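(* Let $\alpha\ge 1$ and consider the game on $\mathbb{Z}^2$ in which Maker plays $m(t)=t^\alpha$ points on his $t$-th turn and Breaker plays $b(t)$ points on his $t$-th turn, with winning line segments of size $n$. If $b(t)=O(\log t)$ then the game is a Maker win, whereas if $b(t)=\omega(\log t)$ then the game is a Breaker win.
   Context: Let $m,b\colon\mathbb{N}\to\mathbb{N}$ be monotone increasing functions. Two players, Maker and Breaker, play in timesteps $t=1,2,\dots$; in timestep $t$ Maker first claims $m(t)$ previously unclaimed points of $\mathbb{Z}^2$, then Breaker claims $b(t)$ previously unclaimed points of $\mathbb{Z}^2$. A winning line segment is a set of $n$ points claimed by Maker lying on a common straight line (any direction) with no point claimed by Breaker on that line between the first and last of these $n$ points (other points of either player may lie on the line). Let $\tau_n$ be the earliest time by which Maker can guarantee (against every Breaker strategy) to have formed a winning line segment of $n$ points. The game is a Breaker win if $m(\tau_n)=(1-o(1))n$ as $n\to\infty$. The game is a Maker win (with constant $\varepsilon$) if there exists $\varepsilon>0$ such that $m(\tau_n)<(1-\varepsilon)n$ for all sufficiently large $n$. The notation $f=\omega(g)$ means $f(n)/g(n)\to\infty$. *)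

theory Defs
  imports "HOL-Analysis.Analysis" "HOL-Library.Landau_Symbols"
begin

type_synonym point = "int \<times> int"

text \<open>A history lists the completed timesteps in order, each as the pair of the sets claimed by
  Maker and by Breaker; a history of length \<open>t\<close> is followed by Maker's turn in timestep
  \<open>Suc t\<close>.\<close>

type_synonym history = "(point set \<times> point set) list"

definition maker_points :: "history \<Rightarrow> point set" where
  "maker_points h = (\<Union>r\<in>set h. fst r)"

definition breaker_points :: "history \<Rightarrow> point set" where
  "breaker_points h = (\<Union>r\<in>set h. snd r)"

definition claimed :: "history \<Rightarrow> point set" where
  "claimed h = maker_points h \<union> breaker_points h"

definition legal_move :: "nat \<Rightarrow> point set \<Rightarrow> point set \<Rightarrow> bool" where
  "legal_move k C X \<longleftrightarrow> finite X \<and> card X = k \<and> X \<inter> C = {}"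

inductive legal_history :: "(nat \<Rightarrow> nat) \<Rightarrow> (nat \<Rightarrow> nat) \<Rightarrow> history \<Rightarrow> bool"
  for m b :: "nat \<Rightarrow> nat" where
  Nil: "legal_history m b []"
| snoc: "\<lbrakk>legal_history m b h;
          legal_move (m (Suc (length h))) (claimed h) X;
          legal_move (b (Suc (length h))) (claimed h \<union> X) Y\<rbrakk>
         \<Longrightarrow> legal_history m b (h @ [(X, Y)])"

definition maker_strategy ::
  "(nat \<Rightarrow> nat) \<Rightarrow> (nat \<Rightarrow> nat) \<Rightarrow> (history \<Rightarrow> point set) \<Rightarrow> bool" where
  "maker_strategy m b \<sigma> \<longleftrightarrow>
     (\<forall>h. legal_history m b h \<longrightarrow> legal_move (m (Suc (length h))) (claimed h) (\<sigma> h))"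

text \<open>Breaker sees the history and Maker's move in the current timestep.\<close>

definition breaker_strategy ::
  "(nat \<Rightarrow> nat) \<Rightarrow> (nat \<Rightarrow> nat) \<Rightarrow> (history \<Rightarrow> point set \<Rightarrow> point set) \<Rightarrow> bool" where
  "breaker_strategy m b \<beta> \<longleftrightarrow>
     (\<forall>h X. legal_history m b h \<longrightarrow> legal_move (m (Suc (length h))) (claimed h) X \<longrightarrow>
        legal_move (b (Suc (length h))) (claimed h \<union> X) (\<beta> h X))"

primrec play ::
  "(history \<Rightarrow> point set) \<Rightarrow> (history \<Rightarrow> point set \<Rightarrow> point set) \<Rightarrow> nat \<Rightarrow> history" where
  "play \<sigma> \<beta> 0 = []"
| "play \<sigma> \<beta> (Suc t) =
     (let h = play \<sigma> \<beta> t; X = \<sigma> h in h @ [(X, \<beta> h X)])"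

definition real_point :: "point \<Rightarrow> real \<times> real" where
  "real_point p = (real_of_int (fst p), real_of_int (snd p))"

text \<open>In the following definition \<open>p\<close> and \<open>q\<close> are the first and the last point of the segment.\<close>

definition winning_segment :: "nat \<Rightarrow> point set \<Rightarrow> point set \<Rightarrow> point set \<Rightarrow> bool" where
  "winning_segment n M B S \<longleftrightarrow>
     S \<subseteq> M \<and> finite S \<and> card S = n \<and> collinear (real_point ` S) \<and>
     (\<exists>p\<in>S. \<exists>q\<in>S.
        real_point ` S \<subseteq> closed_segment (real_point p) (real_point q) \<and>
        real_point ` B \<inter> closed_segment (real_point p) (real_point q) = {})"

text \<open>The segment has to be present at the end of Maker's turn in some timestep
  \<open>Suc t \<le> T\<close>, before Breaker's reply in that timestep.\<close>

definition maker_guarantees ::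
  "(nat \<Rightarrow> nat) \<Rightarrow> (nat \<Rightarrow> nat) \<Rightarrow> nat \<Rightarrow> nat \<Rightarrow> bool" where
  "maker_guarantees m b n T \<longleftrightarrow>
     (\<exists>\<sigma>. maker_strategy m b \<sigma> \<and>
       (\<forall>\<beta>. breaker_strategy m b \<beta> \<longrightarrow>
         (\<exists>t<T. let h = play \<sigma> \<beta> t in
            \<exists>S. winning_segment n (maker_points h \<union> \<sigma> h) (breaker_points h) S)))"

text \<open>This is meaningful for \<open>n \<ge> 1\<close> and unbounded \<open>m\<close>: once \<open>m t \<ge> n\<close>, Maker can claim \<open>n\<close>
  points of a line without claimed points, so that the minimum is over a nonempty set.\<close>

definition tau :: "(nat \<Rightarrow> nat) \<Rightarrow> (nat \<Rightarrow> nat) \<Rightarrow> nat \<Rightarrow> nat" where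
  "tau m b n = (LEAST T. maker_guarantees m b n T)"

text \<open>The \<open>o(1)\<close> term may have either sign.\<close>

definition breaker_win :: "(nat \<Rightarrow> nat) \<Rightarrow> (nat \<Rightarrow> nat) \<Rightarrow> bool" where
  "breaker_win m b \<longleftrightarrow>
     (\<exists>e :: nat \<Rightarrow> real. e \<in> o(\<lambda>_. 1) \<and>
       (\<forall>\<^sub>F n in sequentially. real (m (tau m b n)) = (1 - e n) * real n))"

definition maker_win :: "(nat \<Rightarrow> nat) \<Rightarrow> (nat \<Rightarrow> nat) \<Rightarrow> bool" where
  "maker_win m b \<longleftrightarrow>
     (\<exists>\<epsilon>>0. \<forall>\<^sub>F n in sequentially. real (m (tau m b n)) < (1 - \<epsilon>) * real n)"

text \<open>The number \<open>t\<^sup>\<alpha>\<close> of points, rounded down when it is not an integer.\<close>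

definition power_moves :: "real \<Rightarrow> nat \<Rightarrow> nat" where
  "power_moves \<alpha> t = nat \<lfloor>real t powr \<alpha>\<rfloor>"

end

theory Submission
  imports Defs "HOL-Real_Asymp.Real_Asymp"
begin

text \<open>Maker's side is the box game on empty rows. If Breaker claims at most \<open>B\<close> points per timestep, Maker keeps
  \<open>1 + B j\<close> rows untouched with \<open>j\<close> rounds to go and distributes his points evenly over them, so the last
  row collects about \<open>m(t) (1 + 1/2 + \<dots> + 1/r) / B\<close> points, which is of order \<open>m(t)\<close> for \<open>B = O(log t)\<close> and
  \<open>r\<close> about the square root of \<open>t\<close>. His next turn is then spent on that row.

  On Breaker's side, call a segment live if it has no Breaker point and some unclaimed point. A winning
  segment contains a point of Maker's current turn, so its older part was live, and it suffices to keep
  the number of Maker's points on every live segment below \<open>\<epsilon> n / 2\<close>. Breaker always neutralises the \<open>B\<close> live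
  segments with the most points: next to every \<open>g\<close>-th Maker point of such a segment he claims the nearest
  available points on both sides, where \<open>g\<close> is about \<open>\<epsilon> n / 8\<close>. Going back in time from a live segment one adds
  the neutralised segments to a growing family; the average excess over \<open>g\<close> in the family does not
  decrease, except for the points that Maker has placed on the lines of the family. After \<open>i\<close> steps there
  are at most \<open>1 + i B\<close> lines and \<open>i n\<close> points, and summing the Szemeredi-Trotter bound over dyadic ranges
  of \<open>i \<le> n\<close> gives the total \<open>O(n log n / B + n B\<^sup>-\<^sup>1\<^sup>/\<^sup>3)\<close>, which is \<open>o(n)\<close> for \<open>B\<close> growing faster than \<open>log n\<close>. The
  trivial incidence bound does not suffice when \<open>\<alpha> = 1\<close>.\<close>

section \<open>Plane straight-line graphs\<close>

text \<open>The hardest range is \<alpha> = 1, where the game may last about n turns of up to n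
  points. Applied to the n points of a single turn and i B lines, the incidence bound divided by i B
  leaves n^(2/3) (i B)^(-1/3), and the sum over i \<le> n is about n^(4/3) B^(-1/3), useless for B
  near log n. The way out is that Maker's turns are disjoint and the families of lines only grow:
  all turns with i between t and 2 t are merged into one configuration of t n points and 2 t B
  lines, whose share is n^(2/3) t^(1/3) B^(-1/3). These shares grow geometrically, so the last block
  dominates and gives n B^(-1/3). The remaining n / B per block, over log n blocks, produces the
  threshold. Neutralising one segment costs a number of points that depends on \<epsilon> only, so B
  can be a constant fraction of b. Since b must be compared with log n rather than log t, the count
  starts only after about n^(1/(3 \<alpha>)) turns: until then Maker has at most n^(2/3) points,
  eventually below g, while the logarithm of the time is already of order log n.\<close>

lemma ex_min_value:
  fixes f :: "'a \<Rightarrow> 'b :: linorder"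
  assumes "finite A" "A \<noteq> {}"
  shows "\<exists>a\<in>A. \<forall>x\<in>A. f a \<le> f x"
  using arg_min_if_finite(1)[OF assms, of f] arg_min_least[OF assms, of _ f] by blast

type_synonym rpoint = "real \<times> real"

definition slope :: "rpoint \<times> rpoint \<Rightarrow> real" where
  "slope e = (snd (snd e) - snd (fst e)) / (fst (snd e) - fst (fst e))"

text \<open>The ordinate of the whole supporting line: it is affine on all reals, so two edges can
  be compared at abscissae beyond the span of either.\<close>

definition height :: "rpoint \<times> rpoint \<Rightarrow> real \<Rightarrow> real" where
  "height e x = snd (fst e) + slope e * (x - fst (fst e))"

definition spans :: "rpoint \<times> rpoint \<Rightarrow> real \<Rightarrow> bool" where
  "spans e x \<longleftrightarrow> fst (fst e) < x \<and> x < fst (snd e)"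

text \<open>Spans are open intervals, so edges that merely share an endpoint do not cross, whereas
  edges that overlap along a common line do.\<close>

definition crossing :: "rpoint \<times> rpoint \<Rightarrow> rpoint \<times> rpoint \<Rightarrow> bool" where
  "crossing e f \<longleftrightarrow> (\<exists>x. spans e x \<and> spans f x \<and> height e x = height f x)"

definition geometric_graph :: "rpoint set \<Rightarrow> (rpoint \<times> rpoint) set \<Rightarrow> bool" where
  "geometric_graph V E \<longleftrightarrow> finite V \<and> inj_on fst V \<and> E \<subseteq> V \<times> V \<and>
     (\<forall>e\<in>E. fst (fst e) < fst (snd e)) \<and>
     (\<forall>e\<in>E. \<forall>w\<in>V. spans e (fst w) \<longrightarrow> height e (fst w) \<noteq> snd w)"

lemma height_left: "height e (fst (fst e)) = snd (fst e)"
  by (simp add: height_def)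

lemma height_right: "fst (fst e) < fst (snd e) \<Longrightarrow> height e (fst (snd e)) = snd (snd e)"
  by (simp add: height_def slope_def)

lemma height_shift: "height e y = height e x + slope e * (y - x)"
  by (simp add: height_def algebra_simps)

lemma affine_sign_between:
  fixes a b :: "real \<Rightarrow> real"
  assumes "\<And>x y. a y = a x + s * (y - x)" "\<And>x y. b y = b x + r * (y - x)"
    and "a p < b p" "b q < a q"
  shows "\<exists>x. min p q < x \<and> x < max p q \<and> a x = b x"
proof -
  define d where "d = b p - a p"
  define k where "k = (s - r) * (q - p)"
  have bq: "b q - a q = d - k"
    using assms(1)[of q p] assms(2)[of q p] by (simp add: d_def k_def algebra_simps)
  have d: "d > 0" "k > d" using assms(3,4) bq by (auto simp: d_def)
  define t where "t = d / k"
  have t: "0 < t" "t < 1" using d by (auto simp: t_def)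
  have "a (p + t * (q - p)) - b (p + t * (q - p)) = - d + t * k"
    using assms(1)[of "p + t * (q - p)" p] assms(2)[of "p + t * (q - p)" p]
    by (simp add: d_def k_def algebra_simps)
  also have "\<dots> = 0" using d by (simp add: t_def)
  finally have eq: "a (p + t * (q - p)) = b (p + t * (q - p))" by simp
  have ne: "p \<noteq> q" using assms(3,4) by auto
  have "min p q < p + t * (q - p) \<and> p + t * (q - p) < max p q"
  proof (cases "p < q")
    case True
    then have "t * (q - p) > 0" "t * (q - p) < q - p"
      using t mult_strict_right_mono[of t 1 "q - p"] by auto
    then show ?thesis using True by linarith
  next
    case False
    then have "q < p" using ne by simp
    then have "t * (p - q) > 0" "t * (p - q) < p - q"
      using t mult_strict_right_mono[of t 1 "p - q"] by auto
    then have "t * (q - p) < 0" "t * (q - p) > q - p" by (auto simp: algebra_simps)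
    then show ?thesis using \<open>q < p\<close> by linarith
  qed
  then show ?thesis using eq by blast
qed

lemma height_crossing:
  assumes "height e p < height f p" "height f q < height e q"
  shows "\<exists>x. min p q < x \<and> x < max p q \<and> height e x = height f x"
  by (rule affine_sign_between[OF _ _ assms]) (rule height_shift)+

lemma height_order_propagate:
  assumes nc: "\<not> crossing e f"
    and sp: "\<And>x. min p q < x \<Longrightarrow> x < max p q \<Longrightarrow> spans e x \<and> spans f x"
    and lt: "height e p < height f p"
  shows "height e q \<le> height f q"
proof (rule ccontr)
  assume "\<not> ?thesis"
  then obtain x where "min p q < x" "x < max p q" "height e x = height f x"
    using height_crossing[OF lt, of q] by auto
  then show False using nc sp by (auto simp: crossing_def)
qed

definition charges :: "(rpoint \<times> rpoint) set \<Rightarrow> rpoint \<times> rpoint \<Rightarrow> rpoint \<Rightarrow> bool" where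
  "charges E e w \<longleftrightarrow> spans e (fst w) \<and> height e (fst w) < snd w \<and>
     (\<forall>f\<in>E. spans f (fst w) \<longrightarrow> \<not> (height e (fst w) < height f (fst w) \<and> height f (fst w) < snd w))"

lemma charges_unique:
  assumes nc: "\<And>e f. e \<in> E \<Longrightarrow> f \<in> E \<Longrightarrow> e \<noteq> f \<Longrightarrow> \<not> crossing e f"
    and "e \<in> E" "f \<in> E" "charges E e w" "charges E f w"
  shows "e = f"
proof (rule ccontr)
  assume ne: "e \<noteq> f"
  have "height e (fst w) \<noteq> height f (fst w)"
    using nc[OF assms(2,3) ne] assms(4,5) by (auto simp: crossing_def charges_def)
  then show False using assms(2-5) unfolding charges_def by fastforce
qed

text \<open>The edge \<open>e'\<close> is the next one above \<open>e\<close> at their common left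
  endpoint. Since it ends first, the wedge between the two contains a vertex, and its leftmost
  vertex \<open>w\<close> works: an edge separating \<open>w\<close> from \<open>e\<close> would,
  followed to the left, either start at a vertex of the wedge further left, or pass through the
  apex, or leave the apex with a slope strictly between the two.\<close>

lemma charges_exists_left:
  assumes G: "geometric_graph V E"
    and nc: "\<And>e f. e \<in> E \<Longrightarrow> f \<in> E \<Longrightarrow> e \<noteq> f \<Longrightarrow> \<not> crossing e f"
    and e: "e \<in> E" and e': "e' \<in> E" "fst e' = fst e" "slope e < slope e'"
    and adj: "\<And>f. f \<in> E \<Longrightarrow> fst f = fst e \<Longrightarrow> slope e < slope f \<Longrightarrow> slope e' \<le> slope f"
    and short: "fst (snd e') < fst (snd e)"
  shows "\<exists>w\<in>V. charges E e w"
proof -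
  define u where "u = fst (fst e)"
  have fin: "finite V" and inj: "inj_on fst V" and EV: "E \<subseteq> V \<times> V"
    and lr: "\<And>e. e \<in> E \<Longrightarrow> fst (fst e) < fst (snd e)"
    and nv: "\<And>e w. e \<in> E \<Longrightarrow> w \<in> V \<Longrightarrow> spans e (fst w) \<Longrightarrow> height e (fst w) \<noteq> snd w"
    using G by (auto simp: geometric_graph_def)
  have above: "height e x < height e' x" if "u < x" for x
    using that e'(2,3) by (simp add: height_def u_def)
  have hu: "height e u = snd (fst e)" "height e' u = snd (fst e)"
    using e'(2) height_left[of e] height_left[of e'] by (auto simp: u_def)
  \<comment> \<open>The vertices in the wedge; the right endpoint of \<open>e'\<close> is one of
    them.\<close>
  define W where "W = {w \<in> V. u < fst w \<and> fst w \<le> fst (snd e') \<and>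
     height e (fst w) < snd w \<and> snd w \<le> height e' (fst w)}"
  have finW: "finite W" using fin by (simp add: W_def)
  have ue': "u < fst (snd e')" using lr[OF e'(1)] e'(2) by (simp add: u_def)
  have "snd e' \<in> W"
    using above[OF ue'] height_right[OF lr[OF e'(1)]] EV e'(1) ue' by (auto simp: W_def)
  then obtain w where w: "w \<in> W" and wmin: "\<And>w'. w' \<in> W \<Longrightarrow> fst w \<le> fst w'"
    using finW by (metis (no_types, lifting) arg_min_if_finite(1) arg_min_least empty_iff)
  have spe: "spans e x" if "u < x" "x \<le> fst w" for x
    using that w short by (auto simp: spans_def W_def u_def)
  have spe': "spans e' x" if "u < x" "x < fst w" for x
    using that w e'(2) by (auto simp: spans_def W_def u_def)
  have wu: "u < fst w" using w by (simp add: W_def)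
  have "charges E e w"
    unfolding charges_def
  proof (intro conjI ballI impI notI)
    show "spans e (fst w)" using spe wu by simp
    show "height e (fst w) < snd w" using w by (simp add: W_def)
    fix f assume f: "f \<in> E" "spans f (fst w)"
      and btw: "height e (fst w) < height f (fst w) \<and> height f (fst w) < snd w"
    have btw': "height f (fst w) < height e' (fst w)" using btw w by (auto simp: W_def)
    have nef: "\<not> crossing e f" "\<not> crossing f e'"
      using nc[OF e f(1)] nc[OF f(1) e'(1)] btw btw' by auto
    define p where "p = fst f"
    have pw: "fst p < fst w" using f(2) by (simp add: spans_def p_def)
    have spf: "spans f x" if "fst p < x" "x \<le> fst w" for x
      using that f(2) by (auto simp: spans_def p_def)
    \<comment> \<open>Followed to the left from \<open>w\<close>, the edge \<open>f\<close> cannot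
      leave the wedge without crossing \<open>e\<close> or \<open>e'\<close>.\<close>
    have lo: "height e x \<le> height f x" and hi: "height f x \<le> height e' x"
      if "x \<ge> u" "x \<ge> fst p" "x \<le> fst w" for x
    proof -
      show "height e x \<le> height f x"
        by (rule height_order_propagate[OF nef(1) _ conjunct1[OF btw]])
          (use that spe spf in auto)
      show "height f x \<le> height e' x"
        by (rule height_order_propagate[OF nef(2) _ btw'])
          (use that spe' spf in auto)
    qed
    show False
    proof (cases "u < fst p")
      case True
      have pV: "p \<in> V" using f(1) EV by (auto simp: p_def)
      have hp: "height f (fst p) = snd p" by (simp add: p_def height_left)
      have "height e (fst p) \<le> snd p" "snd p \<le> height e' (fst p)"
        using lo[of "fst p"] hi[of "fst p"] True pw hp by auto
      moreover have "height e (fst p) \<noteq> snd p"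
        using nv[OF e pV] spe True pw by auto
      ultimately have "p \<in> W" using pV True pw w by (auto simp: W_def)
      then show False using wmin pw by fastforce
    next
      \<comment> \<open>Here \<open>f\<close> begins at or before the apex and is squeezed through
        it by the two bounds.\<close>
      case False
      then have hfu: "height f u = snd (fst e)"
        using lo[of u] hi[of u] hu wu by auto
      have ueV: "fst e \<in> V" using e EV by auto
      show False
      proof (cases "fst p < u")
        case True
        then have "spans f (fst (fst e))" using spf[of u] wu by (simp add: u_def)
        then show False using nv[OF f(1) ueV] hfu by (simp add: u_def)
      next
        case False2: False
        then have "fst (fst f) = fst (fst e)" using False by (simp add: p_def u_def)
        then have pe: "fst f = fst e"
          using inj ueV f(1) EV by (auto dest!: inj_onD)
        have "slope e * (fst w - u) < slope f * (fst w - u)"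
             "slope f * (fst w - u) < slope e' * (fst w - u)"
          using btw btw' pe e'(2) by (auto simp: height_def u_def)
        then have "slope e < slope f" "slope f < slope e'"
          using wu by (auto simp: mult_less_cancel_right)
        then show False using adj[OF f(1) pe] by simp
      qed
    qed
  qed
  then show ?thesis using w by (auto simp: W_def)
qed

definition reflect :: "rpoint \<Rightarrow> rpoint" where
  "reflect p = (- fst p, snd p)"

definition reflect_edge :: "rpoint \<times> rpoint \<Rightarrow> rpoint \<times> rpoint" where
  "reflect_edge e = (reflect (snd e), reflect (fst e))"

lemma reflect_reflect [simp]: "reflect (reflect p) = p"
  by (simp add: reflect_def)

lemma spans_reflect: "spans (reflect_edge e) x \<longleftrightarrow> spans e (- x)"
  by (auto simp: spans_def reflect_edge_def reflect_def)

lemma slope_reflect: "slope (reflect_edge e) = - slope e"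
proof -
  have "slope (reflect_edge e) = (snd (fst e) - snd (snd e)) / (fst (snd e) - fst (fst e))"
    by (simp add: slope_def reflect_edge_def reflect_def)
  also have "\<dots> = - slope e" by (simp add: slope_def minus_divide_left)
  finally show ?thesis .
qed

lemma height_reflect:
  assumes "fst (fst e) < fst (snd e)"
  shows "height (reflect_edge e) x = height e (- x)"
proof -
  have "height (reflect_edge e) x = snd (snd e) - slope e * (x + fst (snd e))"
    unfolding height_def slope_reflect by (simp add: reflect_edge_def reflect_def)
  also have "\<dots> = height e (- x)"
    using height_shift[of e "- x" "fst (snd e)"] height_right[OF assms]
    by (simp add: algebra_simps)
  finally show ?thesis .
qed

text \<open>The mirror image under x \<mapsto> -x, which swaps the endpoints of an edge, negates
  slopes and preserves what lies above what. At a right endpoint the smaller slope is therefore the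
  higher edge.\<close>

lemma charges_exists_right:
  assumes G: "geometric_graph V E"
    and nc: "\<And>e f. e \<in> E \<Longrightarrow> f \<in> E \<Longrightarrow> e \<noteq> f \<Longrightarrow> \<not> crossing e f"
    and e: "e \<in> E" and e': "e' \<in> E" "snd e' = snd e" "slope e' < slope e"
    and adj: "\<And>f. f \<in> E \<Longrightarrow> snd f = snd e \<Longrightarrow> slope f < slope e \<Longrightarrow> slope f \<le> slope e'"
    and short: "fst (fst e) < fst (fst e')"
  shows "\<exists>w\<in>V. charges E e w"
proof -
  let ?V = "reflect ` V" and ?E = "reflect_edge ` E"
  have lr: "\<And>e. e \<in> E \<Longrightarrow> fst (fst e) < fst (snd e)" and EV: "E \<subseteq> V \<times> V"
    and inj: "inj_on fst V"
    and nv: "\<And>e w. e \<in> E \<Longrightarrow> w \<in> V \<Longrightarrow> spans e (fst w) \<Longrightarrow> height e (fst w) \<noteq> snd w"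
    using G by (auto simp: geometric_graph_def)
  have fr: "fst (reflect p) = - fst p" "snd (reflect p) = snd p" for p
    by (auto simp: reflect_def)
  have "inj_on fst ?V"
  proof (rule inj_onI)
    fix a b assume "a \<in> ?V" "b \<in> ?V" "fst a = fst b"
    then obtain p q where "p \<in> V" "q \<in> V" "a = reflect p" "b = reflect q" "fst p = fst q"
      by (auto simp: fr)
    then show "a = b" using inj by (auto dest: inj_onD)
  qed
  moreover have "?E \<subseteq> ?V \<times> ?V"
    using EV by (auto simp: reflect_edge_def)
  moreover have "\<forall>e\<in>?E. fst (fst e) < fst (snd e)"
    using lr by (auto simp: reflect_edge_def fr)
  moreover have "\<forall>e\<in>?E. \<forall>w\<in>?V. spans e (fst w) \<longrightarrow> height e (fst w) \<noteq> snd w"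
    using nv lr by (auto simp: spans_reflect height_reflect fr)
  ultimately have G': "geometric_graph ?V ?E"
    using G by (auto simp: geometric_graph_def)
  have "crossing e f" if ef: "e \<in> E" "f \<in> E" "crossing (reflect_edge e) (reflect_edge f)" for e f
  proof -
    obtain x where "spans e (- x)" "spans f (- x)" "height e (- x) = height f (- x)"
      using ef by (auto simp: crossing_def spans_reflect height_reflect[OF lr])
    then show ?thesis unfolding crossing_def by blast
  qed
  then have nc': "\<not> crossing e f" if "e \<in> ?E" "f \<in> ?E" "e \<noteq> f" for e f
    using that nc by blast
  have "\<exists>w\<in>?V. charges ?E (reflect_edge e) w"
  proof (rule charges_exists_left[OF G' nc'])
    show "reflect_edge e \<in> ?E" "reflect_edge e' \<in> ?E" using e e'(1) by auto
    show "fst (reflect_edge e') = fst (reflect_edge e)" by (simp add: reflect_edge_def e'(2))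
    show "slope (reflect_edge e) < slope (reflect_edge e')" using e'(3) by (simp add: slope_reflect)
    show "fst (snd (reflect_edge e')) < fst (snd (reflect_edge e))"
      using short by (simp add: reflect_edge_def fr)
    show "slope (reflect_edge e') \<le> slope f"
      if f: "f \<in> ?E" "fst f = fst (reflect_edge e)" "slope (reflect_edge e) < slope f" for f
    proof -
      obtain k where k: "k \<in> E" "f = reflect_edge k" using f(1) by auto
      have "reflect (snd k) = reflect (snd e)" using f(2) k by (simp add: reflect_edge_def)
      then have "snd k = snd e" by (metis reflect_reflect)
      then show ?thesis using adj[OF k(1)] f(3) k(2) by (simp add: slope_reflect)
    qed
  qed
  then obtain w where w: "w \<in> V" "charges ?E (reflect_edge e) (reflect w)" by auto
  have "charges E e w"
    using w(2) lr e by (auto simp: charges_def spans_reflect height_reflect fr)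
  then show ?thesis using w(1) by blast
qed

text \<open>The edges that are topmost at their left or at their right endpoint number at most \<open>2 * card V\<close>. Every
  other edge is charged to a vertex whose downward vertical ray meets it first.\<close>

lemma noncrossing_card_le:
  assumes G: "geometric_graph V E"
    and nc: "\<And>e f. e \<in> E \<Longrightarrow> f \<in> E \<Longrightarrow> e \<noteq> f \<Longrightarrow> \<not> crossing e f"
  shows "card E \<le> 3 * card V"
proof -
  have fin: "finite V" and inj: "inj_on fst V" and EV: "E \<subseteq> V \<times> V"
    and lr: "\<And>e. e \<in> E \<Longrightarrow> fst (fst e) < fst (snd e)"
    using G by (auto simp: geometric_graph_def)
  have finE: "finite E" using fin EV by (meson finite_SigmaI finite_subset)
  \<comment> \<open>Topmost means largest slope at a left endpoint, but smallest slope at a right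
    endpoint.\<close>
  define TL where "TL = {e \<in> E. \<forall>f\<in>E. fst f = fst e \<longrightarrow> slope f \<le> slope e}"
  define TR where "TR = {e \<in> E. \<forall>f\<in>E. snd f = snd e \<longrightarrow> slope e \<le> slope f}"
  have slope_eq: "e = f"
    if e4: "e \<in> E" "f \<in> E" "slope e = slope f" "fst e = fst f \<or> snd e = snd f" for e f
  proof (rule ccontr)
    assume "e \<noteq> f"
    then have "\<not> crossing e f" using nc e4 by blast
    moreover have "height e x = height f x" for x
      using e4(4)
    proof
      assume "fst e = fst f" then show ?thesis using e4(3) by (simp add: height_def)
    next
      assume s: "snd e = snd f"
      then have "height e (fst (snd e)) = height f (fst (snd e))"
        using height_right[OF lr[OF e4(1)]] height_right[OF lr[OF e4(2)]] by simp
      then show ?thesis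
        using height_shift[of e x "fst (snd e)"] height_shift[of f x "fst (snd e)"] e4(3) by simp
    qed
    moreover obtain x where "max (fst (fst e)) (fst (fst f)) < x" "x < min (fst (snd e)) (fst (snd f))"
      using e4(4) lr[OF e4(1)] lr[OF e4(2)] dense[of "max (fst (fst e)) (fst (fst f))" "min (fst (snd e)) (fst (snd f))"]
      by auto
    ultimately show False by (auto simp: crossing_def spans_def)
  qed
  have TL: "card TL \<le> card V"
  proof (rule card_inj_on_le[of fst])
    show "inj_on fst TL"
      by (rule inj_onI, rule slope_eq) (auto simp: TL_def intro: antisym)
  qed (use EV fin in \<open>auto simp: TL_def\<close>)
  have TR: "card TR \<le> card V"
  proof (rule card_inj_on_le[of snd])
    show "inj_on snd TR"
      by (rule inj_onI, rule slope_eq) (auto simp: TR_def intro: antisym)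
  qed (use EV fin in \<open>auto simp: TR_def\<close>)
  have ex: "\<exists>w\<in>V. charges E e w" if e: "e \<in> E - TL - TR" for e
  proof -
    let ?A = "{f \<in> E. fst f = fst e \<and> slope e < slope f}"
    let ?B = "{f \<in> E. snd f = snd e \<and> slope f < slope e}"
    have "\<exists>f\<in>E. fst f = fst e \<and> slope e < slope f" "\<exists>f\<in>E. snd f = snd e \<and> slope f < slope e"
      using e by (auto simp: TL_def TR_def not_le simp del: split_paired_Ex)
    then have "?A \<noteq> {}" "?B \<noteq> {}" by blast+
    moreover have fAB: "finite ?A" "finite ?B" using finE by auto
    ultimately have ex: "\<exists>a\<in>?A. \<forall>f\<in>?A. slope a \<le> slope f" "\<exists>a\<in>?B. \<forall>f\<in>?B. - slope a \<le> - slope f"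
      using ex_min_value[OF fAB(1), of slope] ex_min_value[OF fAB(2), of "\<lambda>f. - slope f"] by blast+
    from ex(1) obtain e' where e': "e' \<in> ?A" "\<forall>f\<in>?A. slope e' \<le> slope f" by blast
    from ex(2) obtain e'' where e'': "e'' \<in> ?B" "\<forall>f\<in>?B. slope f \<le> slope e''"
      unfolding neg_le_iff_le by blast
    consider "fst (snd e') < fst (snd e)" | "fst (fst e) < fst (fst e'')"
      | "fst (snd e) \<le> fst (snd e')" "fst (fst e'') \<le> fst (fst e)" by linarith
    then show ?thesis
    proof cases
      case 1
      show ?thesis
        by (rule charges_exists_left[OF G nc, of e e']) (use e e' 1 in blast)+
    next
      case 2
      show ?thesis
        by (rule charges_exists_right[OF G nc, of e e'']) (use e e'' 2 in blast)+
    next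
      \<comment> \<open>Both upper neighbours of \<open>e\<close> extend over its whole span. One
        starts on \<open>e\<close> and ends above it, the other starts above and ends on it, so they
        swap their order and cross.\<close>
      case 3
      have E: "e \<in> E" "e' \<in> E" "e'' \<in> E" using e e' e'' by auto
      let ?u = "fst (fst e)" and ?v = "fst (snd e)"
      have uv: "?u < ?v" using lr E by auto
      have "slope e'' * (?v - ?u) < slope e * (?v - ?u)" "slope e * (?v - ?u) < slope e' * (?v - ?u)"
        using uv e' e'' by auto
      moreover have "height e'' ?v = height e ?v"
        using height_right[OF lr[OF E(1)]] height_right[OF lr[OF E(3)]] e'' by auto
      moreover have "height e' ?u = height e ?u" using e' by (auto simp: height_def)
      ultimately have "height e' ?u < height e'' ?u" "height e'' ?v < height e' ?v"
        using height_shift[of e'' ?v ?u] height_shift[of e' ?v ?u] height_shift[of e ?v ?u] by auto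
      then obtain x where x: "min ?u ?v < x" "x < max ?u ?v" "height e' x = height e'' x"
        using height_crossing by blast
      have "crossing e' e''"
        unfolding crossing_def spans_def using x uv 3 e' e'' by (intro exI[of _ x]) auto
      then have "e' = e''" using nc E by blast
      then show ?thesis using e' e'' by auto
    qed
  qed
  define c where "c e = (SOME w. w \<in> V \<and> charges E e w)" for e
  have c: "c e \<in> V" "charges E e (c e)" if "e \<in> E - TL - TR" for e
    using someI_ex[of "\<lambda>w. w \<in> V \<and> charges E e w"] ex[OF that] by (auto simp: c_def)
  have "card (E - TL - TR) \<le> card V"
  proof (rule card_inj_on_le[of c])
    show "inj_on c (E - TL - TR)"
      using c charges_unique[OF nc] by (intro inj_onI) (metis DiffD1)
  qed (use c fin in auto)
  moreover have "card E \<le> card (E - TL - TR) + card TL + card TR"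
  proof -
    have "card E = card ((E - TL - TR) \<union> TL \<union> TR)"
      by (rule arg_cong[where f = card]) (auto simp: TL_def TR_def)
    then show ?thesis
      using card_Un_le[of "(E - TL - TR) \<union> TL" TR] card_Un_le[of "E - TL - TR" TL] by linarith
  qed
  ultimately show ?thesis using TL TR by linarith
qed

text \<open>Deleting the first edge of every crossing pair leaves a crossing-free graph. The pairs
  are ordered, so each crossing is counted twice, which costs only a constant.\<close>

lemma card_edges_le_crossings:
  assumes G: "geometric_graph V E"
  shows "card E \<le> 3 * card V + card {(e, f) \<in> E \<times> E. e \<noteq> f \<and> crossing e f}"
proof -
  define C where "C = {(e, f) \<in> E \<times> E. e \<noteq> f \<and> crossing e f}"
  have "E \<subseteq> V \<times> V" "finite V" using G by (auto simp: geometric_graph_def)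
  then have finE: "finite E" by (meson finite_SigmaI finite_subset)
  have finC: "finite C"
    by (rule finite_subset[of _ "E \<times> E"]) (use finE in \<open>auto simp: C_def\<close>)
  have "geometric_graph V (E - fst ` C)" using G by (auto simp: geometric_graph_def)
  then have "card (E - fst ` C) \<le> 3 * card V"
  proof (rule noncrossing_card_le)
    fix e f assume "e \<in> E - fst ` C" "f \<in> E - fst ` C" "e \<noteq> f"
    then have "(e, f) \<notin> C" "e \<in> E" "f \<in> E" by (metis DiffD2 fst_conv imageI, auto)
    then show "\<not> crossing e f" using \<open>e \<noteq> f\<close> by (simp add: C_def)
  qed
  moreover have "card (E - fst ` C) \<ge> card E - card (fst ` C)" by (rule diff_card_le_card_Diff) (use finC in auto)
  moreover have "card (fst ` C) \<le> card C" by (rule card_image_le[OF finC])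
  ultimately show ?thesis unfolding C_def by linarith
qed

section \<open>The Szemeredi-Trotter bound\<close>

text \<open>If every element of V is kept independently with probability p, then A survives with
  probability p^|A|. This and the following lemma replace a probability space by finite weighted
  sums.\<close>

lemma sum_sample_weights:
  fixes p :: real
  assumes V: "finite V" and A: "A \<subseteq> V"
  shows "(\<Sum>S\<in>Pow V. if A \<subseteq> S then p ^ card S * (1 - p) ^ card (V - S) else 0) = p ^ card A"
proof -
  \<comment> \<open>The factor 0 on A kills every S that misses a point of A, so the restricted sum
    becomes the expansion of one product.\<close>
  let ?g = "\<lambda>x. if x \<in> A then 0 else 1 - p"
  have "(\<Sum>S\<in>Pow V. if A \<subseteq> S then p ^ card S * (1 - p) ^ card (V - S) else 0)
      = (\<Sum>S\<in>Pow V. (\<Prod>x\<in>S. p) * (\<Prod>x\<in>V - S. ?g x))"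
  proof (rule sum.cong[OF refl])
    fix S assume "S \<in> Pow V"
    show "(if A \<subseteq> S then p ^ card S * (1 - p) ^ card (V - S) else 0) = (\<Prod>x\<in>S. p) * (\<Prod>x\<in>V - S. ?g x)"
    proof (cases "A \<subseteq> S")
      case True
      have "(\<Prod>x\<in>V - S. ?g x) = (\<Prod>x\<in>V - S. 1 - p)"
        by (rule prod.cong) (use True in auto)
      then show ?thesis using True by simp
    next
      case False
      then have "(\<Prod>x\<in>V - S. ?g x) = 0" using A V by (intro prod_zero) auto
      then show ?thesis using False by simp
    qed
  qed
  also have "\<dots> = (\<Prod>x\<in>V. p + ?g x)" by (rule prod_add[OF V, symmetric])
  also have "\<dots> = (\<Prod>x\<in>A. p + ?g x) * (\<Prod>x\<in>V - A. p + ?g x)"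
    by (subst prod.subset_diff[OF A V]) (rule mult.commute)
  also have "\<dots> = p ^ card A" by simp
  finally show ?thesis .
qed

text \<open>Linearity of expectation for the number of structures whose vertices all survive the
  sampling.\<close>

lemma sum_sample_card:
  fixes p :: real
  assumes V: "finite V" and T: "finite T" and A: "\<And>x. x \<in> T \<Longrightarrow> A x \<subseteq> V"
  shows "(\<Sum>S\<in>Pow V. p ^ card S * (1 - p) ^ card (V - S) * real (card {x \<in> T. A x \<subseteq> S}))
         = (\<Sum>x\<in>T. p ^ card (A x))"
proof -
  have "real (card {x \<in> T. A x \<subseteq> S}) = (\<Sum>x\<in>T. if A x \<subseteq> S then 1 else 0)" for S
    using T by (simp add: sum.If_cases Int_def)
  then have "(\<Sum>S\<in>Pow V. p ^ card S * (1 - p) ^ card (V - S) * real (card {x \<in> T. A x \<subseteq> S}))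
     = (\<Sum>S\<in>Pow V. \<Sum>x\<in>T. if A x \<subseteq> S then p ^ card S * (1 - p) ^ card (V - S) else 0)"
    by (auto simp: sum_distrib_left intro!: sum.cong)
  also have "\<dots> = (\<Sum>x\<in>T. \<Sum>S\<in>Pow V. if A x \<subseteq> S then p ^ card S * (1 - p) ^ card (V - S) else 0)"
    by (rule sum.swap)
  also have "\<dots> = (\<Sum>x\<in>T. p ^ card (A x))"
    by (intro sum.cong refl sum_sample_weights[OF V] A)
  finally show ?thesis .
qed

text \<open>Equal slopes would put both edges on one line, where an endpoint of one would lie inside
  the other. With different slopes the supporting lines meet only at the crossing, which is interior
  to both. This is what makes a crossing survive the sampling with probability p^4.\<close>

lemma crossing_distinct_endpoints:
  assumes G: "geometric_graph V E" and E: "e \<in> E" "f \<in> E" "e \<noteq> f" and c: "crossing e f"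
  shows "card {fst e, snd e, fst f, snd f} = 4"
proof -
  have inj: "inj_on fst V" and EV: "E \<subseteq> V \<times> V"
    and lr: "\<And>e. e \<in> E \<Longrightarrow> fst (fst e) < fst (snd e)"
    and nv: "\<And>e w. e \<in> E \<Longrightarrow> w \<in> V \<Longrightarrow> spans e (fst w) \<Longrightarrow> height e (fst w) \<noteq> snd w"
    using G by (auto simp: geometric_graph_def)
  obtain x where x: "spans e x" "spans f x" "height e x = height f x"
    using c by (auto simp: crossing_def)
  have V: "fst e \<in> V" "snd e \<in> V" "fst f \<in> V" "snd f \<in> V" using E EV by auto
  have ne: "slope e \<noteq> slope f"
  proof
    assume "slope e = slope f"
    then have h: "height e y = height f y" for y
      using height_shift[of e y x] height_shift[of f y x] x(3) by simp
    have "\<not> spans e (fst (fst f))" "\<not> spans f (fst (fst e))"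
         "\<not> spans e (fst (snd f))" "\<not> spans f (fst (snd e))"
      using nv[OF E(1) V(3)] nv[OF E(2) V(1)] nv[OF E(1) V(4)] nv[OF E(2) V(2)] h
        height_left[of e] height_left[of f] height_right[OF lr[OF E(1)]] height_right[OF lr[OF E(2)]]
      by auto
    then have "fst (fst e) = fst (fst f)" "fst (snd e) = fst (snd f)"
      using x by (auto simp: spans_def)
    then have "fst e = fst f" "snd e = snd f" using inj V by (auto dest: inj_onD)
    then show False using E(3) by (simp add: prod_eq_iff)
  qed
  have agree: "y = x" if "height e y = height f y" for y
  proof -
    have "slope e * (y - x) = slope f * (y - x)"
      using that height_shift[of e y x] height_shift[of f y x] x(3) by simp
    then show ?thesis using ne by simp
  qed
  have "fst e \<noteq> fst f"
    using agree[of "fst (fst e)"] height_left[of e] height_left[of f] x by (auto simp: spans_def)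
  moreover have "snd e \<noteq> snd f"
    using agree[of "fst (snd e)"] height_right[OF lr[OF E(1)]] height_right[OF lr[OF E(2)]] x
    by (auto simp: spans_def)
  moreover have "fst e \<noteq> snd e" "fst f \<noteq> snd f" using lr[OF E(1)] lr[OF E(2)] by auto
  moreover have "fst e \<noteq> snd f" "snd e \<noteq> fst f" using x by (auto simp: spans_def)
  ultimately show ?thesis by auto
qed

text \<open>The expectation of the weak linear bound over the induced subgraph of a random vertex
  set. The parameter p stays free, to be optimised once the number of edges is known.\<close>

lemma crossing_lemma:
  fixes p :: real
  assumes G: "geometric_graph V E" and p: "0 \<le> p" "p \<le> 1"
  shows "p ^ 2 * card E \<le> 3 * p * card V
           + p ^ 4 * card {(e, f) \<in> E \<times> E. e \<noteq> f \<and> crossing e f}"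
proof -
  define C where "C = {(e, f) \<in> E \<times> E. e \<noteq> f \<and> crossing e f}"
  let ?w = "\<lambda>S. p ^ card S * (1 - p) ^ card (V - S)"
  let ?A = "\<lambda>e. {fst e, snd e}" and ?B = "\<lambda>c. {fst (fst c), snd (fst c), fst (snd c), snd (snd c)}"
  have V: "finite V" and EV: "E \<subseteq> V \<times> V" and lr: "\<And>e. e \<in> E \<Longrightarrow> fst (fst e) < fst (snd e)"
    using G by (auto simp: geometric_graph_def)
  have finE: "finite E" using V EV by (meson finite_SigmaI finite_subset)
  have finC: "finite C"
    by (rule finite_subset[of _ "E \<times> E"]) (use finE in \<open>auto simp: C_def\<close>)
  have le: "real (card {e \<in> E. ?A e \<subseteq> S}) \<le> 3 * real (card {v \<in> V. {v} \<subseteq> S}) + real (card {c \<in> C. ?B c \<subseteq> S})"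
    if S: "S \<in> Pow V" for S
  proof -
    let ?E = "{e \<in> E. ?A e \<subseteq> S}"
    have SV: "S \<subseteq> V" "finite S" using S V by (auto intro: finite_subset)
    have "inj_on fst S" using SV G inj_on_subset[of fst V S] by (auto simp: geometric_graph_def)
    moreover have "?E \<subseteq> S \<times> S" by (auto simp: mem_Times_iff)
    ultimately have "geometric_graph S ?E"
      using SV G unfolding geometric_graph_def by blast
    from card_edges_le_crossings[OF this]
    have "card ?E \<le> 3 * card S + card {(e, f) \<in> ?E \<times> ?E. e \<noteq> f \<and> crossing e f}" .
    moreover have "{(e, f) \<in> ?E \<times> ?E. e \<noteq> f \<and> crossing e f} = {c \<in> C. ?B c \<subseteq> S}"
      by (auto simp: C_def)
    moreover have "{v \<in> V. {v} \<subseteq> S} = S" using S by auto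
    ultimately have "card ?E \<le> 3 * card {v \<in> V. {v} \<subseteq> S} + card {c \<in> C. ?B c \<subseteq> S}" by simp
    then show ?thesis by linarith
  qed
  have "(\<Sum>e\<in>E. p ^ card (?A e)) = (\<Sum>S\<in>Pow V. ?w S * card {e \<in> E. ?A e \<subseteq> S})"
    by (rule sum_sample_card[OF V finE, symmetric]) (use EV in auto)
  also have "\<dots> \<le> (\<Sum>S\<in>Pow V. ?w S * (3 * real (card {v \<in> V. {v} \<subseteq> S}) + real (card {c \<in> C. ?B c \<subseteq> S})))"
    by (intro sum_mono mult_left_mono le) (use p in auto)
  also have "\<dots> = 3 * (\<Sum>S\<in>Pow V. ?w S * real (card {v \<in> V. {v} \<subseteq> S})) + (\<Sum>S\<in>Pow V. ?w S * real (card {c \<in> C. ?B c \<subseteq> S}))"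
    by (simp add: distrib_left sum.distrib sum_distrib_left mult_ac)
  also have "(\<Sum>S\<in>Pow V. ?w S * real (card {v \<in> V. {v} \<subseteq> S})) = (\<Sum>v\<in>V. p ^ card {v})"
    by (rule sum_sample_card[OF V V]) auto
  also have "(\<Sum>S\<in>Pow V. ?w S * real (card {c \<in> C. ?B c \<subseteq> S})) = (\<Sum>c\<in>C. p ^ card (?B c))"
    by (rule sum_sample_card[OF V finC]) (use EV in \<open>auto simp: C_def\<close>)
  also have "(\<Sum>c\<in>C. p ^ card (?B c)) = (\<Sum>c\<in>C. p ^ 4)"
    by (rule sum.cong[OF refl], rule arg_cong[where f = "\<lambda>k. p ^ k"], rule crossing_distinct_endpoints[OF G])
      (auto simp: C_def)
  also have "(\<Sum>e\<in>E. p ^ card (?A e)) = (\<Sum>e\<in>E. p ^ 2)"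
  proof (rule sum.cong[OF refl])
    fix e assume "e \<in> E"
    then have "fst e \<noteq> snd e" using lr[of e] by auto
    then show "p ^ card (?A e) = p ^ 2" by (simp add: power2_eq_square)
  qed
  finally show ?thesis unfolding C_def by (simp add: mult_ac)
qed

section \<open>Incidences of points with non-vertical lines, given by slope and intercept\<close>

definition on_line :: "real \<times> real \<Rightarrow> rpoint \<Rightarrow> bool" where
  "on_line l p \<longleftrightarrow> snd p = fst l * fst p + snd l"

definition incidences :: "rpoint set \<Rightarrow> (real \<times> real) set \<Rightarrow> nat" where
  "incidences P L = (\<Sum>l\<in>L. card {p \<in> P. on_line l p})"

lemma on_line_unique:
  assumes "on_line l p" "on_line l q" "on_line k p" "on_line k q" "fst p \<noteq> fst q"
  shows "l = k"
proof -
  have "(fst l - fst k) * (fst p - fst q) = 0" using assms by (auto simp: on_line_def algebra_simps)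
  then have "fst l = fst k" using assms(5) by simp
  then show ?thesis using assms by (auto simp: on_line_def prod_eq_iff)
qed

text \<open>The part on l of the graph in Szekely's proof of the incidence bound.\<close>

definition line_edges :: "rpoint set \<Rightarrow> real \<times> real \<Rightarrow> (rpoint \<times> rpoint) set" where
  "line_edges P l = {(p, q) \<in> P \<times> P. on_line l p \<and> on_line l q \<and> fst p < fst q \<and>
      (\<forall>r\<in>P. on_line l r \<longrightarrow> \<not> (fst p < fst r \<and> fst r < fst q))}"

text \<open>Every incident point except the rightmost one is the left endpoint of an edge.\<close>

lemma card_line_edges:
  assumes P: "finite P" "inj_on fst P"
  shows "card {p \<in> P. on_line l p} \<le> card (line_edges P l) + 1"
proof -
  let ?Q = "{p \<in> P. on_line l p}"
  let ?N = "{p \<in> ?Q. \<exists>q\<in>?Q. fst p < fst q}"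
  have finQ: "finite ?Q" using P by auto
  have fE: "finite (line_edges P l)"
    by (rule finite_subset[of _ "P \<times> P"]) (use P in \<open>auto simp: line_edges_def\<close>)
  have "?N \<subseteq> fst ` line_edges P l"
  proof
    fix p assume p: "p \<in> ?N"
    let ?U = "{q \<in> ?Q. fst p < fst q}"
    have U: "finite ?U" "?U \<noteq> {}" using finite_subset[OF _ finQ, of ?U] p by auto
    let ?q = "arg_min_on fst ?U"
    have "?q \<in> ?U" using arg_min_if_finite(1)[OF U] .
    moreover have "fst ?q \<le> fst r" if "r \<in> ?U" for r using arg_min_least[OF U that] .
    ultimately have "(p, ?q) \<in> line_edges P l"
      using p unfolding line_edges_def by force
    then show "p \<in> fst ` line_edges P l" by force
  qed
  then have "card ?N \<le> card (line_edges P l)" using fE by (rule surj_card_le[rotated])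
  moreover have "card (?Q - ?N) \<le> 1"
  proof -
    have "p = q" if "p \<in> ?Q - ?N" "q \<in> ?Q - ?N" for p q
    proof -
      have "p \<in> ?Q" "q \<in> ?Q" "\<not> fst p < fst q" "\<not> fst q < fst p" using that by blast+
      then have "fst p = fst q" by linarith
      then show ?thesis using that P(2) by (auto dest: inj_onD)
    qed
    moreover have "finite (?Q - ?N)" using finQ by blast
    ultimately show ?thesis unfolding One_nat_def by (subst card_le_Suc0_iff_eq) blast+
  qed
  moreover have "card ?Q = card (?N \<union> (?Q - ?N))" by (rule arg_cong[where f = card]) blast
  then have "card ?Q \<le> card ?N + card (?Q - ?N)" using card_Un_le[of ?N "?Q - ?N"] by linarith
  ultimately show ?thesis by linarith
qed

lemma line_edges_height:
  assumes "e \<in> line_edges P l"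
  shows "height e x = fst l * x + snd l"
proof -
  obtain p q where e: "e = (p, q)" "snd p = fst l * fst p + snd l" "snd q = fst l * fst q + snd l"
    "fst p < fst q"
    using assms by (auto simp: line_edges_def on_line_def)
  have "slope e = fst l" using e by (simp add: slope_def field_simps)
  then show ?thesis using e by (simp add: height_def algebra_simps)
qed

text \<open>Here e is the number of edges of the graph formed by all lines. Two distinct lines meet
  at most once, so the crossings are bounded by the ordered pairs of lines. The existential over e
  stands outside the quantifier over p, so that p may be chosen depending on e.\<close>

lemma incidences_le_parameter:
  assumes P: "finite P" "inj_on fst P" and L: "finite L"
  shows "\<exists>e::nat. incidences P L \<le> card L + e \<and>
           (\<forall>p::real. 0 \<le> p \<longrightarrow> p \<le> 1 \<longrightarrow>
              p ^ 2 * real e \<le> 3 * p * card P + p ^ 4 * (real (card L))\<^sup>2)"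
proof -
  define E where "E = (\<Union>l\<in>L. line_edges P l)"
  define C where "C = {(e, f) \<in> E \<times> E. e \<noteq> f \<and> crossing e f}"
  have G: "geometric_graph P E"
    unfolding geometric_graph_def
  proof (intro conjI ballI impI notI)
    show "E \<subseteq> P \<times> P" by (auto simp: E_def line_edges_def)
    show "fst (fst e) < fst (snd e)" if "e \<in> E" for e using that by (auto simp: E_def line_edges_def)
    fix e w assume *: "e \<in> E" "w \<in> P" "spans e (fst w)" "height e (fst w) = snd w"
    then obtain l where l: "l \<in> L" "e \<in> line_edges P l" by (auto simp: E_def)
    then have "on_line l w" using *(4) line_edges_height[OF l(2)] by (simp add: on_line_def)
    then show False using *(2,3) l(2) by (auto simp: line_edges_def spans_def)
  qed (use P in auto)
  have disj: "line_edges P l \<inter> line_edges P k = {}" if "l \<noteq> k" for l k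
  proof -
    have False if e: "e \<in> line_edges P l" "e \<in> line_edges P k" for e
      using on_line_unique[of l "fst e" "snd e" k] e \<open>l \<noteq> k\<close> by (auto simp: line_edges_def)
    then show ?thesis by blast
  qed
  have fE: "finite (line_edges P l)" for l
    by (rule finite_subset[of _ "P \<times> P"]) (use P in \<open>auto simp: line_edges_def\<close>)
  have finE: "finite E" using L fE by (auto simp: E_def)
  have "incidences P L \<le> (\<Sum>l\<in>L. card (line_edges P l) + 1)"
    unfolding incidences_def by (intro sum_mono card_line_edges P)
  also have "\<dots> = card L + (\<Sum>l\<in>L. card (line_edges P l))"
    by (subst sum.distrib) simp
  also have "(\<Sum>l\<in>L. card (line_edges P l)) = card E"
    unfolding E_def by (rule card_UN_disjoint[symmetric]) (use L fE disj in auto)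
  finally have inc: "incidences P L \<le> card L + card E" .
  have one_line: "\<exists>l. l \<in> L \<and> e \<in> line_edges P l" if "e \<in> E" for e using that by (auto simp: E_def)
  then obtain g where g: "\<And>e. e \<in> E \<Longrightarrow> g e \<in> L \<and> e \<in> line_edges P (g e)" by metis
  have same_line: "\<not> crossing e f" if "e \<in> line_edges P l" "f \<in> line_edges P l" "e \<noteq> f" for e f l
  proof
    assume "crossing e f"
    then obtain x where x: "spans e x" "spans f x" by (auto simp: crossing_def)
    obtain a b c d where ef: "e = (a, b)" "f = (c, d)" by (cases e, cases f)
    have "a \<in> P" "b \<in> P" "c \<in> P" "d \<in> P" using that ef by (auto simp: line_edges_def)
    moreover have "\<not> (fst a < fst c \<and> fst c < fst b)" "\<not> (fst a < fst d \<and> fst d < fst b)"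
      "\<not> (fst c < fst a \<and> fst a < fst d)" "\<not> (fst c < fst b \<and> fst b < fst d)"
      using that ef by (auto simp: line_edges_def)
    then have "fst a = fst c" "fst b = fst d" using x ef by (auto simp: spans_def)
    ultimately show False using that(3) ef P(2) by (auto dest: inj_onD)
  qed
  have uniq: "e = e'" if "e \<in> line_edges P l" "e' \<in> line_edges P l" "spans e x" "spans e' x" for e e' l x
    using same_line[OF that(1,2)] that line_edges_height[OF that(1)] line_edges_height[OF that(2)]
    by (auto simp: crossing_def)
  have "card C \<le> card (L \<times> L)"
  \<comment> \<open>The pair of lines determines the crossing point, and on each line at most one
    edge has that point in its interior.\<close>
  proof (rule card_inj_on_le[of "\<lambda>(e, f). (g e, g f)"])
    show "inj_on (\<lambda>(e, f). (g e, g f)) C"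
    proof (rule inj_onI, clarify)
      fix e f e' f' assume *: "(e, f) \<in> C" "(e', f') \<in> C" "g e = g e'" "g f = g f'"
      then have E: "e \<in> E" "f \<in> E" "e' \<in> E" "f' \<in> E" by (auto simp: C_def)
      obtain x x' where x: "spans e x" "spans f x" "height e x = height f x"
        and x': "spans e' x'" "spans f' x'" "height e' x' = height f' x'"
        using * by (auto simp: C_def crossing_def)
      have ne: "g e \<noteq> g f" 
      proof
        assume eq: "g e = g f"
        have "e \<noteq> f" "crossing e f" using *(1) by (auto simp: C_def)
        then show False using same_line[of e "g e" f] g[OF E(1)] g[OF E(2)] eq by auto
      qed
      have h: "height e y = fst (g e) * y + snd (g e)" "height f y = fst (g f) * y + snd (g f)"
        "height e' y = fst (g e) * y + snd (g e)" "height f' y = fst (g f) * y + snd (g f)" for y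
        using g E *(3,4) line_edges_height by metis+
      have "x = x'"
      proof (rule ccontr)
        assume "x \<noteq> x'"
        then have "g e = g f"
          using on_line_unique[of "g e" "(x, height e x)" "(x', height e x')" "g f"] x(3) x'(3)
          by (simp add: on_line_def h)
        then show False using ne by simp
      qed
      then show "e = e' \<and> f = f'"
        using uniq[of e "g e" e' x] uniq[of f "g f" f' x] g[OF E(1)] g[OF E(2)] g[OF E(3)] g[OF E(4)]
          *(3,4) x x' by auto
    qed
  qed (use L g in \<open>auto simp: C_def\<close>)
  then have "real (card C) \<le> (real (card L))\<^sup>2"
    by (simp add: card_cartesian_product power2_eq_square flip: of_nat_mult)
  then have "p ^ 2 * card E \<le> 3 * p * card P + p ^ 4 * (real (card L))\<^sup>2"
    if "0 \<le> p" "p \<le> 1" for p :: real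
    using crossing_lemma[OF G that] mult_left_mono[of "real (card C)" "(real (card L))\<^sup>2" "p ^ 4"]
    unfolding C_def by fastforce
  then show ?thesis using inc by blast
qed

theorem szemeredi_trotter:
  assumes P: "finite P" "inj_on fst P" and L: "finite L"
  shows "real (incidences P L) \<le> card L + 6 * card P + 5 * (real (card P) * real (card L)) powr (2/3)"
proof (cases "P = {}")
  case True
  then show ?thesis by (simp add: incidences_def)
next
  case False
  obtain e :: nat where e: "incidences P L \<le> card L + e"
    and ep: "\<And>p::real. 0 \<le> p \<Longrightarrow> p \<le> 1 \<Longrightarrow>
              p ^ 2 * real e \<le> 3 * p * card P + p ^ 4 * (real (card L))\<^sup>2"
    using incidences_le_parameter[OF P L] by blast
  define N s where "N = real (card P)" and "s = real (card L)"
  have N0: "N > 0" using False P by (simp add: N_def card_gt_0_iff)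
  have "real e \<le> 6 * N + 5 * (N * s) powr (2/3)"
  proof (cases "real e \<le> 6 * N")
    case large: False
    then have e0: "real e > 6 * N" "real e > 0" by (auto simp: N_def)
    \<comment> \<open>This choice makes 3 p N equal to half of p^2 e. It is at most 1 because the
      case e \<le> 6 N is absorbed by the linear term.\<close>
    define p where "p = 6 * N / e"
    have p: "0 \<le> p" "p \<le> 1" using e0 by (auto simp: p_def N_def)
    have "3 * p * N = p ^ 2 * e / 2" using e0 by (simp add: p_def power2_eq_square field_simps)
    then have "p ^ 2 * e / 2 \<le> p ^ 4 * s\<^sup>2" using ep[OF p] by (simp add: N_def s_def)
    have "real e ^ 3 \<le> 72 * (N * s)\<^sup>2"
    proof -
      have "p > 0" using e0 N0 by (auto simp: p_def)
      have "p ^ 2 * (e / 2) \<le> p ^ 2 * (p ^ 2 * s\<^sup>2)"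
        using \<open>p ^ 2 * e / 2 \<le> p ^ 4 * s\<^sup>2\<close> by (simp add: power_add[symmetric] mult.assoc[symmetric])
      then have "e / 2 \<le> p ^ 2 * s\<^sup>2"
        by (rule mult_left_le_imp_le) (use \<open>p > 0\<close> in simp)
      then show ?thesis using e0 by (simp add: p_def field_simps power2_eq_square power3_eq_cube)
    qed
    \<comment> \<open>The constant 5 comes from 72 \<le> 5^3.\<close>
    also have "\<dots> \<le> (5 * (N * s) powr (2/3)) ^ 3"
    proof -
      have "((N * s) powr (2/3)) ^ 3 = (N * s)\<^sup>2"
      proof (cases "N * s = 0")
        case False
        moreover have "N * s \<ge> 0" by (simp add: N_def s_def)
        ultimately have "N * s > 0" by linarith
        define x where "x = N * s"
        have x: "x > 0" using \<open>N * s > 0\<close> by (simp add: x_def)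
        then have "(x powr (2/3)) ^ 3 = (x powr (2/3)) powr real 3" by (subst powr_realpow) auto
        also have "\<dots> = x powr real 2" by (simp add: powr_powr)
        also have "\<dots> = x\<^sup>2" using x by (rule powr_realpow)
        finally show ?thesis by (simp add: x_def)
      qed auto
      then show ?thesis by (simp add: power_mult_distrib)
    qed
    finally have "real e \<le> 5 * (N * s) powr (2/3)" by (subst (asm) power_mono_iff) auto
    then show ?thesis by (simp add: N_def)
  qed (use powr_ge_zero[of "N * s" "2/3"] in linarith)
  then show ?thesis using e unfolding N_def s_def by linarith
qed

section \<open>Live segments\<close>

text \<open>As \<open>sqrt 2\<close> is irrational, \<open>kappa\<close> is injective on lattice points. In the coordinates given by \<open>emb\<close> no line
  through two lattice points is vertical, and \<open>kappa\<close> orders the lattice points of each line.\<close>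

definition kappa :: "point \<Rightarrow> real" where
  "kappa p = real_of_int (fst p) + sqrt 2 * real_of_int (snd p)"

definition emb :: "point \<Rightarrow> rpoint" where
  "emb p = (kappa p, real_of_int (snd p))"

lemma sqrt_2_irrational: "sqrt 2 * real_of_int b = real_of_int a \<Longrightarrow> b = 0"
proof (rule ccontr)
  assume eq: "sqrt 2 * real_of_int b = real_of_int a" and b: "b \<noteq> 0"
  have "2 * (real_of_int b)\<^sup>2 = (real_of_int a)\<^sup>2"
    by (subst eq[symmetric]) (simp add: power_mult_distrib)
  then have "real_of_int (2 * b\<^sup>2) = real_of_int (a\<^sup>2)" by simp
  then have ab: "2 * b\<^sup>2 = a\<^sup>2" by (simp only: of_int_eq_iff)
  then have a: "a \<noteq> 0" using b by auto
  have "multiplicity 2 (2 * b\<^sup>2) = multiplicity 2 (2::int) + 2 * multiplicity 2 b"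
    using b by (subst prime_elem_multiplicity_mult_distrib) (auto simp: prime_elem_multiplicity_power_distrib)
  moreover have "multiplicity 2 (a\<^sup>2) = 2 * multiplicity 2 a"
    using a by (simp add: prime_elem_multiplicity_power_distrib)
  moreover have "multiplicity 2 (2::int) = 1" by simp
  ultimately have "1 + 2 * multiplicity 2 b = 2 * multiplicity 2 a" unfolding ab by linarith
  then show False by presburger
qed

lemma inj_kappa: "inj kappa"
proof (rule injI)
  fix p q assume "kappa p = kappa q"
  then have "sqrt 2 * real_of_int (snd q - snd p) = real_of_int (fst p - fst q)"
    by (simp add: kappa_def algebra_simps)
  then have "snd q - snd p = 0" by (rule sqrt_2_irrational)
  then show "p = q" using \<open>kappa p = kappa q\<close> by (simp add: kappa_def prod_eq_iff)
qed

lemma kappa_eq_iff [simp]: "kappa p = kappa q \<longleftrightarrow> p = q"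
  using inj_kappa by (auto dest: injD)

lemma fst_emb [simp]: "fst (emb p) = kappa p" and snd_emb [simp]: "snd (emb p) = real_of_int (snd p)"
  by (simp_all add: emb_def)

lemma ex_line:
  assumes "p \<noteq> q"
  shows "\<exists>l. on_line l (emb p) \<and> on_line l (emb q)"
proof -
  define a where "a = (real_of_int (snd q) - real_of_int (snd p)) / (kappa q - kappa p)"
  have "a * (kappa q - kappa p) = real_of_int (snd q) - real_of_int (snd p)"
    using assms by (simp add: a_def)
  then have "on_line (a, real_of_int (snd p) - a * kappa p) (emb p)
      \<and> on_line (a, real_of_int (snd p) - a * kappa p) (emb q)"
    by (simp add: on_line_def algebra_simps)
  then show ?thesis by blast
qed

text \<open>A line with an interval of \<open>kappa\<close> values. The bounds need not be attained
  at lattice points, so different triples may describe the same set of points.\<close>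

type_synonym lseg = "(real \<times> real) \<times> real \<times> real"

fun seg :: "lseg \<Rightarrow> point set" where
  "seg (l, u, v) = {p. on_line l (emb p) \<and> u \<le> kappa p \<and> kappa p \<le> v}"

text \<open>A bounded range of \<open>kappa\<close> can contain infinitely many lattice points of
  the plane, but on a fixed line it bounds the second coordinate and with it the first.\<close>

lemma finite_seg: "finite (seg x)"
proof -
  obtain l u v where x: "x = (l, u, v)" by (cases x)
  obtain a c where l: "l = (a, c)" by (cases l)
  define K where "K = \<bar>a\<bar> * (\<bar>u\<bar> + \<bar>v\<bar>) + \<bar>c\<bar>"
  define N where "N = \<lceil>K\<rceil>"
  define N' where "N' = \<lceil>\<bar>u\<bar> + \<bar>v\<bar> + sqrt 2 * K\<rceil>"
  have "seg x \<subseteq> {-N'..N'} \<times> {-N..N}"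
  proof
    fix p assume "p \<in> seg x"
    then have p: "real_of_int (snd p) = a * kappa p + c" "u \<le> kappa p" "kappa p \<le> v"
      by (auto simp: x l on_line_def)
    then have k: "\<bar>kappa p\<bar> \<le> \<bar>u\<bar> + \<bar>v\<bar>" by linarith
    have "\<bar>a * kappa p\<bar> \<le> \<bar>a\<bar> * (\<bar>u\<bar> + \<bar>v\<bar>)" unfolding abs_mult using k by (intro mult_left_mono) auto
    then have s: "\<bar>real_of_int (snd p)\<bar> \<le> K" unfolding p(1) K_def by linarith
    then have "\<bar>sqrt 2 * real_of_int (snd p)\<bar> \<le> sqrt 2 * K" by (simp add: abs_mult)
    then have "\<bar>real_of_int (fst p)\<bar> \<le> \<bar>u\<bar> + \<bar>v\<bar> + sqrt 2 * K"
      using k unfolding kappa_def by linarith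
    then have f: "\<bar>fst p\<bar> \<le> N'" unfolding N'_def by linarith
    from s have "\<bar>snd p\<bar> \<le> N" unfolding N_def by linarith
    with f show "p \<in> {-N'..N'} \<times> {-N..N}" by (auto simp: mem_Times_iff)
  qed
  then show ?thesis by (rule finite_subset) auto
qed

definition live :: "point set \<Rightarrow> point set \<Rightarrow> lseg \<Rightarrow> bool" where
  "live M D x \<longleftrightarrow> seg x \<inter> D = {} \<and> \<not> seg x \<subseteq> M"

text \<open>Segments of different lines may share points: this multiple counting is what the
  incidence bound controls. Only within one line must the segments of a family be disjoint.\<close>

definition separated :: "lseg \<Rightarrow> lseg \<Rightarrow> bool" where
  "separated x y \<longleftrightarrow> (fst x = fst y \<longrightarrow> seg x \<inter> seg y = {})"

definition count_on :: "point set \<Rightarrow> lseg \<Rightarrow> nat" where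
  "count_on M x = card (seg x \<inter> M)"

lemma live_antimono: "live M D x \<Longrightarrow> M' \<subseteq> M \<Longrightarrow> D' \<subseteq> D \<Longrightarrow> live M' D' x"
  by (auto simp: live_def)

lemma separated_sym: "separated x y \<longleftrightarrow> separated y x"
  by (auto simp: separated_def)

text \<open>A live segment is nonempty; hence being separated from every member of a family excludes
  membership in it.\<close>

lemma live_not_separated_self: "live M D x \<Longrightarrow> \<not> separated x x"
  by (auto simp: live_def separated_def)

section \<open>Marked Maker points and the segments they control\<close>

lemma rank_bij:
  fixes f :: "'a \<Rightarrow> real"
  assumes A: "finite A" and f: "inj_on f A"
  shows "inj_on (\<lambda>a. card {b \<in> A. f b \<le> f a}) A"
    and "(\<lambda>a. card {b \<in> A. f b \<le> f a}) ` A = {1..card A}"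
proof -
  let ?r = "\<lambda>a. card {b \<in> A. f b \<le> f a}"
  have less: "?r a < ?r b" if "a \<in> A" "b \<in> A" "f a < f b" for a b
  proof (rule psubset_card_mono)
    show "finite {c \<in> A. f c \<le> f b}" using A by auto
    show "{c \<in> A. f c \<le> f a} \<subset> {c \<in> A. f c \<le> f b}"
    proof (rule psubsetI)
      show "{c \<in> A. f c \<le> f a} \<subseteq> {c \<in> A. f c \<le> f b}" using that by auto
      have "b \<in> {c \<in> A. f c \<le> f b}" "b \<notin> {c \<in> A. f c \<le> f a}" using that by auto
      then show "{c \<in> A. f c \<le> f a} \<noteq> {c \<in> A. f c \<le> f b}" by blast
    qed
  qed
  show inj: "inj_on ?r A"
  proof (rule inj_onI)
    fix a b assume *: "a \<in> A" "b \<in> A" "?r a = ?r b"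
    then have "\<not> f a < f b" "\<not> f b < f a" using less[of a b] less[of b a] by auto
    then show "a = b" using f * by (auto dest: inj_onD)
  qed
  show "?r ` A = {1..card A}"
  proof (rule card_subset_eq)
    show "?r ` A \<subseteq> {1..card A}"
    proof
      fix k assume "k \<in> ?r ` A"
      then obtain a where a: "a \<in> A" "k = ?r a" by auto
      have "?r a \<le> card A" by (rule card_mono) (use A in auto)
      moreover have "{b \<in> A. f b \<le> f a} \<noteq> {}" "finite {b \<in> A. f b \<le> f a}" using a A by auto
      then have "?r a > 0" by (simp only: card_gt_0_iff simp_thms)
      ultimately show "k \<in> {1..card A}" using a by auto
    qed
    show "card (?r ` A) = card {1..card A}" using inj by (simp add: card_image)
  qed simp
qed

text \<open>The marks are the elements whose rank is divisible by g. An interval holding at least g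
  elements contains g consecutive ranks, one of which is such a multiple.\<close>

lemma ex_marks:
  fixes f :: "'a \<Rightarrow> real"
  assumes A: "finite A" and f: "inj_on f A" and g: "g > 0"
  shows "\<exists>K\<subseteq>A. card K \<le> card A div g \<and>
     (\<forall>u v. g \<le> card {a \<in> A. u \<le> f a \<and> f a \<le> v} \<longrightarrow> (\<exists>k\<in>K. u \<le> f k \<and> f k \<le> v))"
proof -
  let ?r = "\<lambda>a. card {b \<in> A. f b \<le> f a}"
  define K where "K = {a \<in> A. g dvd ?r a}"
  have "card K \<le> card {1..card A div g}"
  proof (rule card_inj_on_le[of "\<lambda>a. ?r a div g"])
    show "inj_on (\<lambda>a. ?r a div g) K"
    proof (rule inj_onI)
      fix a b assume *: "a \<in> K" "b \<in> K" "?r a div g = ?r b div g"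
      then have "?r a = ?r b" unfolding K_def by (metis (no_types, lifting) dvd_div_mult_self mem_Collect_eq)
      then show "a = b" using rank_bij(1)[OF A f] * unfolding K_def by (metis (no_types, lifting) inj_onD mem_Collect_eq)
    qed
    show "(\<lambda>a. ?r a div g) ` K \<subseteq> {1..card A div g}"
    proof
      fix k assume "k \<in> (\<lambda>a. ?r a div g) ` K"
      then obtain a where a: "a \<in> A" "g dvd ?r a" "k = ?r a div g" by (auto simp: K_def)
      have "?r a \<in> {1..card A}" using rank_bij(2)[OF A f] a(1) by blast
      then show "k \<in> {1..card A div g}"
        using a g by (auto simp: div_le_mono Suc_le_eq div_greater_zero_iff dvd_imp_le)
    qed
  qed simp
  moreover have "\<exists>k\<in>K. u \<le> f k \<and> f k \<le> v" if Q: "g \<le> card {a \<in> A. u \<le> f a \<and> f a \<le> v}" for u v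
  proof -
    let ?Q = "{a \<in> A. u \<le> f a \<and> f a \<le> v}"
    define c where "c = card {a \<in> A. f a < u}"
    have finQ: "finite ?Q" using A by auto
    have fQ: "inj_on f ?Q" using f by (auto simp: inj_on_def)
    \<comment> \<open>The distance from c to the next multiple of g, taken as g rather than 0 when g
      divides c, so that it is a rank inside the interval.\<close>
    define j where "j = g - c mod g"
    have "j \<in> {1..card ?Q}" using g Q mod_less_divisor[OF g, of c] by (auto simp: j_def)
    then obtain q where q: "q \<in> ?Q" "j = card {b \<in> ?Q. f b \<le> f q}"
      using rank_bij(2)[OF finQ fQ] by (metis (no_types, lifting) imageE)
    have "{b \<in> A. f b \<le> f q} = {a \<in> A. f a < u} \<union> {b \<in> ?Q. f b \<le> f q}" using q by auto
    then have "?r q = card ({a \<in> A. f a < u} \<union> {b \<in> ?Q. f b \<le> f q})" by simp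
    also have "\<dots> = c + j" unfolding c_def q(2) by (rule card_Un_disjoint) (use A in auto)
    finally have "?r q = c + j" .
    moreover have "g dvd c + j"
    proof -
      have "c + j = (c div g) * g + g"
        using mod_less_divisor[OF g, of c] div_mult_mod_eq[of c g] unfolding j_def by linarith
      then show ?thesis by simp
    qed
    ultimately have "q \<in> K" using q by (simp add: K_def)
    then show ?thesis using q by blast
  qed
  moreover have "K \<subseteq> A" by (auto simp: K_def)
  ultimately show ?thesis by (intro exI[of _ K]) auto
qed

text \<open>A set with at most one element instead of a chosen point: a line may have no lattice
  point outside M beyond k, and then the set is empty.\<close>

definition right_nbr :: "point set \<Rightarrow> real \<times> real \<Rightarrow> point \<Rightarrow> point set" where
  "right_nbr M l k = {z. on_line l (emb z) \<and> z \<notin> M \<and> kappa k < kappa z \<and>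
     (\<forall>w. on_line l (emb w) \<and> w \<notin> M \<and> kappa k < kappa w \<longrightarrow> kappa z \<le> kappa w)}"

definition left_nbr :: "point set \<Rightarrow> real \<times> real \<Rightarrow> point \<Rightarrow> point set" where
  "left_nbr M l k = {z. on_line l (emb z) \<and> z \<notin> M \<and> kappa z < kappa k \<and>
     (\<forall>w. on_line l (emb w) \<and> w \<notin> M \<and> kappa w < kappa k \<longrightarrow> kappa w \<le> kappa z)}"

lemma nbr_subsingleton:
  "\<exists>z. right_nbr M l k \<subseteq> {z}" "\<exists>z. left_nbr M l k \<subseteq> {z}"
proof -
  have "a = b" if "a \<in> right_nbr M l k" "b \<in> right_nbr M l k" for a b
  proof -
    have "kappa a \<le> kappa b" "kappa b \<le> kappa a" using that unfolding right_nbr_def by blast+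
    then show ?thesis using kappa_eq_iff by fastforce
  qed
  then show "\<exists>z. right_nbr M l k \<subseteq> {z}" by blast
  have "a = b" if "a \<in> left_nbr M l k" "b \<in> left_nbr M l k" for a b
  proof -
    have "kappa a \<le> kappa b" "kappa b \<le> kappa a" using that unfolding left_nbr_def by blast+
    then show ?thesis using kappa_eq_iff by fastforce
  qed
  then show "\<exists>z. left_nbr M l k \<subseteq> {z}" by blast
qed

text \<open>The nearest point outside M, seen from k in the direction of z, is no farther away than
  z and therefore still in the segment.\<close>

lemma nbr_hits_seg:
  assumes k: "k \<in> seg (l, u, v)" "k \<in> M" and z: "z \<in> seg (l, u, v)" "z \<notin> M"
  shows "seg (l, u, v) \<inter> (right_nbr M l k \<union> left_nbr M l k) \<noteq> {}"
proof (cases "kappa k < kappa z")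
  case True
  let ?A = "{w \<in> seg (l, u, v). w \<notin> M \<and> kappa k < kappa w}"
  have fin: "finite ?A" by (rule finite_subset[OF _ finite_seg[of "(l, u, v)"]]) blast
  moreover have "?A \<noteq> {}" using z True by blast
  ultimately obtain w where w: "w \<in> ?A" "\<forall>w'\<in>?A. kappa w \<le> kappa w'"
    using ex_min_value[of ?A kappa] by blast
  have "kappa w \<le> kappa y" if y: "on_line l (emb y)" "y \<notin> M" "kappa k < kappa y" for y
  proof (cases "kappa y \<le> v")
    case True
    then have "y \<in> ?A" using y k by auto
    then show ?thesis using w(2) by blast
  next
    case False
    then show ?thesis using w(1) by auto
  qed
  then have "w \<in> right_nbr M l k" using w(1) by (auto simp: right_nbr_def)
  then show ?thesis using w(1) by blast
next
  case False
  have "z \<noteq> k" using k z by auto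
  then have zk: "kappa z < kappa k" using False kappa_eq_iff[of z k] by linarith
  let ?A = "{w \<in> seg (l, u, v). w \<notin> M \<and> kappa w < kappa k}"
  have fin: "finite ?A" by (rule finite_subset[OF _ finite_seg[of "(l, u, v)"]]) blast
  moreover have "?A \<noteq> {}" using z zk by blast
  ultimately obtain w where w: "w \<in> ?A" "\<forall>w'\<in>?A. - kappa w \<le> - kappa w'"
    using ex_min_value[of ?A "\<lambda>w. - kappa w"] by blast
  have "kappa y \<le> kappa w" if y: "on_line l (emb y)" "y \<notin> M" "kappa y < kappa k" for y
  proof (cases "u \<le> kappa y")
    case True
    then have "y \<in> ?A" using y k by auto
    then have "- kappa w \<le> - kappa y" using w(2) by blast
    then show ?thesis by simp
  next
    case False
    then show ?thesis using w(1) by auto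
  qed
  then have "w \<in> left_nbr M l k" using w(1) by (auto simp: left_nbr_def)
  then show ?thesis using w(1) by blast
qed

text \<open>Mark every g-th Maker point of x and take both neighbours of each mark. A segment of the
  same line sharing g Maker points with x contains a mark, and if it has a point outside M it
  contains a neighbour of that mark too.\<close>

lemma treat_one:
  assumes M: "finite M" and g: "g > 0" and H: "count_on M x \<le> H"
  shows "\<exists>Y. finite Y \<and> Y \<inter> M = {} \<and> card Y \<le> 2 * (H div g) \<and>
    (\<forall>y. fst y = fst x \<longrightarrow> g \<le> card (seg y \<inter> (seg x \<inter> M)) \<longrightarrow> \<not> seg y \<subseteq> M \<longrightarrow> seg y \<inter> Y \<noteq> {})"
proof -
  define l where "l = fst x"
  define A where "A = seg x \<inter> M"
  have A: "finite A" using M by (simp add: A_def)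
  have "inj_on kappa A" using inj_kappa by (auto simp: inj_on_def)
  from ex_marks[OF A this g] obtain K where K: "K \<subseteq> A" "card K \<le> card A div g"
    and Ku: "\<And>u v. g \<le> card {a \<in> A. u \<le> kappa a \<and> kappa a \<le> v} \<Longrightarrow> \<exists>k\<in>K. u \<le> kappa k \<and> kappa k \<le> v"
    by blast
  have finK: "finite K" using K A by (auto intro: finite_subset)
  define Y where "Y = (\<Union>k\<in>K. right_nbr M l k \<union> left_nbr M l k)"
  have nb: "finite (right_nbr M l k \<union> left_nbr M l k) \<and> card (right_nbr M l k \<union> left_nbr M l k) \<le> 2" for k
  proof -
    obtain a b where ab: "right_nbr M l k \<subseteq> {a}" "left_nbr M l k \<subseteq> {b}" using nbr_subsingleton by metis
    then have s: "right_nbr M l k \<union> left_nbr M l k \<subseteq> {a, b}" by blast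
    have "card {a, b} \<le> 2" by (simp add: card_insert_if)
    then show ?thesis using s card_mono[OF _ s] finite_subset[OF s] by auto
  qed
  have "card Y \<le> (\<Sum>k\<in>K. card (right_nbr M l k \<union> left_nbr M l k))"
    unfolding Y_def by (rule card_UN_le[OF finK])
  also have "\<dots> \<le> (\<Sum>k\<in>K. 2)" by (rule sum_mono) (use nb in blast)
  also have "\<dots> = 2 * card K" by simp
  also have "\<dots> \<le> 2 * (H div g)"
  proof -
    have "card A div g \<le> H div g" using H by (intro div_le_mono) (simp add: A_def count_on_def)
    then show ?thesis using K(2) by linarith
  qed
  finally have "card Y \<le> 2 * (H div g)" .
  moreover have "finite Y" using finK nb by (auto simp: Y_def)
  moreover have "Y \<inter> M = {}" by (auto simp: Y_def right_nbr_def left_nbr_def)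
  moreover have "seg y \<inter> Y \<noteq> {}"
    if y: "fst y = fst x" "g \<le> card (seg y \<inter> (seg x \<inter> M))" "\<not> seg y \<subseteq> M" for y
  proof -
    obtain u v where yy: "y = (l, u, v)" using y(1) by (metis l_def prod.collapse)
    obtain l' u' v' where xx: "x = (l', u', v')" by (cases x)
    have "l' = l" by (simp add: l_def xx)
    have "{p. p \<in> seg y \<and> p \<in> seg x \<inter> M} = {a \<in> A. u \<le> kappa a \<and> kappa a \<le> v}"
      by (auto simp: yy xx A_def \<open>l' = l\<close>)
    then have "g \<le> card {a \<in> A. u \<le> kappa a \<and> kappa a \<le> v}" using y(2) by (simp add: Int_def)
    then obtain k where k: "k \<in> K" "u \<le> kappa k" "kappa k \<le> v" using Ku by blast
    have "k \<in> A" using k K by blast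
    then have kk: "k \<in> seg (l, u, v)" "k \<in> M" using k by (auto simp: A_def xx \<open>l' = l\<close>)
    obtain z where "z \<in> seg (l, u, v)" "z \<notin> M" using y(3) yy by blast
    from nbr_hits_seg[OF kk this] show ?thesis using k(1) by (auto simp: Y_def yy)
  qed
  ultimately show ?thesis by blast
qed

lemma seg_hull:
  assumes xy: "fst x = fst y" "seg x \<inter> seg y \<noteq> {}"
  shows "\<exists>h. fst h = fst x \<and> seg h = seg x \<union> seg y"
proof -
  obtain l u v where x: "x = (l, u, v)" by (cases x)
  obtain u' v' where y: "y = (l, u', v')" using xy(1) x by (metis fst_conv prod.collapse)
  obtain c where c: "c \<in> seg x" "c \<in> seg y" using xy(2) by blast
  have "seg (l, min u u', max v v') = seg x \<union> seg y"
    using c by (auto simp: x y min_def max_def)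
  then show ?thesis using x by (metis fst_conv)
qed

text \<open>All that the counting needs to know about one Breaker turn, which enlarges D to D'. The
  members of R are live before the turn, while survivors are judged after it. If fewer than B
  segments were treated, the last clause says that no survivor has g points; otherwise each treated
  segment is at least as rich as every such survivor.\<close>

definition treated :: "nat \<Rightarrow> nat \<Rightarrow> point set \<Rightarrow> point set \<Rightarrow> point set \<Rightarrow> bool" where
  "treated B g M D D' \<longleftrightarrow> (\<exists>R. finite R \<and> card R \<le> B \<and> (\<forall>r\<in>R. live M D r) \<and>
     (\<forall>r\<in>R. \<forall>r'\<in>R. r \<noteq> r' \<longrightarrow> separated r r') \<and>
     (\<forall>x. live M D' x \<longrightarrow> g \<le> count_on M x \<longrightarrow>
        card R = B \<and> (\<forall>r\<in>R. count_on M x \<le> count_on M r \<and> separated x r)))"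

text \<open>Further Breaker points leave fewer survivors, so a turn may be filled up
  arbitrarily.\<close>

lemma treated_mono: "treated B g M D D' \<Longrightarrow> D' \<subseteq> D'' \<Longrightarrow> treated B g M D D''"
  unfolding treated_def using live_antimono[OF _ subset_refl] by meson

text \<open>A greedy choice: each round treats a live segment with the most Maker points among those
  that survive so far. Maximality is what makes later survivors separated from it.\<close>

lemma treat_many:
  assumes M: "finite M" and g: "g > 0" and H: "\<And>x. live M D x \<Longrightarrow> count_on M x \<le> H"
  shows "\<exists>Y. finite Y \<and> Y \<inter> (M \<union> D) = {} \<and> card Y \<le> B * (2 * (H div g)) \<and> treated B g M D (D \<union> Y)"
proof (induction B)
  case 0
  show ?case by (rule exI[of _ "{}"]) (auto simp: treated_def)
next
  case (Suc B)
  then obtain Y where Y: "finite Y" "Y \<inter> (M \<union> D) = {}" "card Y \<le> B * (2 * (H div g))"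
    "treated B g M D (D \<union> Y)" by blast
  then obtain R where R: "finite R" "card R \<le> B" "\<forall>r\<in>R. live M D r"
    "\<forall>r\<in>R. \<forall>r'\<in>R. r \<noteq> r' \<longrightarrow> separated r r'"
    and Rx: "\<And>x. live M (D \<union> Y) x \<Longrightarrow> g \<le> count_on M x \<Longrightarrow>
        card R = B \<and> (\<forall>r\<in>R. count_on M x \<le> count_on M r \<and> separated x r)"
    unfolding treated_def by blast
  show ?case
  proof (cases "\<exists>x. live M (D \<union> Y) x \<and> g \<le> count_on M x")
    case False
    then have "treated (Suc B) g M D (D \<union> Y)"
      using R unfolding treated_def by (intro exI[of _ R]) auto
    then show ?thesis using Y(1-3) by (intro exI[of _ Y]) auto
  next
    case True
    have "\<exists>x. (live M (D \<union> Y) x \<and> g \<le> count_on M x) \<and>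
        (\<forall>y. live M (D \<union> Y) y \<and> g \<le> count_on M y \<longrightarrow> count_on M y \<le> count_on M x)"
    proof -
      from True obtain k where "live M (D \<union> Y) k \<and> g \<le> count_on M k" by blast
      moreover have "\<forall>y. live M (D \<union> Y) y \<and> g \<le> count_on M y \<longrightarrow> count_on M y < Suc H"
        using H live_antimono by (meson Un_upper1 le_imp_less_Suc subset_refl)
      ultimately show ?thesis
        by (rule ex_has_greatest_nat[of "\<lambda>x. live M (D \<union> Y) x \<and> g \<le> count_on M x" k "count_on M" "Suc H"])
    qed
    then obtain x where x: "live M (D \<union> Y) x" "g \<le> count_on M x"
      and xmax: "\<And>y. live M (D \<union> Y) y \<Longrightarrow> g \<le> count_on M y \<Longrightarrow> count_on M y \<le> count_on M x"
      by blast
    have xl: "live M D x" using x live_antimono by blast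
    from treat_one[OF M g H[OF xl]] obtain Z where Z: "finite Z" "Z \<inter> M = {}" "card Z \<le> 2 * (H div g)"
      and Zy: "\<And>y. fst y = fst x \<Longrightarrow> g \<le> card (seg y \<inter> (seg x \<inter> M)) \<Longrightarrow> \<not> seg y \<subseteq> M \<Longrightarrow> seg y \<inter> Z \<noteq> {}"
      by blast
    \<comment> \<open>Points of Z that Breaker owns already are removed for legality; they still
      block segments through D.\<close>
    let ?Y = "Y \<union> (Z - D)"
    have notin: "x \<notin> R" using Rx[OF x] live_not_separated_self[OF x(1)] by blast
    have sep: "separated y x" if y: "live M (D \<union> ?Y) y" "g \<le> count_on M y" for y
    proof (rule ccontr)
      assume "\<not> separated y x"
      then have yx: "fst x = fst y" "seg x \<inter> seg y \<noteq> {}" by (auto simp: separated_def)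
      \<comment> \<open>If a survivor y overlapped x, their union would be a live segment. By
        maximality of x it has no more Maker points than x, so all Maker points of y lie in x, and
        the points Z chosen for x hit y.\<close>
      obtain h where h: "fst h = fst x" "seg h = seg x \<union> seg y" using seg_hull[OF yx] by blast
      have yl: "live M (D \<union> Y) y" using y live_antimono by blast
      have hl: "live M (D \<union> Y) h" using x(1) yl h by (auto simp: live_def)
      have le: "count_on M x \<le> count_on M h"
        unfolding count_on_def by (rule card_mono) (use M h in auto)
      then have "count_on M h = count_on M x" using xmax[OF hl] x(2) by linarith
      then have "seg x \<inter> M = seg h \<inter> M"
        unfolding count_on_def by (intro card_subset_eq) (use M h in auto)
      then have "seg y \<inter> (seg x \<inter> M) = seg y \<inter> M" using h by blast
      then have "seg y \<inter> Z \<noteq> {}" using Zy[of y] y yx by (auto simp: count_on_def live_def)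
      then show False using y(1) by (auto simp: live_def)
    qed
    have "treated (Suc B) g M D (D \<union> ?Y)"
      unfolding treated_def
    proof (intro exI[of _ "insert x R"] conjI allI impI)
      show "finite (insert x R)" "card (insert x R) \<le> Suc B" "\<forall>r\<in>insert x R. live M D r"
        using R xl by (auto simp: card_insert_if)
      show "\<forall>r\<in>insert x R. \<forall>r'\<in>insert x R. r \<noteq> r' \<longrightarrow> separated r r'"
        using R(4) Rx[OF x] separated_sym by blast
      fix y assume y: "live M (D \<union> ?Y) y" "g \<le> count_on M y"
      have yl: "live M (D \<union> Y) y" using y live_antimono by blast
      show "card (insert x R) = Suc B" using Rx[OF x] notin R(1) by simp
      show "\<forall>r\<in>insert x R. count_on M y \<le> count_on M r \<and> separated y r"
        using Rx[OF yl y(2)] sep[OF y] xmax[OF yl y(2)] by blast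
    qed
    moreover have "card ?Y \<le> Suc B * (2 * (H div g))"
    proof -
      have "card ?Y \<le> card Y + card (Z - D)" by (rule card_Un_le)
      also have "card (Z - D) \<le> card Z" by (rule card_mono) (use Z in auto)
      finally show ?thesis using Y(3) Z(3) by simp
    qed
    moreover have "finite ?Y" "?Y \<inter> (M \<union> D) = {}" using Y Z by auto
    ultimately show ?thesis by blast
  qed
qed

section \<open>The excess of families of segments, followed back in time\<close>

definition inc :: "point set \<Rightarrow> (real \<times> real) set \<Rightarrow> nat" where
  "inc X L = (\<Sum>l\<in>L. card {p \<in> X. on_line l (emb p)})"

text \<open>On each line the segments of F are disjoint, so together they see every incident point
  at most once.\<close>

lemma sum_card_seg_le_inc:
  assumes F: "finite F" "\<And>x y. x \<in> F \<Longrightarrow> y \<in> F \<Longrightarrow> x \<noteq> y \<Longrightarrow> separated x y"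
    and L: "finite L" "fst ` F \<subseteq> L" and X: "finite X"
  shows "(\<Sum>x\<in>F. card (seg x \<inter> X)) \<le> inc X L"
proof -
  have "(\<Sum>x\<in>F. card (seg x \<inter> X)) = (\<Sum>l\<in>L. \<Sum>x\<in>{x \<in> F. fst x = l}. card (seg x \<inter> X))"
    by (rule sum.group[symmetric]) (use F L in auto)
  also have "\<dots> \<le> (\<Sum>l\<in>L. card {p \<in> X. on_line l (emb p)})"
  proof (rule sum_mono)
    fix l
    let ?F = "{x \<in> F. fst x = l}"
    have "(\<Sum>x\<in>?F. card (seg x \<inter> X)) = card (\<Union>x\<in>?F. seg x \<inter> X)"
    proof (rule card_UN_disjoint[symmetric])
      show "finite ?F" "\<forall>x\<in>?F. finite (seg x \<inter> X)" using F X by auto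
      show "\<forall>x\<in>?F. \<forall>y\<in>?F. x \<noteq> y \<longrightarrow> (seg x \<inter> X) \<inter> (seg y \<inter> X) = {}"
        using F(2) unfolding separated_def by blast
    qed
    also have "\<dots> \<le> card {p \<in> X. on_line l (emb p)}"
    proof (rule card_mono)
      show "(\<Union>x\<in>?F. seg x \<inter> X) \<subseteq> {p \<in> X. on_line l (emb p)}" by force
    qed (use X in auto)
    finally show "(\<Sum>x\<in>?F. card (seg x \<inter> X)) \<le> card {p \<in> X. on_line l (emb p)}" .
  qed
  finally show ?thesis by (simp add: inc_def)
qed

lemma count_on_Un: "finite M \<Longrightarrow> finite X \<Longrightarrow> count_on (M \<union> X) x \<le> count_on M x + card (seg x \<inter> X)"
  unfolding count_on_def by (simp add: Int_Un_distrib card_Un_le)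

lemma divide_le_divide_add:
  fixes x y z r s :: real
  assumes "r * x \<le> s * (y + z)" "0 < s" "0 < r"
  shows "x / s \<le> y / r + z / r"
proof -
  have "x / s \<le> (y + z) / r" using assms by (simp add: field_simps)
  then show ?thesis by (simp add: add_divide_distrib)
qed

text \<open>The average excess over \<open>g\<close> of at most \<open>s\<close> live segments does not decrease when, going back in time, the
  segments treated by Breaker are added to the family, since these had the largest excess.\<close>

lemma excess_average_bound:
  fixes M D X :: "nat \<Rightarrow> point set"
  assumes step: "\<And>i. M (Suc i) = M i \<union> X i" and fin: "\<And>i. finite (M i)" "\<And>i. finite (X i)"
    and D: "\<And>i. D i \<subseteq> D (Suc i)"
    and tr: "\<And>i. i \<in> {a..<a + j} \<Longrightarrow> treated B g (M (Suc i)) (D i) (D (Suc i))"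
    and start: "card (M a) \<le> g"
    and F: "finite F" "card F \<le> s" "\<And>x. x \<in> F \<Longrightarrow> live (M (a + j)) (D (a + j)) x"
      "\<And>x y. x \<in> F \<Longrightarrow> y \<in> F \<Longrightarrow> x \<noteq> y \<Longrightarrow> separated x y"
    and L: "finite L" "card L \<le> s" "fst ` F \<subseteq> L" and s: "s > 0"
  shows "\<exists>\<Lambda>. \<Lambda> 0 = L \<and> (\<forall>i. \<Lambda> i \<subseteq> \<Lambda> (Suc i)) \<and> (\<forall>i. finite (\<Lambda> i) \<and> card (\<Lambda> i) \<le> s + i * B) \<and>
    real (\<Sum>x\<in>F. count_on (M (a + j)) x - g) / real s
      \<le> (\<Sum>i<j. real (inc (X (a + j - Suc i)) (\<Lambda> (Suc i))) / real (s + Suc i * B))"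
  using tr F L s
proof (induction j arbitrary: F L s)
  case 0
  have "count_on (M a) x - g = 0" for x
  proof -
    have "count_on (M a) x \<le> card (M a)" unfolding count_on_def by (rule card_mono) (use fin in auto)
    then show ?thesis using start by simp
  qed
  then have "(\<Sum>x\<in>F. count_on (M (a + 0)) x - g) = 0" by simp
  then show ?case using 0 by (intro exI[of _ "\<lambda>_. L"]) auto
next
  case (Suc j)
  define t where "t = a + j"
  \<comment> \<open>Segments without excess contribute 0 to the truncated sum. They are dropped
    because the comparison with the treated segments is available only for counts of at least
    g.\<close>
  define F1 where "F1 = {x \<in> F. g < count_on (M (Suc t)) x}"
  let ?e = "\<lambda>x. count_on (M (Suc t)) x - g"
  have sumF: "(\<Sum>x\<in>F. ?e x) = (\<Sum>x\<in>F1. ?e x)"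
    by (rule sum.mono_neutral_right) (use Suc.prems in \<open>auto simp: F1_def\<close>)
  show ?case
  proof (cases "F1 = {}")
    case True
    have "real (\<Sum>x\<in>F. ?e x) / real s = 0" unfolding sumF True by simp
    then have e0: "real (\<Sum>x\<in>F. count_on (M (a + Suc j)) x - g) / real s = 0" by (simp add: t_def)
    show ?thesis
    proof (intro exI[of _ "\<lambda>_. L"] conjI allI)
      show "card L \<le> s + i * B" for i using Suc.prems(7) by simp
      show "real (\<Sum>x\<in>F. count_on (M (a + Suc j)) x - g) / real s
          \<le> (\<Sum>i<Suc j. real (inc (X (a + Suc j - Suc i)) L) / real (s + Suc i * B))"
        unfolding e0 by (intro sum_nonneg) simp
    qed (use Suc.prems(6) in auto)
  next
    case False
    have "treated B g (M (Suc t)) (D t) (D (Suc t))" using Suc.prems(1)[of t] by (simp add: t_def)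
    then obtain R where R: "finite R" "card R \<le> B" "\<forall>r\<in>R. live (M (Suc t)) (D t) r"
      "\<forall>r\<in>R. \<forall>r'\<in>R. r \<noteq> r' \<longrightarrow> separated r r'"
      and Rx: "\<And>x. live (M (Suc t)) (D (Suc t)) x \<Longrightarrow> g \<le> count_on (M (Suc t)) x \<Longrightarrow>
        card R = B \<and> (\<forall>r\<in>R. count_on (M (Suc t)) x \<le> count_on (M (Suc t)) r \<and> separated x r)"
      unfolding treated_def by blast
    have Flive: "live (M (Suc t)) (D (Suc t)) x" if "x \<in> F" for x
      using Suc.prems(4)[OF that] by (simp add: t_def)
    have F1: "finite F1" "F1 \<subseteq> F" using Suc.prems by (auto simp: F1_def)
    have F1R: "card R = B" "count_on (M (Suc t)) x \<le> count_on (M (Suc t)) r" "separated x r"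
      if "x \<in> F1" "r \<in> R" for x r
      using Rx[OF Flive, of x] that by (auto simp: F1_def)
    have cardR: "card R = B" using False Rx[OF Flive] by (auto simp: F1_def)
    have disj: "F1 \<inter> R = {}" using F1R(3) F1 Flive live_not_separated_self by blast
    define F' where "F' = F1 \<union> R"
    define L' where "L' = L \<union> fst ` R"
    have "card F1 \<le> s" using card_mono[OF Suc.prems(2) F1(2)] Suc.prems(3) by simp
    then have F': "finite F'" "card F' \<le> s + B"
      using F1 R cardR card_Un_le[of F1 R] by (auto simp: F'_def)
    have F'live: "live (M t) (D t) x" if "x \<in> F'" for x
    proof -
      have "live (M (Suc t)) (D t) x"
        using that R(3) F1 Flive live_antimono[OF _ subset_refl D] unfolding F'_def by blast
      then show ?thesis by (rule live_antimono) (auto simp: step)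
    qed
    have F'sep: "separated x y" if "x \<in> F'" "y \<in> F'" "x \<noteq> y" for x y
      using that R(4) F1R(3) Suc.prems(5) F1 separated_sym unfolding F'_def by blast
    have L': "finite L'" "card L' \<le> s + B" "fst ` F' \<subseteq> L'"
    proof -
      show "finite L'" using Suc.prems R by (simp add: L'_def)
      have "card L' \<le> card L + card (fst ` R)" unfolding L'_def by (rule card_Un_le)
      then show "card L' \<le> s + B" using Suc.prems(7) card_image_le[OF R(1), of fst] cardR by linarith
      show "fst ` F' \<subseteq> L'" using Suc.prems(8) F1 by (auto simp: F'_def L'_def)
    qed
    have "\<exists>\<Lambda>. \<Lambda> 0 = L' \<and> (\<forall>i. \<Lambda> i \<subseteq> \<Lambda> (Suc i)) \<and> (\<forall>i. finite (\<Lambda> i) \<and> card (\<Lambda> i) \<le> (s + B) + i * B) \<and>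
      real (\<Sum>x\<in>F'. count_on (M (a + j)) x - g) / real (s + B)
      \<le> (\<Sum>i<j. real (inc (X (a + j - Suc i)) (\<Lambda> (Suc i))) / real ((s + B) + Suc i * B))"
      by (rule Suc.IH) (use Suc.prems(1,9) F' F'live F'sep L' in \<open>auto simp: t_def\<close>)
    then obtain \<Lambda> where \<Lambda>: "\<Lambda> 0 = L'" "\<forall>i. \<Lambda> i \<subseteq> \<Lambda> (Suc i)"
      "\<forall>i. finite (\<Lambda> i) \<and> card (\<Lambda> i) \<le> (s + B) + i * B"
      and bound: "real (\<Sum>x\<in>F'. count_on (M t) x - g) / real (s + B)
      \<le> (\<Sum>i<j. real (inc (X (t - Suc i)) (\<Lambda> (Suc i))) / real ((s + B) + Suc i * B))"
      unfolding t_def by blast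
    have sumF': "(\<Sum>x\<in>F'. ?e x) \<le> (\<Sum>x\<in>F'. count_on (M t) x - g) + inc (X t) L'"
    proof -
      have "(\<Sum>x\<in>F'. ?e x) \<le> (\<Sum>x\<in>F'. (count_on (M t) x - g) + card (seg x \<inter> X t))"
      proof (rule sum_mono)
        fix x
        have "count_on (M (Suc t)) x \<le> count_on (M t) x + card (seg x \<inter> X t)"
          unfolding step by (rule count_on_Un[OF fin])
        then show "?e x \<le> (count_on (M t) x - g) + card (seg x \<inter> X t)" by linarith
      qed
      also have "\<dots> = (\<Sum>x\<in>F'. count_on (M t) x - g) + (\<Sum>x\<in>F'. card (seg x \<inter> X t))"
        by (rule sum.distrib)
      also have "(\<Sum>x\<in>F'. card (seg x \<inter> X t)) \<le> inc (X t) L'"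
        by (rule sum_card_seg_le_inc) (use F' F'sep L' fin in auto)
      finally show ?thesis by simp
    qed
    \<comment> \<open>Every treated segment has at least the excess of every member of F1. The B
      added segments thus have an average no smaller than the sum over F1 divided by s, and
      enlarging the denominator to s + B does not lower the average.\<close>
    have "s * (\<Sum>r\<in>R. ?e r) \<ge> B * (\<Sum>x\<in>F1. ?e x)"
    proof -
      have "B * ?e x \<le> (\<Sum>r\<in>R. ?e r)" if "x \<in> F1" for x
      proof -
        have "(\<Sum>r\<in>R. ?e x) \<le> (\<Sum>r\<in>R. ?e r)"
          by (rule sum_mono) (use F1R(2)[OF that] in \<open>simp add: diff_le_mono\<close>)
        then show ?thesis using cardR by simp
      qed
      then have "(\<Sum>x\<in>F1. B * ?e x) \<le> (\<Sum>x\<in>F1. \<Sum>r\<in>R. ?e r)" by (rule sum_mono)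
      also have "\<dots> = card F1 * (\<Sum>r\<in>R. ?e r)" by simp
      also have "\<dots> \<le> s * (\<Sum>r\<in>R. ?e r)" using \<open>card F1 \<le> s\<close> by (rule mult_right_mono) simp
      finally show ?thesis by (simp only: sum_distrib_left)
    qed
    moreover have "(\<Sum>x\<in>F'. ?e x) = (\<Sum>x\<in>F1. ?e x) + (\<Sum>r\<in>R. ?e r)"
      unfolding F'_def by (rule sum.union_disjoint) (use F1 R disj in auto)
    ultimately have "(s + B) * (\<Sum>x\<in>F. ?e x) \<le> s * (\<Sum>x\<in>F'. ?e x)"
      unfolding sumF by (simp only: distrib_left distrib_right)
    also have "\<dots> \<le> s * ((\<Sum>x\<in>F'. count_on (M t) x - g) + inc (X t) L')"
      using sumF' by (rule mult_left_mono) simp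
    finally have "real (s + B) * real (\<Sum>x\<in>F. ?e x)
        \<le> real s * (real (\<Sum>x\<in>F'. count_on (M t) x - g) + real (inc (X t) L'))"
      by (simp only: of_nat_le_iff flip: of_nat_mult of_nat_add)
    then have "real (\<Sum>x\<in>F. ?e x) / real s
        \<le> real (\<Sum>x\<in>F'. count_on (M t) x - g) / real (s + B) + real (inc (X t) L') / real (s + B)"
      by (rule divide_le_divide_add) (use Suc.prems(9) in auto)
    also have "\<dots> \<le> real (inc (X t) (\<Lambda> 0)) / real (s + 1 * B)
       + (\<Sum>i<j. real (inc (X (t - Suc i)) (\<Lambda> (Suc i))) / real (s + Suc (Suc i) * B))"
      using bound \<Lambda>(1) by (simp add: algebra_simps del: of_nat_sum)
    finally have "real (\<Sum>x\<in>F. ?e x) / real s \<le> real (inc (X t) (\<Lambda> 0)) / real (s + 1 * B)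
       + (\<Sum>i<j. real (inc (X (t - Suc i)) (\<Lambda> (Suc i))) / real (s + Suc (Suc i) * B))" .
    \<comment> \<open>The chain from the induction hypothesis starts one turn earlier, at L', so it
      is shifted by one and L is put in front.\<close>
    also have "\<dots> = (\<Sum>i<Suc j. real (inc (X (Suc t - Suc i)) (case Suc i of 0 \<Rightarrow> L | Suc k \<Rightarrow> \<Lambda> k)) / real (s + Suc i * B))"
      by (subst sum.lessThan_Suc_shift) simp
    finally have "real (\<Sum>x\<in>F. ?e x) / real s
       \<le> (\<Sum>i<Suc j. real (inc (X (Suc t - Suc i)) (case Suc i of 0 \<Rightarrow> L | Suc k \<Rightarrow> \<Lambda> k)) / real (s + Suc i * B))" .
    moreover have "\<forall>i. finite (\<Lambda> i) \<and> card (\<Lambda> i) \<le> s + (B + i * B)"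
      using \<Lambda>(3) by (simp add: add.assoc)
    ultimately show ?thesis
      using \<Lambda>(1,2) Suc.prems(6,7)
      by (intro exI[of _ "\<lambda>i. case i of 0 \<Rightarrow> L | Suc k \<Rightarrow> \<Lambda> k"])
         (auto simp: t_def L'_def split: nat.split)
  qed
qed

section \<open>Breaker's strategy\<close>

lemma inc_eq_incidences: "inc X L = incidences (emb ` X) L"
proof -
  have "{q \<in> emb ` X. on_line l q} = emb ` {p \<in> X. on_line l (emb p)}" for l by auto
  moreover have "inj emb" by (rule injI) (metis fst_emb kappa_eq_iff)
  then have "card (emb ` A) = card A" for A by (auto intro: card_image inj_on_subset)
  ultimately show ?thesis by (simp add: inc_def incidences_def)
qed

lemma inc_le:
  assumes "finite X" "finite L"
  shows "real (inc X L) \<le> card L + 6 * card X + 5 * (real (card X) * real (card L)) powr (2/3)"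
proof -
  have "inj emb" by (rule injI) (metis fst_emb kappa_eq_iff)
  then have c: "card (emb ` X) = card X" by (auto intro: card_image inj_on_subset)
  have "inj_on fst (emb ` X)" by (rule inj_onI) (metis fst_emb imageE kappa_eq_iff)
  then show ?thesis using szemeredi_trotter[of "emb ` X" L] assms by (simp add: inc_eq_incidences c)
qed

lemma inc_mono: "L \<subseteq> L' \<Longrightarrow> finite L' \<Longrightarrow> inc X L \<le> inc X L'"
  unfolding inc_def by (rule sum_mono2) auto

lemma inc_UN:
  assumes "finite I" "\<And>i. finite (X i)" "\<And>i j. i \<noteq> j \<Longrightarrow> X i \<inter> X j = {}"
  shows "(\<Sum>i\<in>I. inc (X i) L) = inc (\<Union>i\<in>I. X i) L"
proof -
  have "card {p \<in> \<Union>i\<in>I. X i. on_line l (emb p)} = (\<Sum>i\<in>I. card {p \<in> X i. on_line l (emb p)})" for l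
  proof -
    have "{p \<in> \<Union>i\<in>I. X i. on_line l (emb p)} = (\<Union>i\<in>I. {p \<in> X i. on_line l (emb p)})" by auto
    moreover have "card (\<Union>i\<in>I. {p \<in> X i. on_line l (emb p)}) = (\<Sum>i\<in>I. card {p \<in> X i. on_line l (emb p)})"
    proof (rule card_UN_disjoint)
      show "\<forall>i\<in>I. \<forall>j\<in>I. i \<noteq> j \<longrightarrow> {p \<in> X i. on_line l (emb p)} \<inter> {p \<in> X j. on_line l (emb p)} = {}"
        using assms(3) by blast
    qed (use assms in auto)
    ultimately show ?thesis by simp
  qed
  then show ?thesis unfolding inc_def by (simp add: sum.swap[of _ I])
qed

text \<open>All families of the block are replaced by the last one, all denominators by the lower
  bound 2^k B, and the disjoint turns by their union. One application of the incidence bound to at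
  most 2^k n points and 2^(k+1) B lines then serves the whole block. The index range makes
  \<open>Suc i\<close> run from 2^k to 2^(k+1) - 1.\<close>

lemma dyadic_block:
  fixes X :: "nat \<Rightarrow> point set" and \<Lambda> :: "nat \<Rightarrow> (real \<times> real) set"
  assumes X: "\<And>i. finite (X i)" "\<And>i. card (X i) \<le> n" "\<And>i j. i \<noteq> j \<Longrightarrow> X i \<inter> X j = {}"
    and \<Lambda>: "\<And>i. \<Lambda> i \<subseteq> \<Lambda> (Suc i)" "\<And>i. finite (\<Lambda> i)" "\<And>i. card (\<Lambda> i) \<le> 1 + i * B" and B: "B \<ge> 1"
  shows "(\<Sum>i\<in>{2^k - 1..<2^Suc k - 1}. real (inc (X i) (\<Lambda> (Suc i))) / real (1 + Suc i * B))
    \<le> 2 + 6 * real n / real B + 8 * (real n powr (2/3) * real B powr (-1/3)) * (2 powr (1/3)) ^ k"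
proof -
  define I where "I = {2^k - 1..<2^Suc k - (1::nat)}"
  define Z where "Z = \<Lambda> (2^Suc k - 1)"
  define t where "t = (2::real) ^ k"
  have t: "t > 0" "t = real (2 ^ k)" by (auto simp: t_def)
  have B0: "real B > 0" using B by simp
  have mono: "\<Lambda> i \<subseteq> \<Lambda> j" if "i \<le> j" for i j using that \<Lambda>(1) by (rule lift_Suc_mono_le[rotated])
  have cardI: "card I = 2 ^ k" by (simp add: I_def)
  have Z: "finite Z" "real (card Z) \<le> 2 * t * B"
  proof -
    show "finite Z" by (simp add: Z_def \<Lambda>)
    have "card Z \<le> 1 + (2^Suc k - 1) * B" unfolding Z_def by (rule \<Lambda>)
    also have "\<dots> \<le> B + (2^Suc k - 1) * B" using B by simp
    also have "\<dots> = 2 ^ Suc k * B" by (simp add: diff_mult_distrib)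
    finally have "real (card Z) \<le> real (2 ^ Suc k * B)" by (simp only: of_nat_le_iff)
    then show "real (card Z) \<le> 2 * t * B" by (simp add: t_def)
  qed
  define U where "U = (\<Union>i\<in>I. X i)"
  have U: "finite U" "real (card U) \<le> t * n"
  proof -
    show "finite U" by (simp add: U_def I_def X)
    have "card U \<le> (\<Sum>i\<in>I. card (X i))" unfolding U_def by (rule card_UN_le) (simp add: I_def)
    also have "\<dots> \<le> (\<Sum>i\<in>I. n)" by (rule sum_mono) (rule X)
    also have "\<dots> = 2 ^ k * n" by (simp add: cardI)
    finally have "real (card U) \<le> real (2 ^ k * n)" by (simp only: of_nat_le_iff)
    then show "real (card U) \<le> t * n" by (simp add: t_def)
  qed
  have "(\<Sum>i\<in>I. real (inc (X i) (\<Lambda> (Suc i))) / real (1 + Suc i * B)) \<le> (\<Sum>i\<in>I. real (inc (X i) Z) / (t * B))"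
  proof (rule sum_mono)
    fix i assume i: "i \<in> I"
    have "inc (X i) (\<Lambda> (Suc i)) \<le> inc (X i) Z"
      unfolding Z_def by (rule inc_mono[OF mono \<Lambda>(2)]) (use i in \<open>auto simp: I_def\<close>)
    moreover have "t * B \<le> real (1 + Suc i * B)"
    proof -
      have "2 ^ k * B \<le> Suc i * B" using i by (intro mult_right_mono) (auto simp: I_def)
      then have "real (2 ^ k * B) \<le> real (1 + Suc i * B)" by (simp only: of_nat_le_iff)
      then show ?thesis by (simp add: t_def)
    qed
    ultimately show "real (inc (X i) (\<Lambda> (Suc i))) / real (1 + Suc i * B) \<le> real (inc (X i) Z) / (t * B)"
      using t B0 by (intro frac_le) auto
  qed
  also have "\<dots> = real (inc U Z) / (t * B)"
    unfolding U_def by (subst inc_UN[symmetric]) (auto simp: I_def X sum_divide_distrib)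
  also have "\<dots> \<le> (2 * t * B + 6 * (t * n) + 5 * ((t * n) * (2 * t * B)) powr (2/3)) / (t * B)"
  proof (rule divide_right_mono)
    have "(real (card U) * real (card Z)) powr (2/3) \<le> ((t * n) * (2 * t * B)) powr (2/3)"
      by (rule powr_mono2) (use U Z t in \<open>auto intro!: mult_mono\<close>)
    then show "real (inc U Z) \<le> 2 * t * B + 6 * (t * n) + 5 * ((t * n) * (2 * t * B)) powr (2/3)"
      using inc_le[OF U(1) Z(1)] U(2) Z(2) by linarith
  qed (use t in simp)
  also have "\<dots> = 2 + 6 * real n / real B + 5 * (((t * n) * (2 * t * B)) powr (2/3) / (t * B))"
    using t B0 by (simp add: field_simps)
  also have "((t * n) * (2 * t * B)) powr (2/3) / (t * B)
      = 2 powr (2/3) * (real n powr (2/3) * real B powr (-1/3)) * (2 powr (1/3)) ^ k"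
  proof -
    have "((t * n) * (2 * t * B)) powr (2/3) = 2 powr (2/3) * (t powr (2/3) * t powr (2/3)) * real n powr (2/3) * real B powr (2/3)"
      using t B0 by (simp add: powr_mult mult_ac)
    moreover have "t powr (2/3) * t powr (2/3) = t * t powr (1/3)"
    proof -
      have "t powr (2/3) * t powr (2/3) = t powr (1 + 1/3)" by (simp flip: powr_add)
      also have "\<dots> = t powr 1 * t powr (1/3)" by (rule powr_add)
      finally show ?thesis using t by simp
    qed
    moreover have "real B powr (2/3) = B * real B powr (-1/3)"
    proof -
      have "real B powr (2/3) = real B powr (1 + (-1/3))" by simp
      also have "\<dots> = real B powr 1 * real B powr (-1/3)" by (rule powr_add)
      finally show ?thesis using B0 by simp
    qed
    moreover have "t powr (1/3) = (2 powr (1/3)) ^ k"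
      unfolding t_def by (simp add: powr_powr mult.commute flip: powr_realpow)
    ultimately show ?thesis using t B0 by (simp add: field_simps)
  qed
  also have "5 * (2 powr (2/3) * (real n powr (2/3) * real B powr (-1/3)) * (2 powr (1/3)) ^ k)
     \<le> 8 * (real n powr (2/3) * real B powr (-1/3)) * (2 powr (1/3)) ^ k"
  proof -
    \<comment> \<open>The constant 8 in the bound is 5 times 8/5, and (8/5)^3 exceeds 4.\<close>
    have "(2::real) powr (2/3) \<le> 8/5"
    proof -
      have "((2::real) powr (2/3)) ^ 3 = 4" by (subst powr_power) auto
      then have "((2::real) powr (2/3)) ^ 3 \<le> (8/5) ^ 3" by (simp only:) (simp add: power3_eq_cube)
      then show ?thesis by (subst (asm) power_mono_iff) auto
    qed
    then have "(5 * 2 powr (2/3)) * ((real n powr (2/3) * real B powr (-1/3)) * (2 powr (1/3)) ^ k)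
      \<le> 8 * ((real n powr (2/3) * real B powr (-1/3)) * (2 powr (1/3)) ^ k)"
      by (intro mult_right_mono) auto
    then show ?thesis by (simp add: mult_ac)
  qed
  finally show ?thesis by (simp add: I_def)
qed

text \<open>The first summand collects at most 1 + log n blocks at 2 + 6 n / B each; the second is
  the geometric series of the Szemeredi-Trotter terms, dominated by the block near n.\<close>

definition err :: "nat \<Rightarrow> nat \<Rightarrow> real" where
  "err n B = (1 + log 2 n) * (2 + 6 * real n / real B) + 64 * (n * real B powr (-1/3))"

lemma sum_inc_le_err:
  fixes X :: "nat \<Rightarrow> point set" and \<Lambda> :: "nat \<Rightarrow> (real \<times> real) set"
  assumes X: "\<And>i. finite (X i)" "\<And>i. card (X i) \<le> n" "\<And>i j. i \<noteq> j \<Longrightarrow> X i \<inter> X j = {}"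
    and \<Lambda>: "\<And>i. \<Lambda> i \<subseteq> \<Lambda> (Suc i)" "\<And>i. finite (\<Lambda> i)" "\<And>i. card (\<Lambda> i) \<le> 1 + i * B" and B: "B \<ge> 1"
    and j: "j \<le> n" "n > 0"
  shows "(\<Sum>i<j. real (inc (X i) (\<Lambda> (Suc i))) / real (1 + Suc i * B)) \<le> err n B"
proof -
  let ?f = "\<lambda>i. real (inc (X i) (\<Lambda> (Suc i))) / real (1 + Suc i * B)"
  define c where "c = real n powr (2/3) * real B powr (-1/3)"
  define q where "q = (2::real) powr (1/3)"
  have c0: "c \<ge> 0" by (simp add: c_def)
  have q: "q \<ge> 5/4"
  proof -
    have "q ^ 3 = 2" unfolding q_def by (subst powr_power) auto
    then have "(5/4) ^ 3 \<le> q ^ 3" by (simp only:) (simp add: power3_eq_cube)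
    then show ?thesis by (subst (asm) power_mono_iff) (auto simp: q_def)
  qed
  \<comment> \<open>The 32 is fitted to the ratio q \<ge> 5/4: a new block adds 8, and 32 + 8 \<le>
    32 q.\<close>
  have sum: "(\<Sum>i<2^K - 1. ?f i) \<le> K * (2 + 6 * real n / real B) + 32 * c * q ^ K" for K
  proof (induction K)
    case 0
    then show ?case using c0 by simp
  next
    case (Suc K)
    have "(\<Sum>i<2^Suc K - 1. ?f i) = (\<Sum>i<2^K - 1. ?f i) + (\<Sum>i\<in>{2^K - 1..<2^Suc K - 1}. ?f i)"
      by (simp only: lessThan_atLeast0) (rule sum.atLeastLessThan_concat[symmetric], auto)
    also have "\<dots> \<le> (K * (2 + 6 * real n / real B) + 32 * c * q ^ K) + (2 + 6 * real n / real B + 8 * c * q ^ K)"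
      by (intro add_mono Suc) (unfold c_def q_def,
        rule dyadic_block[where X = X and \<Lambda> = \<Lambda> and n = n and B = B, OF X \<Lambda> B])
    also have "\<dots> = Suc K * (2 + 6 * real n / real B) + 40 * (c * q ^ K)" by (simp add: algebra_simps add_divide_distrib)
    also have "40 * (c * q ^ K) \<le> 32 * c * q ^ Suc K"
    proof -
      have "40 \<le> 32 * q" using q by simp
      then have "40 * (c * q ^ K) \<le> 32 * q * (c * q ^ K)"
        using c0 q by (intro mult_right_mono) auto
      then show ?thesis by (simp add: mult_ac)
    qed
    finally show ?case by simp
  qed
  \<comment> \<open>Enough blocks to cover all indices below n, yet q^K is still at most 2
    n^(1/3).\<close>
  define K where "K = Suc (nat \<lfloor>log 2 n\<rfloor>)"
  have lg: "log 2 n \<ge> 0" using j by simp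
  have K1: "real K \<le> 1 + log 2 n" using lg by (simp add: K_def)
  have "log 2 n < K" using lg by (simp add: K_def) linarith
  then have "n < 2 powr real K" using j by (simp add: log_less_iff)
  then have "real n < 2 ^ K" by (simp add: powr_realpow)
  then have "real n < real (2 ^ K)" by simp
  then have "n < 2 ^ K" by (simp only: of_nat_less_iff)
  then have "(\<Sum>i<j. ?f i) \<le> (\<Sum>i<2^K - 1. ?f i)" using j by (intro sum_mono2) auto
  also have "\<dots> \<le> K * (2 + 6 * real n / real B) + 32 * c * q ^ K" by (rule sum)
  also have "K * (2 + 6 * real n / real B) \<le> (1 + log 2 n) * (2 + 6 * real n / real B)" using K1 by (rule mult_right_mono) simp
  also have "32 * c * q ^ K \<le> 64 * (n * real B powr (-1/3))"
  proof -
    have "q ^ K = 2 powr (K / 3)" by (simp add: q_def powr_power)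
    also have "\<dots> \<le> 2 powr ((1 + log 2 n) / 3)" using K1 by (intro powr_mono) auto
    also have "\<dots> = (2 powr (1 + log 2 n)) powr (1/3)" by (simp add: powr_powr)
    also have "2 powr (1 + log 2 n) = 2 * real n" using j by (simp add: powr_add)
    also have "(2 * real n) powr (1/3) \<le> 2 * real n powr (1/3)"
    proof -
      have "(2::real) powr (1/3) \<le> 2 powr 1" by (rule powr_mono) auto
      then show ?thesis by (simp add: powr_mult mult_right_mono)
    qed
    finally have "32 * c * q ^ K \<le> 32 * c * (2 * real n powr (1/3))" using c0 by (intro mult_left_mono) auto
    also have "\<dots> = 64 * ((real n powr (2/3) * real n powr (1/3)) * real B powr (-1/3))"
      by (simp add: c_def mult_ac)
    also have "real n powr (2/3) * real n powr (1/3) = n" using j by (simp flip: powr_add)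
    finally show ?thesis .
  qed
  finally show ?thesis by (simp add: err_def)
qed

text \<open>The averaging bound for the family consisting of x alone, where the average is the
  excess itself and s = 1 yields the denominators 1 + i B.\<close>

lemma live_excess_le_err:
  fixes M D X :: "nat \<Rightarrow> point set"
  assumes step: "\<And>i. M (Suc i) = M i \<union> X i" and fin: "\<And>i. finite (M i)" "\<And>i. finite (X i)"
    and new: "\<And>i. X i \<inter> M i = {}" and D: "\<And>i. D i \<subseteq> D (Suc i)"
    and tr: "\<And>i. i \<in> {a..<a + j} \<Longrightarrow> treated B g (M (Suc i)) (D i) (D (Suc i))"
    and start: "card (M a) \<le> g" and B: "B \<ge> 1" and j: "j \<le> n" "n > 0"
    and X: "\<And>i. i \<in> {a..<a + j} \<Longrightarrow> card (X i) \<le> n"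
    and x: "live (M (a + j)) (D (a + j)) x"
  shows "real (count_on (M (a + j)) x) \<le> g + err n B"
proof -
  have "\<exists>\<Lambda>. \<Lambda> 0 = {fst x} \<and> (\<forall>i. \<Lambda> i \<subseteq> \<Lambda> (Suc i)) \<and> (\<forall>i. finite (\<Lambda> i) \<and> card (\<Lambda> i) \<le> 1 + i * B) \<and>
    real (\<Sum>x\<in>{x}. count_on (M (a + j)) x - g) / real 1
      \<le> (\<Sum>i<j. real (inc (X (a + j - Suc i)) (\<Lambda> (Suc i))) / real (1 + Suc i * B))"
    by (rule excess_average_bound[OF step fin D tr start]) (use x in auto)
  then obtain \<Lambda> where L: "\<forall>i. \<Lambda> i \<subseteq> \<Lambda> (Suc i)" "\<forall>i. finite (\<Lambda> i) \<and> card (\<Lambda> i) \<le> 1 + i * B"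
    and le: "real (\<Sum>x\<in>{x}. count_on (M (a + j)) x - g) / real 1
      \<le> (\<Sum>i<j. real (inc (X (a + j - Suc i)) (\<Lambda> (Suc i))) / real (1 + Suc i * B))" by blast
  have \<Lambda>: "\<Lambda> i \<subseteq> \<Lambda> (Suc i)" "finite (\<Lambda> i)" "card (\<Lambda> i) \<le> 1 + i * B" for i
    using L by blast+
  \<comment> \<open>Turns are numbered backwards from a + j and continued by empty sets, because the
    truncated index would repeat turns and destroy disjointness.\<close>
  define X' where "X' i = (if i < j then X (a + j - Suc i) else {})" for i
  have M_mono: "M i \<subseteq> M k" if "i \<le> k" for i k
    using that by (rule lift_Suc_mono_le[rotated]) (auto simp: step)
  have disjX: "X i \<inter> X k = {}" if "i < k" for i k
    using M_mono[of "Suc i" k] new[of k] that step[of i] by auto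
  have disj: "X' i \<inter> X' k = {}" if ik: "i \<noteq> k" for i k
  proof (cases "i < j \<and> k < j")
    case True
    consider "a + j - Suc i < a + j - Suc k" | "a + j - Suc k < a + j - Suc i" using True ik by linarith
    then show ?thesis using disjX True by cases (auto simp: X'_def)
  qed (auto simp: X'_def)
  have "(\<Sum>i<j. real (inc (X' i) (\<Lambda> (Suc i))) / real (1 + Suc i * B)) \<le> err n B"
    by (rule sum_inc_le_err[where X = X' and \<Lambda> = \<Lambda>, OF _ _ disj \<Lambda> B j]) (use fin X in \<open>auto simp: X'_def\<close>)
  then have "real (count_on (M (a + j)) x - g) \<le> err n B"
    using le by (simp add: X'_def)
  then show ?thesis by linarith
qed

section \<open>Histories, winning segments and Breaker's replies\<close>

lemma finite_claimed: "legal_history m b h \<Longrightarrow> finite (maker_points h) \<and> finite (breaker_points h)"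
proof (induction rule: legal_history.induct)
  case Nil
  then show ?case by (simp add: maker_points_def breaker_points_def)
next
  case (snoc h X Y)
  then show ?case by (auto simp: maker_points_def breaker_points_def legal_move_def)
qed

lemma legal_move_extend:
  assumes "finite C" "finite Y" "Y \<inter> C = {}" "card Y \<le> k"
  shows "\<exists>Z. Y \<subseteq> Z \<and> legal_move k C Z"
proof -
  have inf: "infinite (UNIV - (C \<union> Y) :: point set)"
    using assms by (simp add: finite_prod infinite_UNIV_int Diff_infinite_finite)
  obtain W where W: "W \<subseteq> UNIV - (C \<union> Y)" "finite W" "card W = k - card Y"
    using infinite_arbitrarily_large[OF inf] by blast
  have "card (Y \<union> W) = k" using W assms by (subst card_Un_disjoint) auto
  then show ?thesis using W assms by (intro exI[of _ "Y \<union> W"]) (auto simp: legal_move_def)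
qed

lemma legal_history_play:
  assumes "maker_strategy m b \<sigma>" "breaker_strategy m b \<beta>"
  shows "legal_history m b (play \<sigma> \<beta> t) \<and> length (play \<sigma> \<beta> t) = t"
proof (induction t)
  case 0
  then show ?case by (simp add: legal_history.Nil)
next
  case (Suc t)
  let ?h = "play \<sigma> \<beta> t"
  have "legal_move (m (Suc (length ?h))) (claimed ?h) (\<sigma> ?h)"
    using assms(1) Suc unfolding maker_strategy_def by blast
  moreover from this have "legal_move (b (Suc (length ?h))) (claimed ?h \<union> \<sigma> ?h) (\<beta> ?h (\<sigma> ?h))"
    using assms(2) Suc unfolding breaker_strategy_def by blast
  ultimately show ?case using Suc by (simp add: Let_def legal_history.snoc)
qed

lemma kappa_real_point: "kappa p = fst (real_point p) + sqrt 2 * snd (real_point p)"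
  by (simp add: kappa_def real_point_def)

text \<open>As a linear functional of the plane, \<open>kappa\<close> interpolates between its
  values at the endpoints along the closed segment. With n \<ge> 2 the endpoints are distinct and
  determine a line.\<close>

lemma winning_segment_subset_seg:
  assumes w: "winning_segment n M D S" and n: "n \<ge> 2"
  shows "\<exists>x. S \<subseteq> seg x \<and> seg x \<inter> D = {}"
proof -
  obtain p q where pq: "p \<in> S" "q \<in> S"
    and S: "real_point ` S \<subseteq> closed_segment (real_point p) (real_point q)"
    and D: "real_point ` D \<inter> closed_segment (real_point p) (real_point q) = {}"
    and c: "card S = n" "finite S"
    using w by (auto simp: winning_segment_def)
  have inj: "inj real_point" by (rule injI) (auto simp: real_point_def prod_eq_iff)
  have "p \<noteq> q"
  proof
    assume "p = q"
    then have "real_point ` S \<subseteq> {real_point p}" using S by simp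
    then have "S \<subseteq> {p}" using inj by (auto dest: injD)
    then have "card S \<le> 1" using card_mono[of "{p}" S] by simp
    then show False using c n by simp
  qed
  then obtain l where l: "on_line l (emb p)" "on_line l (emb q)" using ex_line by blast
  let ?x = "(l, min (kappa p) (kappa q), max (kappa p) (kappa q))"
  have "r \<in> seg ?x" if r: "r \<in> S" for r
  proof -
    obtain u where u: "0 \<le> u" "u \<le> 1" "real_point r = (1 - u) *\<^sub>R real_point p + u *\<^sub>R real_point q"
      using S r by (auto simp: closed_segment_def)
    have k: "kappa r = (1 - u) * kappa p + u * kappa q"
      unfolding kappa_real_point u(3) by (simp add: algebra_simps)
    have s: "real_of_int (snd r) = (1 - u) * real_of_int (snd p) + u * real_of_int (snd q)"
      using arg_cong[OF u(3), of snd] by (simp add: real_point_def)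
    have "on_line l (emb r)"
      using l unfolding on_line_def fst_emb snd_emb s k by (simp add: algebra_simps)
    moreover have "min (kappa p) (kappa q) \<le> kappa r" "kappa r \<le> max (kappa p) (kappa q)"
    proof -
      have "(1 - u) * min (kappa p) (kappa q) + u * min (kappa p) (kappa q) \<le> kappa r"
        unfolding k using u by (intro add_mono mult_left_mono) auto
      then show "min (kappa p) (kappa q) \<le> kappa r" by (simp add: algebra_simps)
      have "kappa r \<le> (1 - u) * max (kappa p) (kappa q) + u * max (kappa p) (kappa q)"
        unfolding k using u by (intro add_mono mult_left_mono) auto
      then show "kappa r \<le> max (kappa p) (kappa q)" by (simp add: algebra_simps)
    qed
    ultimately show ?thesis by simp
  qed
  \<comment> \<open>The reverse inclusion transfers the absence of Breaker points: the parameter u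
    of a lattice point of \<open>seg\<close> is read off from its \<open>kappa\<close>
    value.\<close>
  moreover have "real_point r \<in> closed_segment (real_point p) (real_point q)" if r: "r \<in> seg ?x" for r
  proof -
    define u where "u = (kappa r - kappa p) / (kappa q - kappa p)"
    have kn: "kappa q - kappa p \<noteq> 0" using \<open>p \<noteq> q\<close> by auto
    then have ku: "u * (kappa q - kappa p) = kappa r - kappa p" by (simp add: u_def)
    have rr: "on_line l (emb r)" "min (kappa p) (kappa q) \<le> kappa r" "kappa r \<le> max (kappa p) (kappa q)"
      using r by auto
    have u01: "0 \<le> u" "u \<le> 1"
      using rr(2,3) kn unfolding u_def by (auto simp: divide_simps min_def max_def split: if_splits)
    have k: "kappa r = (1 - u) * kappa p + u * kappa q" using ku by (simp add: algebra_simps)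
    have s: "real_of_int (snd r) = (1 - u) * real_of_int (snd p) + u * real_of_int (snd q)"
      using l rr(1) unfolding on_line_def fst_emb snd_emb k by (simp add: algebra_simps)
    have f: "real_of_int (fst r) = (1 - u) * real_of_int (fst p) + u * real_of_int (fst q)"
    proof -
      have "real_of_int (fst r) = kappa r - sqrt 2 * real_of_int (snd r)" by (simp add: kappa_def)
      also have "\<dots> = (1 - u) * real_of_int (fst p) + u * real_of_int (fst q)"
        unfolding k s by (simp add: kappa_def algebra_simps)
      finally show ?thesis .
    qed
    have "real_point r = (1 - u) *\<^sub>R real_point p + u *\<^sub>R real_point q"
      by (simp add: real_point_def prod_eq_iff s f)
    then show ?thesis using u01 by (auto simp: closed_segment_def)
  qed
  then have "seg ?x \<inter> D = {}" using D by blast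
  ultimately show ?thesis by (intro exI[of _ ?x]) blast
qed

lemma winning_segment_antimono:
  assumes "winning_segment n M D S" "S \<subseteq> M'" "D' \<subseteq> D"
  shows "winning_segment n M' D' S"
proof -
  obtain p q where "p \<in> S" "q \<in> S" "real_point ` S \<subseteq> closed_segment (real_point p) (real_point q)"
    "real_point ` D \<inter> closed_segment (real_point p) (real_point q) = {}"
    using assms(1) unfolding winning_segment_def by blast
  moreover from this have "real_point ` D' \<inter> closed_segment (real_point p) (real_point q) = {}"
    using assms(3) by blast
  ultimately show ?thesis
    using assms(1,2) unfolding winning_segment_def by blast
qed

text \<open>A strategy has to be legal after every legal history, while good moves are known to
  exist only along the play under study. Choosing a move with this property achieves both.\<close>

lemma ex_legal_move_preferring:
  assumes "finite C"
  shows "\<exists>Y. legal_move k C Y \<and> ((\<exists>Z. legal_move k C Z \<and> Q Z) \<longrightarrow> Q Y)"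
  using legal_move_extend[OF assms, of "{}" k] by auto

text \<open>Until a the points of Maker number at most g, so nothing is asked of Breaker. Afterwards
  live segments keep at most g + err points before a turn and at most H after Maker's move, which
  bounds the price of treating B of them by the available b. As \<mu> bounds a turn of Maker, no
  live segment can be completed to n points at once.\<close>

lemma breaker_prevents:
  fixes m b :: "nat \<Rightarrow> nat"
  assumes n: "n \<ge> 2" and T: "T \<le> n" and \<mu>: "\<And>t. t < T \<Longrightarrow> m (Suc t) \<le> \<mu>" "\<mu> \<le> n"
    and g: "g > 0" and B: "B \<ge> 1"
    and win: "g + err n B + \<mu> < n" and H: "g + err n B + \<mu> \<le> real H"
    and early: "(\<Sum>t<a. m (Suc t)) \<le> g"
    and b: "\<And>t. a \<le> t \<Longrightarrow> B * (2 * (H div g)) \<le> b (Suc t)"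
  shows "\<not> maker_guarantees m b n T"
proof
  assume "maker_guarantees m b n T"
  then obtain \<sigma> where \<sigma>: "maker_strategy m b \<sigma>"
    and \<sigma>w: "\<And>\<beta>. breaker_strategy m b \<beta> \<Longrightarrow> \<exists>t<T. let h = play \<sigma> \<beta> t in
            \<exists>S. winning_segment n (maker_points h \<union> \<sigma> h) (breaker_points h) S"
    unfolding maker_guarantees_def by blast
  define leg where "leg h X Y = legal_move (b (Suc (length h))) (claimed h \<union> X) Y" for h X Y
  define good where "good h X Y = treated B g (maker_points h \<union> X) (breaker_points h) (breaker_points h \<union> Y)"
    for h :: history and X Y
  define \<beta> where "\<beta> h X = (SOME Y. leg h X Y \<and> ((\<exists>Z. leg h X Z \<and> good h X Z) \<longrightarrow> good h X Y))" for h X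
  have \<beta>: "leg h X (\<beta> h X) \<and> ((\<exists>Z. leg h X Z \<and> good h X Z) \<longrightarrow> good h X (\<beta> h X))"
    if "legal_history m b h" "finite X" for h X
  proof -
    have "finite (claimed h \<union> X)" using finite_claimed[OF that(1)] that(2) by (simp add: claimed_def)
    from ex_legal_move_preferring[OF this] show ?thesis
      unfolding \<beta>_def leg_def by (rule someI_ex)
  qed
  have \<beta>s: "breaker_strategy m b \<beta>"
    unfolding breaker_strategy_def using \<beta> by (auto simp: leg_def legal_move_def)
  define h where "h t = play \<sigma> \<beta> t" for t
  define M where "M t = maker_points (h t)" for t
  define D where "D t = breaker_points (h t)" for t
  define X where "X t = \<sigma> (h t)" for t
  have leg_h: "legal_history m b (h t)" "length (h t) = t" for t
    using legal_history_play[OF \<sigma> \<beta>s] by (auto simp: h_def)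
  have hS: "h (Suc t) = h t @ [(X t, \<beta> (h t) (X t))]" for t by (simp add: h_def X_def Let_def)
  have Mstep: "M (Suc t) = M t \<union> X t" for t by (auto simp: M_def hS maker_points_def)
  have Dstep: "D (Suc t) = D t \<union> \<beta> (h t) (X t)" for t by (auto simp: D_def hS breaker_points_def)
  have fin: "finite (M t)" "finite (D t)" for t using finite_claimed[OF leg_h(1)] by (auto simp: M_def D_def)
  have Xleg: "legal_move (m (Suc t)) (M t \<union> D t) (X t)" for t
    using \<sigma> leg_h[of t] unfolding maker_strategy_def X_def M_def D_def claimed_def[symmetric] by metis
  then have Xf: "finite (X t)" "card (X t) = m (Suc t)" "X t \<inter> M t = {}" "X t \<inter> D t = {}" for t
    by (auto simp: legal_move_def)
  have Dm: "D t \<subseteq> D (Suc t)" for t by (auto simp: Dstep)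
  have M0: "M 0 = {}" by (simp add: M_def h_def maker_points_def)
  have cM: "card (M t) \<le> (\<Sum>i<t. m (Suc i))" for t
  proof (induction t)
    case (Suc t)
    then show ?case using card_Un_le[of "M t" "X t"] by (simp add: Mstep Xf)
  qed (simp add: M0)
  have Ma: "card (M a) \<le> g" using cM[of a] early by simp
  have err0: "0 \<le> err n B" using n by (simp add: err_def)
  have Mm: "M i \<subseteq> M k" if "i \<le> k" for i k
    using that by (rule lift_Suc_mono_le[rotated]) (auto simp: Mstep)
  have bound: "real (count_on (M t) x) \<le> g + err n B"
    if t: "t < T" and x: "live (M t) (D t) x"
      and tr: "\<And>i. i \<in> {a..<t} \<Longrightarrow> treated B g (M (Suc i)) (D i) (D (Suc i))" for t x
  proof (cases "t \<le> a")
    case True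
    have "count_on (M t) x \<le> card (M a)"
      unfolding count_on_def by (rule card_mono) (use fin Mm[OF True] in auto)
    then show ?thesis using Ma err0 by linarith
  next
    case False
    then have ta: "a + (t - a) = t" by simp
    have "real (count_on (M (a + (t - a))) x) \<le> g + err n B"
    proof (rule live_excess_le_err[where M = M and X = X and D = D, OF Mstep fin(1) Xf(1) Xf(3) Dm])
      show "treated B g (M (Suc i)) (D i) (D (Suc i))" if "i \<in> {a..<a + (t - a)}" for i
        using tr that by (simp add: ta)
      show "card (X i) \<le> n" if "i \<in> {a..<a + (t - a)}" for i
        using \<mu>(1)[of i] \<mu>(2) that t by (simp add: Xf ta)
    qed (use Ma B n T t x in \<open>auto simp: ta\<close>)
    then show ?thesis by (simp add: ta)
  qed
  \<comment> \<open>Strong induction: the bound on live segments at t uses only the turns treated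
    before t, and this bound is what makes the treatment at t affordable.\<close>
  have treat: "treated B g (M (Suc t)) (D t) (D (Suc t))" if "a \<le> t" "t < T" for t
    using that
  proof (induction t rule: less_induct)
    case (less t)
    have bd: "real (count_on (M t) x) \<le> g + err n B" if "live (M t) (D t) x" for x
      by (rule bound[OF less.prems(2) that]) (use less in auto)
    have "count_on (M (Suc t)) x \<le> H" if x: "live (M (Suc t)) (D t) x" for x
    proof -
      have "live (M t) (D t) x" using x by (rule live_antimono) (auto simp: Mstep)
      moreover have "card (seg x \<inter> X t) \<le> \<mu>"
        using card_mono[of "X t" "seg x \<inter> X t"] Xf[of t] \<mu>(1)[OF less.prems(2)] by simp
      moreover have "count_on (M (Suc t)) x \<le> count_on (M t) x + card (seg x \<inter> X t)"
        unfolding Mstep by (rule count_on_Un[OF fin(1) Xf(1)])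
      ultimately have "real (count_on (M (Suc t)) x) \<le> H" using bd[of x] H by linarith
      then show ?thesis by simp
    qed
    from treat_many[OF fin(1) g this, where B = B] obtain Y where Y: "finite Y" "Y \<inter> (M (Suc t) \<union> D t) = {}"
      "card Y \<le> B * (2 * (H div g))" "treated B g (M (Suc t)) (D t) (D t \<union> Y)" by blast
    have "card Y \<le> b (Suc t)" using Y(3) b[OF less.prems(1)] by linarith
    moreover have "finite (claimed (h t) \<union> X t)" "Y \<inter> (claimed (h t) \<union> X t) = {}"
      using fin[of t] Xf[of t] Y(2) unfolding claimed_def M_def[symmetric] D_def[symmetric] Mstep by auto
    ultimately obtain Z where Z: "Y \<subseteq> Z" "legal_move (b (Suc t)) (claimed (h t) \<union> X t) Z"
      using legal_move_extend[of "claimed (h t) \<union> X t" Y "b (Suc t)"] Y(1) by blast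
    have "leg (h t) (X t) Z" using Z by (simp add: leg_def leg_h)
    moreover have "good (h t) (X t) Z"
      unfolding good_def M_def[symmetric] D_def[symmetric] Mstep[symmetric]
      by (rule treated_mono[OF Y(4)]) (use Z in auto)
    ultimately have "good (h t) (X t) (\<beta> (h t) (X t))" using \<beta>[OF leg_h(1) Xf(1)] by blast
    then show ?case
      unfolding good_def M_def[symmetric] D_def[symmetric] Mstep[symmetric] Dstep[symmetric] .
  qed
  \<comment> \<open>A winning set with a new point lies in a segment that was live before the turn,
    and such a segment had too few points.\<close>
  have old: "S \<subseteq> M t" if t: "t < T" and w: "winning_segment n (M t \<union> X t) (D t) S" for t S
  proof (rule ccontr)
    assume "\<not> S \<subseteq> M t"
    obtain x where x: "S \<subseteq> seg x" "seg x \<inter> D t = {}" using winning_segment_subset_seg[OF w n] by blast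
    then have "live (M t) (D t) x" using \<open>\<not> S \<subseteq> M t\<close> by (auto simp: live_def)
    then have cnt: "real (count_on (M t) x) \<le> g + err n B"
      by (rule bound[OF t]) (use treat t in auto)
    have "S \<subseteq> M t \<union> X t" "card S = n" using w by (auto simp: winning_segment_def)
    moreover from this have "S \<subseteq> (seg x \<inter> M t) \<union> X t" using x by blast
    ultimately have "n \<le> card ((seg x \<inter> M t) \<union> X t)"
      using card_mono[of "(seg x \<inter> M t) \<union> X t" S] fin[of t] Xf[of t] by simp
    also have "\<dots> \<le> count_on (M t) x + card (X t)" unfolding count_on_def by (rule card_Un_le)
    also have "card (X t) \<le> \<mu>" using \<mu>(1)[OF t] by (simp add: Xf)
    finally show False using cnt win by linarith
  qed
  have no_win: "\<not> winning_segment n (M t \<union> X t) (D t) S" if "t < T" for t S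
    using that
  proof (induction t)
    case 0
    show ?case
    proof
      assume w: "winning_segment n (M 0 \<union> X 0) (D 0) S"
      then have "S = {}" using old[OF 0] M0 by blast
      then show False using w n by (auto simp: winning_segment_def)
    qed
  next
    case (Suc t)
    show ?case
    proof
      assume w: "winning_segment n (M (Suc t) \<union> X (Suc t)) (D (Suc t)) S"
      \<comment> \<open>A winning set made of old points was winning in the preceding timestep
        already, when Breaker had fewer points.\<close>
      then have "S \<subseteq> M t \<union> X t" using old[OF Suc.prems] Mstep by blast
      then have "winning_segment n (M t \<union> X t) (D t) S"
        using winning_segment_antimono[OF w _ Dm] by blast
      then show False using Suc by simp
    qed
  qed
  from \<sigma>w[OF \<beta>s] no_win show False
    unfolding h_def[symmetric] M_def[symmetric] D_def[symmetric] X_def[symmetric] Let_def by blast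
qed

section \<open>Maker's strategy\<close>

lemma maker_guaranteesI:
  assumes I0: "Inv []" and T: "T > 0"
    and step: "\<And>h. legal_history m b h \<Longrightarrow> length h < T \<Longrightarrow> Inv h \<Longrightarrow>
      \<exists>X. legal_move (m (Suc (length h))) (claimed h) X \<and>
        ((\<exists>S. winning_segment n (maker_points h \<union> X) (breaker_points h) S) \<or>
         (Suc (length h) < T \<and>
          (\<forall>Y. legal_move (b (Suc (length h))) (claimed h \<union> X) Y \<longrightarrow> Inv (h @ [(X, Y)]))))"
  shows "maker_guarantees m b n T"
proof -
  define good where "good h X \<longleftrightarrow> legal_move (m (Suc (length h))) (claimed h) X \<and>
        ((\<exists>S. winning_segment n (maker_points h \<union> X) (breaker_points h) S) \<or>
         (Suc (length h) < T \<and>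
          (\<forall>Y. legal_move (b (Suc (length h))) (claimed h \<union> X) Y \<longrightarrow> Inv (h @ [(X, Y)]))))" for h X
  define \<sigma> where "\<sigma> h = (SOME X. legal_move (m (Suc (length h))) (claimed h) X \<and>
     ((\<exists>Z. legal_move (m (Suc (length h))) (claimed h) Z \<and> good h Z) \<longrightarrow> good h X))" for h
  have \<sigma>: "legal_move (m (Suc (length h))) (claimed h) (\<sigma> h) \<and>
     ((\<exists>Z. legal_move (m (Suc (length h))) (claimed h) Z \<and> good h Z) \<longrightarrow> good h (\<sigma> h))"
    if "legal_history m b h" for h
  proof -
    have "finite (claimed h)" using finite_claimed[OF that] by (simp add: claimed_def)
    from ex_legal_move_preferring[OF this] show ?thesis unfolding \<sigma>_def by (rule someI_ex)
  qed
  have \<sigma>s: "maker_strategy m b \<sigma>" unfolding maker_strategy_def using \<sigma> by blast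
  have "\<exists>t<T. \<exists>S. winning_segment n (maker_points (play \<sigma> \<beta> t) \<union> \<sigma> (play \<sigma> \<beta> t)) (breaker_points (play \<sigma> \<beta> t)) S"
    if \<beta>: "breaker_strategy m b \<beta>" for \<beta>
  proof (rule ccontr)
    assume no: "\<not> ?thesis"
    define h where "h t = play \<sigma> \<beta> t" for t
    have leg: "legal_history m b (h t)" "length (h t) = t" for t
      using legal_history_play[OF \<sigma>s \<beta>] by (auto simp: h_def)
    have good: "good (h t) (\<sigma> (h t))" if "t < T" "Inv (h t)" for t
    proof -
      have "\<exists>Z. good (h t) Z" using step[OF leg(1)[of t]] that by (auto simp: leg good_def)
      then show ?thesis using \<sigma>[OF leg(1)[of t]] unfolding good_def by blast
    qed
    have inv: "Inv (h t)" if "t < T" for t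
      using that
    proof (induction t)
      case 0
      then show ?case using I0 by (simp add: h_def)
    next
      case (Suc t)
      have "good (h t) (\<sigma> (h t))" using good Suc by simp
      moreover have "legal_move (b (Suc (length (h t)))) (claimed (h t) \<union> \<sigma> (h t)) (\<beta> (h t) (\<sigma> (h t)))"
        using \<beta> leg(1)[of t] \<sigma>[OF leg(1)[of t]] unfolding breaker_strategy_def by blast
      moreover have "\<not> (\<exists>S. winning_segment n (maker_points (h t) \<union> \<sigma> (h t)) (breaker_points (h t)) S)"
        using no Suc.prems by (auto simp: h_def)
      ultimately have "Inv (h t @ [(\<sigma> (h t), \<beta> (h t) (\<sigma> (h t)))])" unfolding good_def by blast
      then show ?case by (simp add: h_def Let_def)
    qed
    \<comment> \<open>In the last turn the alternative of merely preserving the invariant is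
      excluded by the strict bound on the length, so a good move must win.\<close>
    have "T - 1 < T" using T by simp
    then have "good (h (T - 1)) (\<sigma> (h (T - 1)))" using good inv by blast
    moreover have "\<not> (\<exists>S. winning_segment n (maker_points (h (T - 1)) \<union> \<sigma> (h (T - 1))) (breaker_points (h (T - 1))) S)"
      using no \<open>T - 1 < T\<close> by (auto simp: h_def)
    ultimately show False unfolding good_def using T by (simp add: leg)
  qed
  then show ?thesis unfolding maker_guarantees_def Let_def using \<sigma>s by blast
qed

section \<open>The box game on rows\<close>

definition lattice_row :: "int \<Rightarrow> point set" where
  "lattice_row y = {p. snd p = y}"

lemma row_free_points:
  assumes "finite C"
  shows "\<exists>W. W \<subseteq> lattice_row y - C \<and> finite W \<and> card W = k"
proof -
  have "infinite (lattice_row y)"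
  proof
    assume "finite (lattice_row y)"
    then have "finite (fst ` lattice_row y)" by simp
    moreover have "x \<in> fst ` lattice_row y" for x
      by (rule image_eqI[of _ _ "(x, y)"]) (auto simp: lattice_row_def)
    then have "fst ` lattice_row y = UNIV" by blast
    ultimately show False by (simp add: infinite_UNIV_int)
  qed
  then have "infinite (lattice_row y - C)" using assms by (rule Diff_infinite_finite[rotated])
  from infinite_arbitrarily_large[OF this] show ?thesis by blast
qed

lemma winning_segment_row:
  assumes S: "S \<subseteq> M \<inter> lattice_row y" "finite S" "card S = n" "n \<ge> 1" and D: "D \<inter> lattice_row y = {}"
  shows "winning_segment n M D S"
proof -
  have Sne: "S \<noteq> {}" using S by auto
  obtain p where p: "p \<in> S" "\<forall>r\<in>S. fst p \<le> fst r" using ex_min_value[OF S(2) Sne, of fst] by blast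
  obtain q where q: "q \<in> S" "\<forall>r\<in>S. - fst q \<le> - fst r"
    using ex_min_value[OF S(2) Sne, of "\<lambda>r. - fst r"] by blast
  have y: "snd r = y" if "r \<in> S" for r using that S by (auto simp: lattice_row_def)
  have "collinear (real_point ` S)"
    unfolding collinear_def
  proof (intro exI[of _ "(1, 0)"] ballI)
    fix a b assume "a \<in> real_point ` S" "b \<in> real_point ` S"
    then obtain r s where "r \<in> S" "s \<in> S" "a = real_point r" "b = real_point s" by blast
    then have "a - b = (real_of_int (fst r) - real_of_int (fst s)) *\<^sub>R (1, 0)"
      using y by (simp add: real_point_def)
    then show "\<exists>c. a - b = c *\<^sub>R (1, 0)" by blast
  qed
  moreover have "real_point r \<in> closed_segment (real_point p) (real_point q)" if r: "r \<in> S" for r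
  proof (cases "fst p = fst q")
    case True
    then have "fst r = fst p" using p(2) q(2) r by force
    then have "r = p" using y r p by (simp add: prod_eq_iff)
    then show ?thesis by simp
  next
    case False
    have o: "fst p \<le> fst r" "fst r \<le> fst q" using p(2) q(2) r by auto
    then have lt: "fst p < fst q" using False by simp
    define u where "u = real_of_int (fst r - fst p) / real_of_int (fst q - fst p)"
    have u: "0 \<le> u" "u \<le> 1" using o lt by (auto simp: u_def)
    have "u * real_of_int (fst q - fst p) = real_of_int (fst r - fst p)" using lt by (simp add: u_def)
    then have "real_point r = (1 - u) *\<^sub>R real_point p + u *\<^sub>R real_point q"
      using y[OF r] y[OF p(1)] y[OF q(1)] by (simp add: real_point_def algebra_simps)
    then show ?thesis using u by (auto simp: closed_segment_def)
  qed
  moreover have "real_point w \<notin> closed_segment (real_point p) (real_point q)" if w: "w \<in> D" for w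
  proof
    assume "real_point w \<in> closed_segment (real_point p) (real_point q)"
    then obtain u where "real_point w = (1 - u) *\<^sub>R real_point p + u *\<^sub>R real_point q"
      by (auto simp: closed_segment_def)
    from arg_cong[OF this, of snd] have "real_of_int (snd w) = real_of_int y"
      using y[OF p(1)] y[OF q(1)] by (simp add: real_point_def algebra_simps)
    then have "w \<in> lattice_row y" by (simp add: lattice_row_def)
    then show False using w D by blast
  qed
  ultimately show ?thesis
    unfolding winning_segment_def using S p q by blast
qed

text \<open>What every intact row is sure to have received after k of the r box turns, where \<mu>
  bounds the size of each turn from below.\<close>

definition box_gain :: "nat \<Rightarrow> nat \<Rightarrow> nat \<Rightarrow> nat \<Rightarrow> nat" where
  "box_gain \<mu> B r k = (\<Sum>j<k. \<mu> div (1 + B * (r - j)))"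

text \<open>From timestep \<open>T + 1\<close> on Maker plays the box game on \<open>1 + B * r\<close> rows without claimed points:
  he distributes his points evenly over the rows not yet touched by Breaker.\<close>

lemma maker_box_strategy:
  fixes m b :: "nat \<Rightarrow> nat"
  assumes m: "mono m" and b: "\<And>k. k < r \<Longrightarrow> b (Suc (T + k)) \<le> B"
    and n: "n \<ge> 1" "n \<le> box_gain (m (Suc T)) B r r + m (Suc (T + r))"
  shows "maker_guarantees m b n (Suc (T + r))"
proof -
  define \<mu> where "\<mu> = m (Suc T)"
  \<comment> \<open>Before T completed timesteps no k qualifies, so the invariant is vacuous and
    Maker may play anything.\<close>
  define Inv where "Inv h \<longleftrightarrow> (\<forall>k. k \<le> r \<longrightarrow> length h = T + k \<longrightarrow>
     (\<exists>A. finite A \<and> card A = 1 + B * (r - k) \<and>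
       (\<forall>y\<in>A. breaker_points h \<inter> lattice_row y = {} \<and> box_gain \<mu> B r k \<le> card (maker_points h \<inter> lattice_row y))))" for h
  have start: "Inv h" if "legal_history m b h" "length h \<le> T" for h
    unfolding Inv_def
  proof (intro allI impI)
    fix k assume "k \<le> r" "length h = T + k"
    then have k: "k = 0" using that by simp
    \<comment> \<open>Rows are chosen free of Breaker's points; points that Maker already has there
      do no harm.\<close>
    have "finite (snd ` breaker_points h)" using finite_claimed[OF that(1)] by simp
    then have "infinite (UNIV - snd ` breaker_points h)" by (simp add: infinite_UNIV_int Diff_infinite_finite)
    from infinite_arbitrarily_large[OF this]
    obtain A where A: "A \<subseteq> UNIV - snd ` breaker_points h" "finite A" "card A = 1 + B * (r - k)" by blast
    then have "breaker_points h \<inter> lattice_row y = {}" if "y \<in> A" for y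
      using that by (auto simp: lattice_row_def)
    then show "\<exists>A. finite A \<and> card A = 1 + B * (r - k) \<and>
       (\<forall>y\<in>A. breaker_points h \<inter> lattice_row y = {} \<and> box_gain \<mu> B r k \<le> card (maker_points h \<inter> lattice_row y))"
      using A by (intro exI[of _ A]) (auto simp: k box_gain_def)
  qed
  show ?thesis
  proof (rule maker_guaranteesI[where Inv = Inv])
    show "Inv []" by (rule start) (auto intro: legal_history.Nil)
    show "Suc (T + r) > 0" by simp
    fix h assume h: "legal_history m b h" "length h < Suc (T + r)" "Inv h"
    have fin: "finite (maker_points h)" "finite (breaker_points h)" "finite (claimed h)"
      using finite_claimed[OF h(1)] by (auto simp: claimed_def)
    let ?goal = "\<exists>X. legal_move (m (Suc (length h))) (claimed h) X \<and>
        ((\<exists>S. winning_segment n (maker_points h \<union> X) (breaker_points h) S) \<or>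
         (Suc (length h) < Suc (T + r) \<and>
          (\<forall>Y. legal_move (b (Suc (length h))) (claimed h \<union> X) Y \<longrightarrow> Inv (h @ [(X, Y)]))))"
    have "length h < T \<or> (\<exists>k<r. length h = T + k) \<or> length h = T + r" using h(2) by presburger
    then consider "length h < T" | k where "length h = T + k" "k < r" | "length h = T + r" by blast
    then show ?goal
    proof cases
      case 1
      obtain X where X: "legal_move (m (Suc (length h))) (claimed h) X"
        using legal_move_extend[OF fin(3), of "{}"] by auto
      have "Inv (h @ [(X, Y)])" if "legal_move (b (Suc (length h))) (claimed h \<union> X) Y" for Y
        by (rule start[OF legal_history.snoc[OF h(1) X that]]) (use 1 in simp)
      then show ?thesis using X 1 by auto
    next
      case (2 k)
      define a where "a = 1 + B * (r - k)"
      obtain A where A: "finite A" "card A = a"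
        and Ay: "\<And>y. y \<in> A \<Longrightarrow> breaker_points h \<inter> lattice_row y = {}"
          "\<And>y. y \<in> A \<Longrightarrow> box_gain \<mu> B r k \<le> card (maker_points h \<inter> lattice_row y)"
        using h(3) 2 unfolding Inv_def a_def by (meson less_imp_le)
      define c where "c = \<mu> div a"
      obtain W where W: "\<And>y. W y \<subseteq> lattice_row y - claimed h" "\<And>y. finite (W y)" "\<And>y. card (W y) = c"
        using row_free_points[OF fin(3), of _ c] by metis
      let ?U = "\<Union>y\<in>A. W y"
      have "card ?U \<le> (\<Sum>y\<in>A. card (W y))" by (rule card_UN_le[OF A(1)])
      also have "\<dots> = a * c" by (simp add: W A)
      also have "\<dots> \<le> \<mu>" by (simp add: c_def)
      \<comment> \<open>Only \<mu> points, the size of the first box turn, are distributed; the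
        surplus of a later turn is placed arbitrarily.\<close>
      also have "\<mu> \<le> m (Suc (length h))" unfolding \<mu>_def by (rule monoD[OF m]) (simp add: 2)
      finally have "card ?U \<le> m (Suc (length h))" .
      moreover have "finite ?U" "?U \<inter> claimed h = {}" using A W by auto
      ultimately obtain X where X: "?U \<subseteq> X" "legal_move (m (Suc (length h))) (claimed h) X"
        using legal_move_extend[OF fin(3), of ?U "m (Suc (length h))"] by blast
      have "Inv (h @ [(X, Y)])" if Y: "legal_move (b (Suc (length h))) (claimed h \<union> X) Y" for Y
        unfolding Inv_def
      proof (intro allI impI)
        fix k' assume k': "k' \<le> r" "length (h @ [(X, Y)]) = T + k'"
        then have kk: "k' = Suc k" using 2 by simp
        have Yf: "finite Y" "card Y \<le> B" using Y b[OF 2(2)] 2(1) by (auto simp: legal_move_def)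
        \<comment> \<open>B points of Breaker touch at most B rows, exactly the decrease that the
          invariant allows.\<close>
        have "a - B \<le> card (A - snd ` Y)"
        proof -
          have "card (snd ` Y) \<le> B" using card_image_le[OF Yf(1), of snd] Yf(2) by linarith
          moreover have "card A - card (snd ` Y) \<le> card (A - snd ` Y)"
            by (rule diff_card_le_card_Diff) (use Yf in simp)
          ultimately show ?thesis using A(2) by linarith
        qed
        moreover have "1 + B * (r - k') = a - B"
        proof -
          have "r - k = Suc (r - k')" using 2 kk by simp
          then show ?thesis by (simp add: a_def)
        qed
        ultimately obtain A' where A': "A' \<subseteq> A - snd ` Y" "finite A'" "card A' = 1 + B * (r - k')"
          using obtain_subset_with_card_n[of "1 + B * (r - k')" "A - snd ` Y"] by metis
        have "breaker_points (h @ [(X, Y)]) \<inter> lattice_row y = {} \<and>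
            box_gain \<mu> B r k' \<le> card (maker_points (h @ [(X, Y)]) \<inter> lattice_row y)" if y: "y \<in> A'" for y
        proof
          have yA: "y \<in> A" "y \<notin> snd ` Y" using y A' by auto
          then show "breaker_points (h @ [(X, Y)]) \<inter> lattice_row y = {}"
            using Ay(1)[of y] by (force simp: breaker_points_def lattice_row_def)
          have "box_gain \<mu> B r k' = box_gain \<mu> B r k + c" by (simp add: kk box_gain_def c_def a_def)
          also have "\<dots> \<le> card (maker_points h \<inter> lattice_row y) + card (W y)" using Ay(2)[OF yA(1)] by (simp add: W)
          also have "\<dots> = card ((maker_points h \<inter> lattice_row y) \<union> W y)"
            by (rule card_Un_disjoint[symmetric]) (use fin W[of y] in \<open>auto simp: claimed_def\<close>)
          also have "\<dots> \<le> card (maker_points (h @ [(X, Y)]) \<inter> lattice_row y)"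
          proof (rule card_mono)
            show "finite (maker_points (h @ [(X, Y)]) \<inter> lattice_row y)"
              using fin X by (auto simp: maker_points_def legal_move_def)
            show "(maker_points h \<inter> lattice_row y) \<union> W y \<subseteq> maker_points (h @ [(X, Y)]) \<inter> lattice_row y"
              using X(1) W(1)[of y] yA(1) by (auto simp: maker_points_def)
          qed
          finally show "box_gain \<mu> B r k' \<le> card (maker_points (h @ [(X, Y)]) \<inter> lattice_row y)" .
        qed
        then show "\<exists>A. finite A \<and> card A = 1 + B * (r - k') \<and>
           (\<forall>y\<in>A. breaker_points (h @ [(X, Y)]) \<inter> lattice_row y = {} \<and>
             box_gain \<mu> B r k' \<le> card (maker_points (h @ [(X, Y)]) \<inter> lattice_row y))"
          using A' by blast
      qed
      then show ?thesis using X(2) 2 by auto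
    next
      \<comment> \<open>A single intact row is left and receives the whole turn.\<close>
      case 3
      from h(3)[unfolded Inv_def, rule_format, OF order_refl 3]
      obtain A where A: "finite A" "card A = 1 + B * (r - r)"
        and Ay: "\<And>y. y \<in> A \<Longrightarrow> breaker_points h \<inter> lattice_row y = {}"
          "\<And>y. y \<in> A \<Longrightarrow> box_gain \<mu> B r r \<le> card (maker_points h \<inter> lattice_row y)"
        by blast
      have "A \<noteq> {}" using A by auto
      then obtain y where y: "y \<in> A" by blast
      obtain X where X: "X \<subseteq> lattice_row y - claimed h" "finite X" "card X = m (Suc (T + r))"
        using row_free_points[OF fin(3)] by blast
      let ?Q = "(maker_points h \<inter> lattice_row y) \<union> X"
      have "card ?Q = card (maker_points h \<inter> lattice_row y) + card X"
        by (rule card_Un_disjoint) (use fin X in \<open>auto simp: claimed_def\<close>)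
      then have "n \<le> card ?Q" using n(2) Ay(2)[OF y] X(3) by (simp add: \<mu>_def)
      then obtain S where S: "S \<subseteq> ?Q" "card S = n" "finite S"
        by (rule obtain_subset_with_card_n)
      have "winning_segment n (maker_points h \<union> X) (breaker_points h) S"
        by (rule winning_segment_row[where y = y]) (use S X n Ay(1)[OF y] in auto)
      moreover have "legal_move (m (Suc (length h))) (claimed h) X"
        using X 3 by (auto simp: legal_move_def)
      ultimately show ?thesis by blast
    qed
  qed
qed

text \<open>After replacing 1 + B j by 2 B j the shares form a harmonic sum; rounding down loses at
  most one point in each of the r turns.\<close>

lemma box_gain_ge:
  assumes B: "B \<ge> 1"
  shows "real \<mu> * ln (real r + 1) / (2 * real B) - real r \<le> real (box_gain \<mu> B r r)"
proof -
  have "real (box_gain \<mu> B r r) = (\<Sum>j<r. real (\<mu> div (1 + B * (r - j))))" by (simp add: box_gain_def)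
  also have "\<dots> = (\<Sum>j=1..r. real (\<mu> div (1 + B * j)))"
    by (rule sum.reindex_bij_witness[of _ "\<lambda>j. r - j" "\<lambda>j. r - j"]) auto
  also have "\<dots> \<ge> (\<Sum>j=1..r. real \<mu> / (2 * real B) * inverse (real j) - 1)"
  proof (rule sum_mono)
    fix j assume j: "j \<in> {1..r}"
    have "B \<ge> 1" "j \<ge> 1" using B j by auto
    then have "B * j \<ge> 1" by (metis mult_le_mono mult_1)
    then have "real (1 + B * j) \<le> real (2 * (B * j))" by (intro of_nat_mono) simp
    then have "real (1 + B * j) \<le> 2 * real B * real j" by simp
    then have "real \<mu> / (2 * real B * real j) \<le> real \<mu> / real (1 + B * j)"
      by (intro divide_left_mono) (use B j in auto)
    also have "\<dots> \<le> real (\<mu> div (1 + B * j)) + 1"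
      using floor_divide_of_nat_eq[of \<mu> "1 + B * j", where 'a = real] by linarith
    finally show "real \<mu> / (2 * real B) * inverse (real j) - 1 \<le> real (\<mu> div (1 + B * j))"
      by (simp add: field_simps)
  qed
  also have "(\<Sum>j=1..r. real \<mu> / (2 * real B) * inverse (real j) - 1) = real \<mu> / (2 * real B) * harm r - r"
    by (simp add: harm_def sum_subtractf sum_distrib_left)
  finally have "real \<mu> / (2 * real B) * harm r - r \<le> real (box_gain \<mu> B r r)" .
  moreover have "real \<mu> / (2 * real B) * ln (real r + 1) \<le> real \<mu> / (2 * real B) * harm r"
    by (intro mult_left_mono ln_le_harm) auto
  ultimately show ?thesis by simp
qed

section \<open>Asymptotics\<close>

lemma power_moves_le: "real (power_moves \<alpha> t) \<le> real t powr \<alpha>"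
  by (simp add: power_moves_def)

lemma power_moves_gt: "real t powr \<alpha> - 1 < real (power_moves \<alpha> t)"
proof -
  have "\<lfloor>real t powr \<alpha>\<rfloor> \<ge> 0" by simp
  then show ?thesis unfolding power_moves_def by linarith
qed

lemma power_moves_ge: "real k \<le> real t powr \<alpha> \<Longrightarrow> k \<le> power_moves \<alpha> t"
  unfolding power_moves_def by (simp add: le_nat_floor)

lemma mono_power_moves: "\<alpha> \<ge> 0 \<Longrightarrow> mono (power_moves \<alpha>)"
  unfolding power_moves_def by (intro monoI nat_mono floor_mono powr_mono2) auto

lemma le_power_moves:
  assumes "\<alpha> \<ge> 1"
  shows "t \<le> power_moves \<alpha> t"
proof (rule power_moves_ge, cases "t = 0")
  case False
  then have "real t powr 1 \<le> real t powr \<alpha>" using assms by (intro powr_mono) auto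
  then show "real t \<le> real t powr \<alpha>" using False by simp
qed simp

lemma power_moves_tau_le:
  assumes "\<alpha> \<ge> 0" "maker_guarantees (power_moves \<alpha>) b n T"
  shows "power_moves \<alpha> (tau (power_moves \<alpha>) b n) \<le> power_moves \<alpha> T"
  unfolding tau_def by (rule monoD[OF mono_power_moves[OF assms(1)]]) (rule Least_le[of "maker_guarantees (power_moves \<alpha>) b n", OF assms(2)])

text \<open>The box strategy with r = 0: a fresh row filled in one turn. It shows that the minimum
  defining \<open>tau\<close> is attained and bounds it from above.\<close>

lemma maker_guarantees_one_line:
  assumes \<alpha>: "\<alpha> \<ge> 0" and n: "n \<ge> 1" and T: "T \<ge> 1" "n \<le> power_moves \<alpha> T"
  shows "maker_guarantees (power_moves \<alpha>) b n T"
proof -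
  have "maker_guarantees (power_moves \<alpha>) b n (Suc (T - 1 + 0))"
    by (rule maker_box_strategy[OF mono_power_moves[OF \<alpha>]]) (use n T in auto)
  then show ?thesis using T by simp
qed

text \<open>Rounding the time x^(1/\<alpha>) up to an integer changes the turn size only by a factor
  1 + o(1).\<close>

lemma tendsto_shifted_powr_ratio:
  assumes \<alpha>: "\<alpha> > 0"
  shows "((\<lambda>x::real. (x powr (1 / \<alpha>) + 1) powr \<alpha> / x) \<longlongrightarrow> 1) at_top"
proof -
  have "((\<lambda>x::real. x powr (- (1 / \<alpha>))) \<longlongrightarrow> 0) at_top"
    using \<alpha> by (intro tendsto_neg_powr filterlim_ident) auto
  then have "((\<lambda>x::real. (1 + x powr (- (1 / \<alpha>))) powr \<alpha>) \<longlongrightarrow> (1 + 0) powr \<alpha>) at_top"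
    by (intro tendsto_intros) auto
  moreover have "eventually (\<lambda>x::real. (1 + x powr (- (1 / \<alpha>))) powr \<alpha> = (x powr (1 / \<alpha>) + 1) powr \<alpha> / x) at_top"
    using eventually_gt_at_top[of 0]
  proof eventually_elim
    case (elim x)
    have "x powr (1 / \<alpha>) + 1 = x powr (1 / \<alpha>) * (1 + x powr (- (1 / \<alpha>)))"
      using elim by (simp add: distrib_left flip: powr_add)
    then have "(x powr (1 / \<alpha>) + 1) powr \<alpha> = (x powr (1 / \<alpha>)) powr \<alpha> * (1 + x powr (- (1 / \<alpha>))) powr \<alpha>"
      by (simp add: powr_mult)
    also have "(x powr (1 / \<alpha>)) powr \<alpha> = x" using elim \<alpha> by (simp add: powr_powr)
    finally show ?case using elim by simp
  qed
  ultimately have "((\<lambda>x::real. (x powr (1 / \<alpha>) + 1) powr \<alpha> / x) \<longlongrightarrow> (1 + 0) powr \<alpha>) at_top"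
    by (rule Lim_transform_eventually)
  then show ?thesis by simp
qed

definition root_time :: "real \<Rightarrow> real \<Rightarrow> nat" where
  "root_time \<alpha> x = nat \<lceil>x powr (1 / \<alpha>)\<rceil>"

lemma root_time:
  assumes \<alpha>: "\<alpha> > 0" and x: "x > 0"
  shows "x powr (1 / \<alpha>) \<le> real (root_time \<alpha> x)" "real (root_time \<alpha> x) < x powr (1 / \<alpha>) + 1"
    "x \<le> real (root_time \<alpha> x) powr \<alpha>" "root_time \<alpha> x \<ge> 1"
    "real (power_moves \<alpha> (root_time \<alpha> x)) \<le> (x powr (1 / \<alpha>) + 1) powr \<alpha>"
proof -
  have p: "x powr (1 / \<alpha>) > 0" using x by simp
  show l: "x powr (1 / \<alpha>) \<le> real (root_time \<alpha> x)" unfolding root_time_def by linarith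
  show u: "real (root_time \<alpha> x) < x powr (1 / \<alpha>) + 1" unfolding root_time_def using p by linarith
  have "x = (x powr (1 / \<alpha>)) powr \<alpha>" using x \<alpha> by (simp add: powr_powr)
  also have "\<dots> \<le> real (root_time \<alpha> x) powr \<alpha>" using l \<alpha> by (intro powr_mono2) auto
  finally show "x \<le> real (root_time \<alpha> x) powr \<alpha>" .
  show "root_time \<alpha> x \<ge> 1" using l p by linarith
  have "real (power_moves \<alpha> (root_time \<alpha> x)) \<le> real (root_time \<alpha> x) powr \<alpha>" by (rule power_moves_le)
  also have "\<dots> \<le> (x powr (1 / \<alpha>) + 1) powr \<alpha>" using u \<alpha> by (intro powr_mono2) auto
  finally show "real (power_moves \<alpha> (root_time \<alpha> x)) \<le> (x powr (1 / \<alpha>) + 1) powr \<alpha>" .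
qed

text \<open>Each of the three terms of \<open>err\<close> is pushed below \<epsilon> n / 32. The
  term with n log n / B forces B to exceed a large multiple of ln n; for the last one B only has to
  exceed a constant.\<close>

lemma eventually_err_le:
  fixes B :: "nat \<Rightarrow> nat" and \<epsilon> :: real
  assumes \<epsilon>: "0 < \<epsilon>" "\<epsilon> < 1"
    and B: "eventually (\<lambda>n. real (B n) \<ge> (2048 / \<epsilon>) ^ 3 * ln (real n)) sequentially"
  shows "eventually (\<lambda>n. err n (B n) \<le> \<epsilon> * real n / 8) sequentially"
proof -
  \<comment> \<open>As ln n \<ge> 1, also B \<ge> C, and the cube turns this into B^(-1/3) \<le>
    \<epsilon> / 2048 with 2048 = 64 times 32. The second term needs C \<ge> 576 / \<epsilon> with
    576 = 18 times 32.\<close>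
  define C where "C = (2048 / \<epsilon>) ^ 3"
  have C: "C > 0" "C \<ge> 576 / \<epsilon>"
  proof -
    have "2048 / \<epsilon> \<ge> 1" using \<epsilon> by simp
    then have "(2048 / \<epsilon>) ^ 1 \<le> C" unfolding C_def by (intro power_increasing) auto
    moreover have "576 / \<epsilon> \<le> 2048 / \<epsilon>" using \<epsilon> by (simp add: field_simps)
    ultimately show "C \<ge> 576 / \<epsilon>" by simp
    show "C > 0" using \<epsilon> by (simp add: C_def)
  qed
  have "((\<lambda>n::nat. ln (real n) / real n) \<longlongrightarrow> 0) sequentially" by real_asymp
  then have "eventually (\<lambda>n::nat. ln (real n) / real n < \<epsilon> / 192) sequentially"
    using \<epsilon> by (intro order_tendstoD) auto
  moreover have "eventually (\<lambda>n::nat. ln (real n) \<ge> 1) sequentially" by real_asymp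
  moreover have "eventually (\<lambda>n::nat. n > 0) sequentially" by (rule eventually_gt_at_top)
  ultimately show ?thesis using B
  proof eventually_elim
    case (elim n)
    have CB: "C \<le> C * ln n" "C * ln n \<le> real (B n)" using elim C by (auto simp: C_def)
    then have B0: "real (B n) > 0" using C by linarith
    have lg: "1 + log 2 n > 0" using elim by (simp add: add_pos_nonneg)
    have lg3: "1 + log 2 n \<le> 3 * ln n"
    proof -
      have "ln (real n) * (2/3) \<le> ln (real n) * ln 2"
        using elim ln2_ge_two_thirds by (intro mult_left_mono) auto
      then have "log 2 n \<le> 3/2 * ln n" by (simp add: log_def field_simps)
      then show ?thesis using elim by linarith
    qed
    have t1: "2 * (1 + log 2 n) \<le> \<epsilon> * n / 32"
    proof -
      have "2 * (1 + log 2 n) \<le> 6 * ln n" using lg3 by simp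
      also have "\<dots> \<le> 6 * (\<epsilon> / 192 * n)" using elim by (simp add: field_simps)
      finally show ?thesis by simp
    qed
    have t2: "(1 + log 2 n) * (6 * n / B n) \<le> \<epsilon> * n / 32"
    proof -
      have "(1 + log 2 n) * (6 * n / B n) \<le> (3 * ln n) * (6 * n / (C * ln n))"
      proof (intro mult_mono frac_le)
        show "0 < C * ln n" using CB C by linarith
      qed (use elim lg3 CB lg in auto)
      also have "\<dots> = 18 * n / C"
      proof -
        have "(3 * l) * (6 * x / (C * l)) = 18 * x / C" if "l > 0" for l x :: real
          using that C by (simp add: field_simps)
        then show ?thesis using elim(2) by simp
      qed
      also have "\<dots> \<le> 18 * n / (576 / \<epsilon>)" using C \<epsilon> by (intro divide_left_mono) auto
      also have "\<dots> = \<epsilon> * n / 32" using \<epsilon> by simp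
      finally show ?thesis .
    qed
    have t3: "64 * (n * real (B n) powr (-1/3)) \<le> \<epsilon> * n / 32"
    proof -
      have "C \<le> real (B n)" using CB by linarith
      then have "real (B n) powr (-1/3) \<le> C powr (-1/3)"
        using C by (intro powr_mono2') auto
      also have "\<dots> = (2048 / \<epsilon>) powr (-1)"
      proof -
        have "C = (2048 / \<epsilon>) powr 3" using \<epsilon> by (simp add: C_def)
        then have "C powr (-1/3) = (2048 / \<epsilon>) powr (3 * (-1/3))" by (simp only: powr_powr)
        then show ?thesis by simp
      qed
      also have "\<dots> = \<epsilon> / 2048" using \<epsilon> by (simp add: powr_minus_divide)
      finally have "real n * real (B n) powr (-1/3) \<le> real n * (\<epsilon> / 2048)" by (rule mult_left_mono) simp
      then show ?thesis by (simp add: algebra_simps)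
    qed
    have "err n (B n) = 2 * (1 + log 2 n) + (1 + log 2 n) * (6 * n / B n) + 64 * (n * real (B n) powr (-1/3))"
      by (simp add: err_def algebra_simps)
    then show ?case using t1 t2 t3 mult_nonneg_nonneg[of \<epsilon> "real n"] \<epsilon> by linarith
  qed
qed

text \<open>The hypothesis compares b(t) with ln t, the counting needs B against ln n. From time
  a(n), a small power of n, both logarithms agree up to a constant, and earlier Maker has at most
  n^(1/3) turns of at most n^(1/3) points.\<close>

lemma eventually_breaker_prevents:
  fixes \<alpha> \<epsilon> :: real and b :: "nat \<Rightarrow> nat"
  assumes \<alpha>: "\<alpha> \<ge> 1" and b: "mono b" and om: "(\<lambda>t. real (b t)) \<in> \<omega>(\<lambda>t. ln (real t))"
    and \<epsilon>: "0 < \<epsilon>" "\<epsilon> < 1"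
  shows "eventually (\<lambda>n. \<forall>T. real (power_moves \<alpha> T) \<le> (1 - \<epsilon>) * real n \<longrightarrow>
           \<not> maker_guarantees (power_moves \<alpha>) b n T) sequentially"
proof -
  \<comment> \<open>The price of treating one segment: with H = 2 n and g \<ge> \<epsilon> n / 8
    there are at most 16 / \<epsilon> marks, and two points are claimed at each.\<close>
  define K where "K = 2 * nat \<lceil>16 / \<epsilon>\<rceil>"
  have K: "K > 0" using \<epsilon> by (simp add: K_def)
  define a where "a n = nat \<lfloor>real n powr (1 / (3 * \<alpha>))\<rfloor>" for n :: nat
  define B where "B n = b (a n) div K" for n
  define g where "g n = nat \<lceil>\<epsilon> * real n / 8\<rceil>" for n :: nat
  have x_top: "filterlim (\<lambda>n::nat. real n powr (1 / (3 * \<alpha>))) at_top sequentially"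
    using \<alpha> by real_asymp
  have a_top: "filterlim a at_top sequentially"
    unfolding a_def
    by (rule filterlim_compose[OF filterlim_nat_sequentially filterlim_compose[OF filterlim_floor_sequentially x_top]])
  have B_big: "eventually (\<lambda>n. real (B n) \<ge> C * ln (real n)) sequentially" if C: "C > 0" for C
  proof -
    \<comment> \<open>The factor 6 \<alpha> converts ln a(n) into ln n, K undoes the division in B,
      and the extra 1 in C + 1 pays for rounding down since ln n \<ge> 1.\<close>
    define c where "c = 6 * \<alpha> * real K * (C + 1)"
    have c: "c > 0" using \<alpha> K C by (simp add: c_def)
    have "eventually (\<lambda>t. norm (real (b t)) \<ge> c * norm (ln (real t))) at_top"
      using landau_omega.smallD[OF om c] by simp
    then have "eventually (\<lambda>n. real (b (a n)) \<ge> c * \<bar>ln (real (a n))\<bar>) sequentially"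
      using a_top by (auto simp: filterlim_iff)
    moreover have "eventually (\<lambda>n. real n powr (1 / (3 * \<alpha>)) \<ge> 4) sequentially"
      using x_top by (auto simp: filterlim_at_top)
    moreover have "eventually (\<lambda>n::nat. ln (real n) \<ge> 1) sequentially" by real_asymp
    moreover have "eventually (\<lambda>n::nat. n > 0) sequentially" by (rule eventually_gt_at_top)
    ultimately show ?thesis
    proof eventually_elim
      case (elim n)
      define x where "x = real n powr (1 / (3 * \<alpha>))"
      have x: "x \<ge> 4" using elim by (simp add: x_def)
      have "real (a n) \<ge> x - 1" unfolding a_def x_def by linarith
      then have ax: "real (a n) \<ge> x / 2" using x by linarith
      have "sqrt x \<le> x / 2"
      proof -
        have "sqrt x * 2 \<le> sqrt x * sqrt x"
          using x real_le_rsqrt[of 2 x] by (intro mult_left_mono) auto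
        then show ?thesis using x by simp
      qed
      then have "ln (sqrt x) \<le> ln (real (a n))" using x ax by (subst ln_le_cancel_iff) auto
      moreover have "ln (sqrt x) = ln (real n) / (6 * \<alpha>)"
        using x elim \<alpha> by (simp add: ln_sqrt x_def ln_powr)
      ultimately have la: "ln (real n) / (6 * \<alpha>) \<le> \<bar>ln (real (a n))\<bar>" by linarith
      have "real K * (C + 1) * ln (real n) = c * (ln (real n) / (6 * \<alpha>))" using \<alpha> by (simp add: c_def)
      also have "\<dots> \<le> c * \<bar>ln (real (a n))\<bar>" using la c by (intro mult_left_mono) auto
      also have "\<dots> \<le> real (b (a n))" using elim by simp
      finally have "(C + 1) * ln (real n) \<le> real (b (a n)) / real K" using K by (simp add: field_simps)
      also have "\<dots> \<le> real (B n) + 1"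
        using floor_divide_of_nat_eq[of "b (a n)" K, where 'a = real] unfolding B_def by linarith
      finally show ?case using elim by (simp add: algebra_simps)
    qed
  qed
  have "(2048 / \<epsilon>) ^ 3 > 0" using \<epsilon> by simp
  from eventually_err_le[OF \<epsilon> B_big[OF this]]
  have "eventually (\<lambda>n. err n (B n) \<le> \<epsilon> * real n / 8) sequentially" .
  moreover have "eventually (\<lambda>n. real (B n) \<ge> 1 * ln (real n)) sequentially" by (rule B_big) simp
  moreover have "eventually (\<lambda>n::nat. ln (real n) \<ge> 1) sequentially" by real_asymp
  moreover have "eventually (\<lambda>n::nat. real n powr (2/3) \<le> \<epsilon> * real n / 8) sequentially"
    using \<epsilon> by real_asymp
  moreover have "eventually (\<lambda>n::nat. 4 < \<epsilon> * real n) sequentially" using \<epsilon> by real_asymp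
  moreover have "eventually (\<lambda>n::nat. n \<ge> 2) sequentially" by (rule eventually_ge_at_top)
  ultimately show ?thesis
  proof eventually_elim
    case (elim n)
    have n0: "real n > 0" using elim by simp
    have g: "\<epsilon> * n / 8 \<le> g n" "g n < \<epsilon> * n / 8 + 1"
    proof -
      have "0 < \<epsilon> * n / 8" using \<epsilon> n0 by simp
      then show "\<epsilon> * n / 8 \<le> g n" "g n < \<epsilon> * n / 8 + 1" unfolding g_def by linarith+
    qed
    have g0: "g n > 0" using g(1) \<epsilon> n0 by (metis of_nat_0_less_iff less_le_trans divide_pos_pos mult_pos_pos zero_less_numeral)
    have Kg: "2 * (2 * n div g n) \<le> K"
    proof -
      have "real (2 * n div g n) \<le> real (2 * n) / real (g n)"
        using floor_divide_of_nat_eq[of "2 * n" "g n", where 'a = real] by linarith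
      also have "\<dots> \<le> real (2 * n) / (\<epsilon> * n / 8)" 
      proof (intro frac_le)
        show "0 < \<epsilon> * real n / 8" using \<epsilon> n0 by simp
      qed (use g in auto)
      also have "\<dots> = 16 / \<epsilon>" using \<epsilon> n0 by (simp add: field_simps)
      finally have "2 * n div g n \<le> nat \<lceil>16 / \<epsilon>\<rceil>" by linarith
      then show ?thesis by (simp add: K_def)
    qed
    have early: "(\<Sum>t<a n. power_moves \<alpha> (Suc t)) \<le> g n"
    proof -
      define x where "x = real n powr (1 / (3 * \<alpha>))"
      have ax: "real (a n) \<le> x" unfolding a_def x_def by simp
      have "x \<le> real n powr (1/3)" unfolding x_def using \<alpha> elim by (intro powr_mono) (auto simp: field_simps)
      moreover have "x powr \<alpha> = real n powr (1/3)" unfolding x_def using \<alpha> by (simp add: powr_powr)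
      moreover have "real (power_moves \<alpha> (a n)) \<le> x powr \<alpha>"
        using power_moves_le[of \<alpha> "a n"] powr_mono2[OF _ _ ax, of \<alpha>] \<alpha> by simp
      ultimately have "real (a n) * real (power_moves \<alpha> (a n)) \<le> real n powr (1/3) * real n powr (1/3)"
        using ax by (intro mult_mono) auto
      also have "\<dots> = real n powr (2/3)" by (simp flip: powr_add)
      finally have "real (a n * power_moves \<alpha> (a n)) \<le> real (g n)" using elim g by simp
      then have "a n * power_moves \<alpha> (a n) \<le> g n" by (simp only: of_nat_le_iff)
      moreover have "(\<Sum>t<a n. power_moves \<alpha> (Suc t)) \<le> (\<Sum>t<a n. power_moves \<alpha> (a n))"
        by (rule sum_mono, rule monoD[OF mono_power_moves]) (use \<alpha> in auto)
      ultimately show ?thesis by simp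
    qed
    show ?case
    proof (intro allI impI)
      fix T assume T: "real (power_moves \<alpha> T) \<le> (1 - \<epsilon>) * real n"
      have le: "(1 - \<epsilon>) * real n \<le> real n" using \<epsilon> n0 by (simp add: algebra_simps)
      show "\<not> maker_guarantees (power_moves \<alpha>) b n T"
      proof (rule breaker_prevents[where \<mu> = "power_moves \<alpha> T" and g = "g n" and B = "B n" and H = "2 * n" and a = "a n"])
        show "T \<le> n" using le_power_moves[OF \<alpha>, of T] T le by linarith
        show "power_moves \<alpha> T \<le> n" using T le by linarith
        show "power_moves \<alpha> (Suc t) \<le> power_moves \<alpha> T" if "t < T" for t
          by (rule monoD[OF mono_power_moves]) (use \<alpha> that in auto)
        show "B n \<ge> 1" using elim by linarith
        have "real (g n) + err n (B n) + real (power_moves \<alpha> T) < (\<epsilon> * n / 8 + 1) + \<epsilon> * n / 8 + (1 - \<epsilon>) * n"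
          using g elim T by linarith
        also have "\<dots> < real n" using elim by (simp add: algebra_simps)
        finally show lt: "real (g n) + err n (B n) + real (power_moves \<alpha> T) < real n" .
        then show "real (g n) + err n (B n) + real (power_moves \<alpha> T) \<le> real (2 * n)" by simp
        show "B n * (2 * (2 * n div g n)) \<le> b (Suc t)" if "a n \<le> t" for t
        proof -
          have "B n * (2 * (2 * n div g n)) \<le> B n * K" using Kg by (rule mult_left_mono) simp
          also have "\<dots> \<le> b (a n)" by (simp add: B_def)
          also have "\<dots> \<le> b (Suc t)" using that by (intro monoD[OF b]) simp
          finally show ?thesis .
        qed
      qed (use elim g0 early in auto)
    qed
  qed
qed

text \<open>The ratio of m(tau) to n is squeezed to 1: from above by filling one row in a single
  turn, from below because Maker cannot guarantee a win at a time with m(T) \<le> (1 - \<epsilon>)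
  n.\<close>

lemma breaker_win_if_omega:
  fixes \<alpha> :: real and b :: "nat \<Rightarrow> nat"
  assumes \<alpha>: "\<alpha> \<ge> 1" and b: "mono b" and om: "(\<lambda>t. real (b t)) \<in> \<omega>(\<lambda>t. ln (real t))"
  shows "breaker_win (power_moves \<alpha>) b"
proof -
  let ?m = "power_moves \<alpha>"
  define q where "q n = real (?m (tau ?m b n)) / real n" for n
  have g1: "maker_guarantees ?m b n (root_time \<alpha> n)" if "n \<ge> 1" for n
    by (rule maker_guarantees_one_line) (use \<alpha> that root_time[of \<alpha> "real n"] in \<open>auto intro!: power_moves_ge\<close>)
  have upper: "eventually (\<lambda>n. q n \<le> (real n powr (1 / \<alpha>) + 1) powr \<alpha> / real n) sequentially"
    using eventually_ge_at_top[of 1]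
  proof eventually_elim
    case (elim n)
    have "real (?m (tau ?m b n)) \<le> real (?m (root_time \<alpha> n))"
      using power_moves_tau_le[OF _ g1[OF elim]] \<alpha> by simp
    also have "\<dots> \<le> (real n powr (1 / \<alpha>) + 1) powr \<alpha>" by (rule root_time) (use \<alpha> elim in auto)
    finally show ?case unfolding q_def by (rule divide_right_mono) simp
  qed
  have lim: "((\<lambda>n::nat. (real n powr (1 / \<alpha>) + 1) powr \<alpha> / real n) \<longlongrightarrow> 1) sequentially"
    by (rule filterlim_compose[OF tendsto_shifted_powr_ratio filterlim_real_sequentially]) (use \<alpha> in simp)
  have lower: "eventually (\<lambda>n. q n > 1 - \<epsilon>) sequentially" if \<epsilon>: "0 < \<epsilon>" "\<epsilon> < 1" for \<epsilon>
    using eventually_breaker_prevents[OF \<alpha> b om \<epsilon>] eventually_ge_at_top[of 1]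
  proof eventually_elim
    case (elim n)
    have "maker_guarantees ?m b n (tau ?m b n)" unfolding tau_def by (rule LeastI[of "maker_guarantees ?m b n", OF g1[OF elim(2)]])
    then have "\<not> real (?m (tau ?m b n)) \<le> (1 - \<epsilon>) * real n" using elim(1) by blast
    then show ?case using elim(2) by (simp add: q_def field_simps)
  qed
  have "q \<longlonglongrightarrow> 1"
  proof (rule order_tendstoI)
    fix l :: real assume "l < 1"
    define \<epsilon> where "\<epsilon> = min (1 - l) (1/2)"
    have "0 < \<epsilon>" "\<epsilon> < 1" "l \<le> 1 - \<epsilon>" using \<open>l < 1\<close> by (auto simp: \<epsilon>_def)
    from lower[OF this(1,2)] show "eventually (\<lambda>n. l < q n) sequentially"
      by (rule eventually_mono) (use \<open>l \<le> 1 - \<epsilon>\<close> in simp)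
  next
    fix u :: real assume "1 < u"
    from order_tendstoD(2)[OF lim this] upper show "eventually (\<lambda>n. q n < u) sequentially"
      by eventually_elim simp
  qed
  then have "(\<lambda>n. 1 - q n) \<longlonglongrightarrow> 1 - 1" by (intro tendsto_intros)
  then have "(\<lambda>n. 1 - q n) \<in> o(\<lambda>_. 1)" by (intro smalloI_tendsto) auto
  moreover have "eventually (\<lambda>n. real (?m (tau ?m b n)) = (1 - (1 - q n)) * real n) sequentially"
    using eventually_gt_at_top[of 0] by eventually_elim (simp add: q_def)
  ultimately show ?thesis unfolding breaker_win_def by blast
qed

text \<open>The box game fills the last r, about sqrt T, turns before T. This is long enough for ln
  r to be about half of ln T, which cancels the logarithm in b, and short enough that turn sizes
  stay comparable with m(T) and that losing one point per turn is negligible.\<close>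

lemma maker_win_if_bigo:
  fixes \<alpha> :: real and b :: "nat \<Rightarrow> nat"
  assumes \<alpha>: "\<alpha> \<ge> 1" and b: "mono b" and O: "(\<lambda>t. real (b t)) \<in> O(\<lambda>t. ln (real t))"
  shows "maker_win (power_moves \<alpha>) b"
proof -
  let ?m = "power_moves \<alpha>"
  obtain c where c: "c > 0" "eventually (\<lambda>t. norm (real (b t)) \<le> c * norm (ln (real t))) at_top"
    using landau_o.bigE[OF O] by blast
  define C where "C = c + 1"
  have C: "C \<ge> 1" using c by (simp add: C_def)
  have "eventually (\<lambda>t::nat. ln (real t) \<ge> 1) at_top" by real_asymp
  with c(2) have bC: "eventually (\<lambda>t. real (b t) + 1 \<le> C * ln (real t)) at_top"
    by eventually_elim (simp add: C_def algebra_simps)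
  \<comment> \<open>Chosen so that the box game is worth about 4 \<epsilon> n points, while \<theta>
    leaves a deficit of 2 \<epsilon> n. The other half pays for rounding.\<close>
  define \<epsilon> where "\<epsilon> = 2 powr (- \<alpha>) / (32 * C)"
  define \<theta> where "\<theta> = 1 - 2 * \<epsilon>"
  have p2: "0 < 2 powr (- \<alpha>)" "2 powr (- \<alpha>) \<le> 1"
  proof -
    show "0 < 2 powr (- \<alpha>)" by simp
    have "2 powr (- \<alpha>) \<le> 2 powr 0" using \<alpha> by (intro powr_mono) auto
    then show "2 powr (- \<alpha>) \<le> 1" by simp
  qed
  have \<epsilon>: "0 < \<epsilon>" "\<epsilon> \<le> 1 / 32" using p2 C by (auto simp: \<epsilon>_def field_simps)
  have \<theta>: "\<theta> \<ge> 1/2" "\<theta> < 1" using \<epsilon> by (auto simp: \<theta>_def)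
  define T where "T n = root_time \<alpha> (\<theta> * real n)" for n :: nat
  have T_top: "filterlim T at_top sequentially"
  proof -
    have "filterlim (\<lambda>n::nat. (\<theta> * real n) powr (1 / \<alpha>)) at_top sequentially"
      using \<alpha> \<theta> by real_asymp
    then have "filterlim (\<lambda>n. real (T n)) at_top sequentially"
      by (rule filterlim_at_top_mono) (auto simp: T_def root_time_def)
    then show ?thesis by (simp add: filterlim_sequentially_iff_filterlim_real)
  qed
  have lim: "((\<lambda>n::nat. ((\<theta> * real n) powr (1 / \<alpha>) + 1) powr \<alpha> / (\<theta> * real n)) \<longlongrightarrow> 1) sequentially"
    by (rule filterlim_compose[OF tendsto_shifted_powr_ratio]) (use \<alpha> \<theta> in \<open>simp, real_asymp\<close>)
  \<comment> \<open>The gap between 1 - 2 \<epsilon> and 1 - \<epsilon> is the room for rounding T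
    up.\<close>
  have "1 < (1 - \<epsilon>) / \<theta>" using \<theta> \<epsilon> by (simp add: \<theta>_def field_simps)
  note ev = order_tendstoD(2)[OF lim this]
  have evT: "eventually (\<lambda>n. real (b (T n)) + 1 \<le> C * ln (real (T n))) sequentially"
    using bC T_top by (auto simp: filterlim_iff)
  have ev4: "eventually (\<lambda>n. T n \<ge> 4) sequentially" using T_top by (auto simp: filterlim_at_top)
  have ev5: "eventually (\<lambda>n::nat. 1 + 1 / (4 * C) + sqrt (real n + 1) \<le> 2 * \<epsilon> * real n) sequentially"
    using \<epsilon> C by real_asymp
  have "eventually (\<lambda>n. real (?m (tau ?m b n)) < (1 - \<epsilon>) * real n) sequentially"
    using ev evT ev4 ev5 eventually_ge_at_top[of 1]
  proof eventually_elim
    case (elim n)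
    have x0: "\<theta> * real n > 0" using elim \<theta> by simp
    note rt = root_time[OF _ x0, of \<alpha>, folded T_def]
    define r where "r = nat \<lfloor>sqrt (real (T n))\<rfloor>"
    define t where "t = T n - 1 - r"
    have sq: "sqrt (real (T n)) \<le> real (T n) / 2"
    proof -
      have "sqrt (T n) * 2 \<le> sqrt (T n) * sqrt (T n)"
        using elim real_le_rsqrt[of 2 "T n"] by (intro mult_left_mono) auto
      then show ?thesis by simp
    qed
    have r: "real r \<le> sqrt (T n)" "sqrt (T n) < real r + 1" unfolding r_def by (simp, linarith)
    have rT: "real r \<le> real (T n) / 2" using r sq by linarith
    have tr: "Suc (t + r) = T n" using rT elim unfolding t_def by linarith
    \<comment> \<open>All box turns come after half of the time T, so their sizes are at least about
      2^(-\<alpha>) times \<theta> n.\<close>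
    have St: "real (Suc t) \<ge> real (T n) / 2" using rT tr by linarith
    define B where "B = b (T n) + 1"
    have lnT: "ln (real (T n)) > 0" using elim by simp
    have lr: "1 / (4 * C) \<le> ln (real r + 1) / (2 * real B)"
    proof -
      have "ln (real (T n)) / 2 = ln (sqrt (T n))" using elim by (simp add: ln_sqrt)
      also have "\<dots> \<le> ln (real r + 1)" using r elim by (subst ln_le_cancel_iff) auto
      finally have l: "ln (real (T n)) / 2 \<le> ln (real r + 1)" .
      have "1 / (4 * C) = (ln (real (T n)) / 2) / (2 * (C * ln (real (T n))))" using lnT C by (simp add: field_simps)
      also have "\<dots> \<le> ln (real r + 1) / (2 * real B)"
        using l elim lnT C by (intro frac_le) (auto simp: B_def)
      finally show ?thesis .
    qed
    have \<mu>: "real (?m (Suc t)) \<ge> 2 powr (- \<alpha>) * (\<theta> * real n) - 1"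
    proof -
      have "2 powr (- \<alpha>) * (\<theta> * real n) \<le> 2 powr (- \<alpha>) * real (T n) powr \<alpha>"
        using rt(3) \<alpha> by (intro mult_left_mono) auto
      also have "\<dots> = (real (T n) / 2) powr \<alpha>" by (simp add: powr_divide powr_minus_divide)
      also have "\<dots> \<le> real (Suc t) powr \<alpha>" using St \<alpha> by (intro powr_mono2) auto
      finally show ?thesis using power_moves_gt[of "Suc t" \<alpha>] by linarith
    qed
    have "real (T n) \<le> real n + 1"
    proof -
      have "(\<theta> * real n) powr (1 / \<alpha>) \<le> real n powr (1 / \<alpha>)"
        using \<theta> \<alpha> by (intro powr_mono2) (auto simp: mult_left_le_one_le)
      also have "\<dots> \<le> real n powr 1" using \<alpha> elim by (intro powr_mono) auto
      finally show ?thesis using rt(2) \<alpha> by simp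
    qed
    then have rn: "real r \<le> sqrt (real n + 1)" using r(1) by (meson order_trans real_sqrt_le_mono)
    \<comment> \<open>The deficit left by the last turn is below 2 \<epsilon> n + 1, while the gain
      is at least 4 \<epsilon> n - 1 / (4 C) - r with r \<le> sqrt (n + 1).\<close>
    have "real n \<le> real (box_gain (?m (Suc t)) B r r) + real (?m (T n))"
    proof -
      have "1/2 * real n \<le> \<theta> * real n" using \<theta> by (intro mult_right_mono) auto
      then have "2 powr (- \<alpha>) * (real n / 2) \<le> 2 powr (- \<alpha>) * (\<theta> * real n)"
        by (intro mult_left_mono) auto
      then have "2 powr (- \<alpha>) * (real n / 2) - 1 \<le> real (?m (Suc t))" using \<mu> by linarith
      then have "(2 powr (- \<alpha>) * (real n / 2) - 1) * (1 / (4 * C)) \<le> real (?m (Suc t)) * (1 / (4 * C))"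
        by (rule mult_right_mono) (use C in simp)
      also have "\<dots> \<le> real (?m (Suc t)) * (ln (real r + 1) / (2 * real B))"
        using lr by (intro mult_left_mono) auto
      finally have "(2 powr (- \<alpha>) * (real n / 2) - 1) * (1 / (4 * C)) - sqrt (real n + 1) \<le> real (box_gain (?m (Suc t)) B r r)"
        using box_gain_ge[of B "?m (Suc t)" r] rn by (simp add: B_def)
      moreover have "(2 powr (- \<alpha>) * (real n / 2) - 1) * (1 / (4 * C)) = 4 * \<epsilon> * real n - 1 / (4 * C)"
        using C by (simp add: \<epsilon>_def field_simps)
      moreover have "real (?m (T n)) > \<theta> * real n - 1"
        using power_moves_gt[of "T n" \<alpha>] rt(3) \<alpha> by linarith
      moreover have "\<theta> * real n = real n - 2 * \<epsilon> * real n" by (simp add: \<theta>_def algebra_simps)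
      ultimately show ?thesis using elim by linarith
    qed
    then have "real n \<le> real (box_gain (?m (Suc t)) B r r + ?m (Suc (t + r)))" by (simp add: tr)
    then have nle: "n \<le> box_gain (?m (Suc t)) B r r + ?m (Suc (t + r))" by (simp only: of_nat_le_iff)
    have "maker_guarantees ?m b n (Suc (t + r))"
    proof (rule maker_box_strategy[OF mono_power_moves _ _ nle])
      show "b (Suc (t + k)) \<le> B" if "k < r" for k
        using monoD[OF b, of "Suc (t + k)" "T n"] that tr by (simp add: B_def)
    qed (use \<alpha> elim in auto)
    then have "real (?m (tau ?m b n)) \<le> real (?m (T n))"
      using power_moves_tau_le[of \<alpha> b n "T n"] \<alpha> tr by simp
    also have "\<dots> \<le> ((\<theta> * real n) powr (1 / \<alpha>) + 1) powr \<alpha>" using rt(5) \<alpha> by simp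
    also have "\<dots> < (1 - \<epsilon>) * real n"
    proof -
      have "((\<theta> * real n) powr (1 / \<alpha>) + 1) powr \<alpha> < (1 - \<epsilon>) / \<theta> * (\<theta> * real n)"
        using elim(1) x0 by (simp only: pos_divide_less_eq)
      also have "\<dots> = (1 - \<epsilon>) * real n" using \<theta> by simp
      finally show ?thesis .
    qed
    finally show ?case .
  qed
  then show ?thesis unfolding maker_win_def using \<epsilon> by blast
qed

theorem theorem2:
  fixes \<alpha> :: real and b :: "nat \<Rightarrow> nat"
  assumes "\<alpha> \<ge> 1" and "mono b"
  shows "((\<lambda>t. real (b t)) \<in> O(\<lambda>t. ln (real t)) \<longrightarrow> maker_win (power_moves \<alpha>) b) \<and>
         ((\<lambda>t. real (b t)) \<in> \<omega>(\<lambda>t. ln (real t)) \<longrightarrow> breaker_win (power_moves \<alpha>) b)"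
  using maker_win_if_bigo[OF assms] breaker_win_if_omega[OF assms] by blast

end
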